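(* Let $T>0$, let $(u_{\mathrm{ini}},\xi_{\mathrm{ini}})$ be admissible initial data, and let $\xi_0$, $q_0$, $f_0$ and $p_0=q_0-f_0$ be limits, along a subsequence $\varepsilon\to0$, of the functions $\xi_\varepsilon,q_\varepsilon,f_\varepsilon,p_\varepsilon$ produced by the scheme, in the sense described in the context. Then the following holds. 1. (Weak formulation of the PDE.) For all $\varphi\in C_c^\infty((0,T)\times\mathbb{R})$, $$\int_0^T\!\int_{\mathbb{R}}p_0(t,x)\,\partial_x^2\varphi(t,x)\,dx\,dt=-\int_0^T\!\int_{\mathbb{R}}\big(p_0(t,x)+\mathrm{sgn}(x-\xi_0(t))\big)\,\partial_t\varphi(t,x)\,dx\,dt .$$ 2. (Bounds for $p$.) The function $p_0$ is continuous and satisfies $$-1\le p_0(t,x)\le+1\quad\text{for } x\le\xi_0(t),\qquad -1\le p_0(t,x)\quad\text{for } x\ge\xi_0(t)$$ at any $t\in[0,T]$. 3. (Hysteretic flow rule.) The estimate $\dot\xi_0(t)\le0$ holds for almost all $t\in[0,T]$, and for almost all $t\in[0,T]$ we have $\dot\xi_0(t)=0$ in case of $p_0(t,\xi_0(t))<1$. 4. (Further regularity.) The functions $f_0$ and $p_0$ admit a weak spatial derivative in $L^2([0,T]\times\mathbb{R})$ and $L^1_{\mathrm{loc}}([0,T]\times\mathbb{R})$, respectively.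
   Context: Kernels: $g_\varepsilon(x)=\frac{1}{2\varepsilon}\exp(-|x|/\varepsilon)$; $s_\varepsilon(x)=-\exp(x/\varepsilon)$ for $x\le0$, $s_\varepsilon(x)=+\exp(-x/\varepsilon)$ for $x>0$. Write $g_\varepsilon^{\ast k}$ for the $k$-fold convolution power ($g_\varepsilon^{\ast0}\ast$ is the identity). Scheme: starting from $(u^0,\xi^0)=(u_{\mathrm{ini}},\xi_{\mathrm{ini}})$, define $(u^{n+1},\xi^{n+1})$ from $(u^n,\xi^n)$ as follows. 1. Set $\tilde u^n:=g_\varepsilon\ast u^n$. 2. If $\tilde u^n(\xi^n)>1$, choose the maximal $\xi^{n+1}<\xi^n$ with $\tilde u^n(\xi^{n+1})=+1$; if $\tilde u^n(\xi^n)<-1$, choose the minimal $\xi^{n+1}>\xi^n$ with $\tilde u^n(\xi^{n+1})=-1$; if $\tilde u^n(\xi^n)\in[-1,1]$, set $\xi^{n+1}=\xi^n$. 3. Set $u^{n+1}=\tilde u^n+s_\varepsilon(\cdot-\xi^{n+1})$. Admissible single-interface state $(u,\xi)$: (i) $u:\mathbb{R}\to\mathbb{R}$ is continuous for $x<\xi$ and for $x>\xi$; (ii) $\lim_{x\searrow\xi}u(x)-\lim_{x\nearrow\xi}u(x)=2$; (iii) $-2\le u(x)\le0$ for $x\le\xi$ and $u(x)\ge0$ for $x>\xi$; (iv) there is $\alpha>0$ with $u(x)\le\alpha(x-\xi)+2$ for all $x>\xi$. Admissibility with the same $\alpha$ is preserved by the iteration step. Admissible initial data (independent of $\varepsilon$):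 $(u_{\mathrm{ini}},\xi_{\mathrm{ini}})$ is an admissible single-interface state, $\xi_{\mathrm{ini}}=0$, and $p_{\mathrm{ini}}=u_{\mathrm{ini}}-\mathrm{sgn}(\cdot-\xi_{\mathrm{ini}})$ (extended continuously to $x=\xi_{\mathrm{ini}}$) has a distributional second derivative that is a signed measure with finite mass. Derived quantities: $p^n:=u^n-\mathrm{sgn}(\cdot-\xi^n)$ (extended continuously to $x=\xi^n$); regular part $q^0:=p^0=p_{\mathrm{ini}}$, $q^{n+1}:=g_\varepsilon\ast q^n$; local fluctuations $r^n:=g_\varepsilon\ast\mathrm{sgn}(\cdot-\xi^{n+1})-g_\varepsilon\ast\mathrm{sgn}(\cdot-\xi^n)$; global fluctuations $f^0:=0$, $f^n:=\sum_{i=1}^ng_\varepsilon^{\ast(n-i)}\ast r^{i-1}$. One has $p^n=q^n-f^n$. Interpolation ($0<\varepsilon^2\le T$): for $t\in[n\varepsilon^2,(n+1)\varepsilon^2)$, $t\in[0,T]$, set $\xi_\varepsilon(t):=\xi^n$, $p_\varepsilon(t,x):=p^n(x)$, $q_\varepsilon(t,x):=q^n(x)$, $f_\varepsilon(t,x):=f^n(x)$. Limits along a subsequence $\varepsilon\to0$ (such subsequences exist): $\xi_\varepsilon\to\xi_0$ in $L^\infty([0,T])$ with $\xi_0\in W^{1,\infty}([0,T])$; $q_\varepsilon\to q_0$ in $L^\infty([0,T]\times\mathbb{R})$ with $q_0\in C([0,T]\times\mathbb{R})$ the solution of $\partial_tq_0=\partial_x^2q_0$, $q_0(0,\cdot)=p_{\mathrm{ini}}$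 (given by convolution with the heat kernel); $f_\varepsilon\to f_0$ pointwise almost everywhere and in $L^\infty(K)$ for every compact $K\subset[0,T]\times\mathbb{R}$ with $f_0\in C([0,T]\times\mathbb{R})$; consequently $p_\varepsilon=q_\varepsilon-f_\varepsilon\to q_0-f_0=:p_0$ in $L^\infty(K)$ for every such $K$ and pointwise almost everywhere. *)

theory Defs
  imports "HOL-Analysis.Analysis" "HOL-Probability.Essential_Supremum"
begin

subsection \<open>Test functions and weak derivatives\<close>

text \<open>For the coordinate directions of the plane of pairs \<open>(t, x)\<close>, the vectors \<open>(1, 0)\<close> and
  \<open>(0, 1)\<close> give the derivatives in \<open>t\<close> and in \<open>x\<close>; on the real line the direction is \<open>1\<close>.\<close>

definition partial_deriv :: "'a::euclidean_space \<Rightarrow> ('a \<Rightarrow> real) \<Rightarrow> 'a \<Rightarrow> real" where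
  "partial_deriv b f x = deriv (\<lambda>s. f (x + s *\<^sub>R b)) 0"

primrec Ck :: "nat \<Rightarrow> ('a::euclidean_space \<Rightarrow> real) \<Rightarrow> bool" where
  "Ck 0 f \<longleftrightarrow> continuous_on UNIV f"
| "Ck (Suc k) f \<longleftrightarrow> continuous_on UNIV f \<and>
     (\<forall>b\<in>Basis. (\<forall>x. (\<lambda>s. f (x + s *\<^sub>R b)) field_differentiable at 0) \<and> Ck k (partial_deriv b f))"

definition test_function :: "'a::euclidean_space set \<Rightarrow> ('a \<Rightarrow> real) \<Rightarrow> bool" where
  "test_function \<Omega> \<phi> \<longleftrightarrow> (\<forall>k. Ck k \<phi>) \<and>
     compact (closure {z. \<phi> z \<noteq> 0}) \<and> closure {z. \<phi> z \<noteq> 0} \<subseteq> \<Omega>"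

definition L1_loc :: "'a::euclidean_space set \<Rightarrow> ('a \<Rightarrow> real) \<Rightarrow> bool" where
  "L1_loc S f \<longleftrightarrow> (\<forall>K. compact K \<and> K \<subseteq> S \<longrightarrow> integrable (lebesgue_on K) f)"

definition L2 :: "'a::euclidean_space set \<Rightarrow> ('a \<Rightarrow> real) \<Rightarrow> bool" where
  "L2 S f \<longleftrightarrow> f \<in> borel_measurable (lebesgue_on S) \<and> integrable (lebesgue_on S) (\<lambda>z. (f z)\<^sup>2)"

text \<open>The values are taken in \<open>ennreal\<close> so that the norm over a null set is \<open>0\<close>
  (the essential supremum in \<open>ereal\<close> would be \<open>- \<infinity>\<close> there).\<close>

definition Linf_norm :: "'a::euclidean_space set \<Rightarrow> ('a \<Rightarrow> real) \<Rightarrow> ennreal" where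
  "Linf_norm S f = esssup (lebesgue_on S) (\<lambda>z. ennreal \<bar>f z\<bar>)"

definition Linf :: "'a::euclidean_space set \<Rightarrow> ('a \<Rightarrow> real) \<Rightarrow> bool" where
  "Linf S f \<longleftrightarrow> f \<in> borel_measurable (lebesgue_on S) \<and> Linf_norm S f < \<infinity>"

definition Linf_tendsto ::
    "'a::euclidean_space set \<Rightarrow> (nat \<Rightarrow> 'a \<Rightarrow> real) \<Rightarrow> ('a \<Rightarrow> real) \<Rightarrow> bool" where
  "Linf_tendsto S F f \<longleftrightarrow> (\<lambda>k. Linf_norm S (\<lambda>z. F k z - f z)) \<longlonglongrightarrow> 0"

definition has_weak_deriv ::
    "'a::euclidean_space \<Rightarrow> 'a set \<Rightarrow> ('a \<Rightarrow> real) \<Rightarrow> ('a \<Rightarrow> real) \<Rightarrow> bool" where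
  "has_weak_deriv b \<Omega> f d \<longleftrightarrow> L1_loc \<Omega> f \<and> L1_loc \<Omega> d \<and>
     (\<forall>\<phi>. test_function \<Omega> \<phi> \<longrightarrow>
        (LINT z|lebesgue_on \<Omega>. f z * partial_deriv b \<phi> z) = - (LINT z|lebesgue_on \<Omega>. d z * \<phi> z))"

text \<open>Points \<open>0\<close> and \<open>T\<close> are included only in the null-set-insensitive norms; the weak
  derivative is tested on the open interval.\<close>

definition W1_inf :: "real \<Rightarrow> (real \<Rightarrow> real) \<Rightarrow> bool" where
  "W1_inf T f \<longleftrightarrow> Linf {0..T} f \<and> (\<exists>d. Linf {0..T} d \<and> has_weak_deriv 1 {0<..<T} f d)"

text \<open>A signed measure with finite mass is given as the difference \<open>M - N\<close> of two finite
  Borel measures.\<close>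

definition second_deriv_finite_signed_measure :: "(real \<Rightarrow> real) \<Rightarrow> bool" where
  "second_deriv_finite_signed_measure p \<longleftrightarrow>
     (\<exists>M N. finite_measure M \<and> sets M = sets borel \<and> finite_measure N \<and> sets N = sets borel \<and>
        (\<forall>\<phi>. test_function UNIV \<phi> \<longrightarrow>
           (LINT x|lborel. p x * deriv (deriv \<phi>) x) = (LINT x|M. \<phi> x) - (LINT x|N. \<phi> x)))"


subsection \<open>The scheme\<close>

definition conv :: "(real \<Rightarrow> real) \<Rightarrow> (real \<Rightarrow> real) \<Rightarrow> real \<Rightarrow> real" where
  "conv g h x = (LINT y|lborel. g (x - y) * h y)"

definition g_ker :: "real \<Rightarrow> real \<Rightarrow> real" where
  "g_ker \<epsilon> x = 1 / (2 * \<epsilon>) * exp (- \<bar>x\<bar> / \<epsilon>)"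

definition s_ker :: "real \<Rightarrow> real \<Rightarrow> real" where
  "s_ker \<epsilon> x = (if x \<le> 0 then - exp (x / \<epsilon>) else exp (- x / \<epsilon>))"

text \<open>\<open>conv_power_Suc g k\<close> is the \<open>(k + 1)\<close>-fold convolution power of \<open>g\<close>; the zeroth power
  is not a function and only occurs as the identity operator in \<open>g_pow_conv\<close>.\<close>

primrec conv_power_Suc :: "(real \<Rightarrow> real) \<Rightarrow> nat \<Rightarrow> real \<Rightarrow> real" where
  "conv_power_Suc g 0 = g"
| "conv_power_Suc g (Suc k) = conv g (conv_power_Suc g k)"

definition g_pow_conv :: "real \<Rightarrow> nat \<Rightarrow> (real \<Rightarrow> real) \<Rightarrow> real \<Rightarrow> real" where
  "g_pow_conv \<epsilon> k h = (case k of 0 \<Rightarrow> h | Suc m \<Rightarrow> conv (conv_power_Suc (g_ker \<epsilon>) m) h)"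

definition next_interface :: "(real \<Rightarrow> real) \<Rightarrow> real \<Rightarrow> real" where
  "next_interface v \<xi> =
     (if v \<xi> > 1 then (GREATEST y. y < \<xi> \<and> v y = 1)
      else if v \<xi> < - 1 then (LEAST y. y > \<xi> \<and> v y = - 1)
      else \<xi>)"

definition scheme_step :: "real \<Rightarrow> (real \<Rightarrow> real) \<times> real \<Rightarrow> (real \<Rightarrow> real) \<times> real" where
  "scheme_step \<epsilon> = (\<lambda>(u, \<xi>).
     let v = conv (g_ker \<epsilon>) u; \<xi>' = next_interface v \<xi>
     in (\<lambda>x. v x + s_ker \<epsilon> (x - \<xi>'), \<xi>'))"

definition scheme :: "real \<Rightarrow> (real \<Rightarrow> real) \<Rightarrow> real \<Rightarrow> nat \<Rightarrow> (real \<Rightarrow> real) \<times> real" where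
  "scheme \<epsilon> u \<xi> n = (scheme_step \<epsilon> ^^ n) (u, \<xi>)"

definition u_seq :: "real \<Rightarrow> (real \<Rightarrow> real) \<Rightarrow> real \<Rightarrow> nat \<Rightarrow> real \<Rightarrow> real" where
  "u_seq \<epsilon> u \<xi> n = fst (scheme \<epsilon> u \<xi> n)"

definition xi_seq :: "real \<Rightarrow> (real \<Rightarrow> real) \<Rightarrow> real \<Rightarrow> nat \<Rightarrow> real" where
  "xi_seq \<epsilon> u \<xi> n = snd (scheme \<epsilon> u \<xi> n)"


subsection \<open>Admissibility\<close>

definition admissible_state :: "(real \<Rightarrow> real) \<Rightarrow> real \<Rightarrow> bool" where
  "admissible_state u \<xi> \<longleftrightarrow>
     continuous_on {..<\<xi>} u \<and> continuous_on {\<xi><..} u \<and>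
     (\<exists>l r. (u \<longlongrightarrow> l) (at_left \<xi>) \<and> (u \<longlongrightarrow> r) (at_right \<xi>) \<and> r - l = 2) \<and>
     (\<forall>x\<le>\<xi>. - 2 \<le> u x \<and> u x \<le> 0) \<and> (\<forall>x>\<xi>. u x \<ge> 0) \<and>
     (\<exists>\<alpha>>0. \<forall>x>\<xi>. u x \<le> \<alpha> * (x - \<xi>) + 2)"

text \<open>\<open>u - sgn (\<cdot> - \<xi>)\<close>, extended continuously to \<open>\<xi>\<close>.\<close>

definition p_of :: "(real \<Rightarrow> real) \<Rightarrow> real \<Rightarrow> real \<Rightarrow> real" where
  "p_of u \<xi> x = (if x = \<xi> then Lim (at \<xi>) (\<lambda>y. u y - sgn (y - \<xi>)) else u x - sgn (x - \<xi>))"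

definition admissible_initial_data :: "(real \<Rightarrow> real) \<Rightarrow> real \<Rightarrow> bool" where
  "admissible_initial_data u \<xi> \<longleftrightarrow>
     admissible_state u \<xi> \<and> \<xi> = 0 \<and> second_deriv_finite_signed_measure (p_of u \<xi>)"


subsection \<open>Derived quantities and their interpolation in time\<close>

definition p_seq :: "real \<Rightarrow> (real \<Rightarrow> real) \<Rightarrow> real \<Rightarrow> nat \<Rightarrow> real \<Rightarrow> real" where
  "p_seq \<epsilon> u \<xi> n = p_of (u_seq \<epsilon> u \<xi> n) (xi_seq \<epsilon> u \<xi> n)"

primrec q_seq :: "real \<Rightarrow> (real \<Rightarrow> real) \<Rightarrow> real \<Rightarrow> nat \<Rightarrow> real \<Rightarrow> real" where
  "q_seq \<epsilon> u \<xi> 0 = p_of u \<xi>"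
| "q_seq \<epsilon> u \<xi> (Suc n) = conv (g_ker \<epsilon>) (q_seq \<epsilon> u \<xi> n)"

definition r_seq :: "real \<Rightarrow> (real \<Rightarrow> real) \<Rightarrow> real \<Rightarrow> nat \<Rightarrow> real \<Rightarrow> real" where
  "r_seq \<epsilon> u \<xi> n x =
     conv (g_ker \<epsilon>) (\<lambda>y. sgn (y - xi_seq \<epsilon> u \<xi> (Suc n))) x
     - conv (g_ker \<epsilon>) (\<lambda>y. sgn (y - xi_seq \<epsilon> u \<xi> n)) x"

definition f_seq :: "real \<Rightarrow> (real \<Rightarrow> real) \<Rightarrow> real \<Rightarrow> nat \<Rightarrow> real \<Rightarrow> real" where
  "f_seq \<epsilon> u \<xi> n x = (\<Sum>i=1..n. g_pow_conv \<epsilon> (n - i) (r_seq \<epsilon> u \<xi> (i - 1)) x)"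

text \<open>The index \<open>n\<close> with \<open>n \<epsilon>\<^sup>2 \<le> t < (n + 1) \<epsilon>\<^sup>2\<close>, for \<open>t \<ge> 0\<close>.\<close>

definition time_index :: "real \<Rightarrow> real \<Rightarrow> nat" where
  "time_index \<epsilon> t = nat \<lfloor>t / \<epsilon>\<^sup>2\<rfloor>"

definition xi_eps :: "real \<Rightarrow> (real \<Rightarrow> real) \<Rightarrow> real \<Rightarrow> real \<Rightarrow> real" where
  "xi_eps \<epsilon> u \<xi> t = xi_seq \<epsilon> u \<xi> (time_index \<epsilon> t)"

definition p_eps :: "real \<Rightarrow> (real \<Rightarrow> real) \<Rightarrow> real \<Rightarrow> real \<times> real \<Rightarrow> real" where
  "p_eps \<epsilon> u \<xi> = (\<lambda>(t, x). p_seq \<epsilon> u \<xi> (time_index \<epsilon> t) x)"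

definition q_eps :: "real \<Rightarrow> (real \<Rightarrow> real) \<Rightarrow> real \<Rightarrow> real \<times> real \<Rightarrow> real" where
  "q_eps \<epsilon> u \<xi> = (\<lambda>(t, x). q_seq \<epsilon> u \<xi> (time_index \<epsilon> t) x)"

definition f_eps :: "real \<Rightarrow> (real \<Rightarrow> real) \<Rightarrow> real \<Rightarrow> real \<times> real \<Rightarrow> real" where
  "f_eps \<epsilon> u \<xi> = (\<lambda>(t, x). f_seq \<epsilon> u \<xi> (time_index \<epsilon> t) x)"


subsection \<open>The heat equation\<close>

definition heat_kernel :: "real \<Rightarrow> real \<Rightarrow> real" where
  "heat_kernel t x = 1 / sqrt (4 * pi * t) * exp (- x\<^sup>2 / (4 * t))"

definition heat_solution :: "real \<Rightarrow> (real \<Rightarrow> real) \<Rightarrow> (real \<times> real \<Rightarrow> real) \<Rightarrow> bool" where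
  "heat_solution T h q \<longleftrightarrow>
     (\<forall>t\<in>{0<..<T}. \<forall>x. \<exists>q' D.
        (\<forall>y. ((\<lambda>z. q (t, z)) has_real_derivative q' y) (at y)) \<and>
        (q' has_real_derivative D) (at x) \<and>
        ((\<lambda>s. q (s, x)) has_real_derivative D) (at t)) \<and>
     (\<forall>x. q (0, x) = h x) \<and>
     (\<forall>t\<in>{0<..T}. \<forall>x. q (t, x) = conv (heat_kernel t) h x)"

end

theory Submission
  imports Defs "HOL-Probability.Distributions"
begin

text \<open>
  With \<open>w = p\<^sup>n + sgn(x - \<xi>\<^sup>n) - sgn(x - \<xi>\<^sup>n\<^sup>+\<^sup>1)\<close> one has \<open>p\<^sup>n\<^sup>+\<^sup>1 = g * w\<close>, and \<open>\<epsilon>\<^sup>2 (g * w)'' = g * w - w\<close> says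
  that \<open>p + sgn(x - \<xi>)\<close> satisfies an implicit Euler scheme for the heat equation; testing it and
  shifting the test function in time gives the weak formulation. A Harnack inequality for
  \<open>g\<close> shows that the one-sided bounds on \<open>u\<close> persist and that the interface only moves to the
  left, whence the bounds on \<open>p\<close> and the sign of the velocity. When the interface moves, \<open>p = 1\<close> at
  its new position, so the interface is locally constant where \<open>p0 < 1\<close>.

  The fluctuations satisfy \<open>f\<^sup>n\<^sup>+\<^sup>1 = g * (f\<^sup>n + \<rho>\<^sup>n)\<close> with \<open>\<rho>\<^sup>n \<ge> 0\<close> of mass \<open>2 (\<xi>\<^sup>n - \<xi>\<^sup>n\<^sup>+\<^sup>1)\<close>. The energy inequality
  \<open>2 \<epsilon>\<^sup>2 \<integral>(g * w)'\<^sup>2 + \<integral>(g * w)\<^sup>2 \<le> \<integral>w\<^sup>2\<close>, summed over the steps, bounds the spatial derivatives of \<open>f\<close> in \<open>L\<^sup>2\<close>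
  by the total displacement of the interface, and a weak limit of them is the derivative of \<open>f0\<close>. The
  derivative of \<open>q0\<close> is of order \<open>(1 + \<bar>x\<bar>) / \<surd>t\<close> by an estimate for the heat kernel.
\<close>

subsection \<open>The exponential kernel\<close>

text \<open>The iterates have little smoothness: \<open>g_ker\<close> has a corner,
  \<open>s_ker\<close> jumps, and the states need be neither integrable nor bounded. Every
  derivative is therefore moved to a test function by duality or represented by the kernel
  \<open>dg_ker\<close>, and growth in x is tamed by the exponential decay of the kernel. The source
  \<open>s_ker\<close> is tied to the scheme by \<open>sgn - g * sgn = s\<close> off the jump:
  adding it means smoothing u minus the sign at the new interface. It also carries exactly the decay
  factor of the Harnack inequality, which is why the sign bounds survive a step. A second obstacle
  is that all convergence is almost everywhere or in \<open>Linf_norm\<close>, whereas the bounds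
  for p and the flow rule concern single points and the discrete interface. Passages between the two
  use that a property valid almost everywhere holds somewhere in every nonempty open set, combined
  with continuity of the limits, or of the iterates in x.\<close>

definition dg_ker :: "real \<Rightarrow> real \<Rightarrow> real" where
  "dg_ker \<epsilon> x = - sgn x / \<epsilon> * g_ker \<epsilon> x"

text \<open>Admissible states may grow linearly to the right of the interface, so integrability
  classes do not contain them. This class does, and convolution with \<open>g_ker\<close> preserves
  it.\<close>

definition lin_growth :: "(real \<Rightarrow> real) \<Rightarrow> bool" where
  "lin_growth w \<longleftrightarrow> w \<in> borel_measurable borel \<and> (\<exists>A. \<forall>x. \<bar>w x\<bar> \<le> A * (1 + \<bar>x\<bar>))"

lemma g_ker_measurable [measurable]: "g_ker \<epsilon> \<in> borel_measurable borel"
  unfolding g_ker_def by measurable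

lemma dg_ker_measurable [measurable]: "dg_ker \<epsilon> \<in> borel_measurable borel"
  unfolding dg_ker_def by measurable

lemma conv_measurable [measurable]:
  assumes [measurable]: "k \<in> borel_measurable borel" "w \<in> borel_measurable borel"
  shows "conv k w \<in> borel_measurable borel"
  unfolding conv_def by measurable

lemma g_ker_nonneg: "\<epsilon> > 0 \<Longrightarrow> g_ker \<epsilon> x \<ge> 0"
  by (simp add: g_ker_def)

lemma g_ker_even [simp]: "g_ker \<epsilon> (- x) = g_ker \<epsilon> x"
  by (simp add: g_ker_def)

lemma dg_ker_odd [simp]: "dg_ker \<epsilon> (- x) = - dg_ker \<epsilon> x"
  by (simp add: dg_ker_def)

lemma has_bochner_integral_exp_atLeast:
  fixes a c :: real
  assumes "c > 0"
  shows "has_bochner_integral lborel (\<lambda>x. indicator {a..} x * exp (- (c * x))) (exp (- (c * a)) / c)"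
proof (rule has_bochner_integral_nn_integral)
  have *: "filterlim (\<lambda>x. - (c * x)) at_bot at_top"
    using filterlim_tendsto_pos_mult_at_top[OF tendsto_const assms filterlim_ident]
    by (simp add: filterlim_uminus_at_bot)
  have lim: "((\<lambda>x. - (exp (- (c * x)) / c)) \<longlongrightarrow> - (0 / c)) at_top"
    by (intro tendsto_minus tendsto_divide filterlim_compose[OF exp_at_bot *] tendsto_const) (use assms in auto)
  have "(\<integral>\<^sup>+x. ennreal (exp (- (c * x))) * indicator {a..} x \<partial>lborel)
        = ennreal (- (0 / c) - (- (exp (- (c * a)) / c)))"
    by (rule nn_integral_FTC_atLeast[OF _ _ _ lim])
       (use assms in \<open>auto intro!: derivative_eq_intros\<close>)
  then show "(\<integral>\<^sup>+x. ennreal (indicator {a..} x * exp (- (c * x))) \<partial>lborel) = ennreal (exp (- (c * a)) / c)"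
    by (simp add: ennreal_mult ennreal_indicator mult.commute)
qed (use assms in auto)

lemma has_bochner_integral_even_exp:
  fixes c :: real
  assumes "c > 0"
  shows "has_bochner_integral lborel (\<lambda>x. exp (- (c * \<bar>x\<bar>))) (2 / c)"
proof -
  have "has_bochner_integral lborel (\<lambda>x. indicator {0..} x *\<^sub>R exp (- (c * \<bar>x\<bar>))) (1 / c)"
    using has_bochner_integral_exp_atLeast[OF assms, of 0]
    by (subst has_bochner_integral_cong[OF refl _ refl]) (auto split: split_indicator)
  from has_bochner_integral_even_function[OF this] show ?thesis by simp
qed

lemma integrable_exp_abs: "c > 0 \<Longrightarrow> integrable lborel (\<lambda>x::real. exp (- (c * \<bar>x\<bar>)))"
  using has_bochner_integral_even_exp by (simp add: has_bochner_integral_iff)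

lemma has_bochner_integral_g_ker:
  assumes "\<epsilon> > 0" shows "has_bochner_integral lborel (g_ker \<epsilon>) 1"
proof -
  have "has_bochner_integral lborel (\<lambda>x. 1 / (2 * \<epsilon>) * exp (- (1 / \<epsilon> * \<bar>x\<bar>))) (1 / (2 * \<epsilon>) * (2 / (1 / \<epsilon>)))"
    by (intro has_bochner_integral_mult_right has_bochner_integral_even_exp) (use assms in auto)
  moreover have "(\<lambda>x. 1 / (2 * \<epsilon>) * exp (- (1 / \<epsilon> * \<bar>x\<bar>))) = g_ker \<epsilon>"
    by (auto simp: g_ker_def fun_eq_iff)
  moreover have "1 / (2 * \<epsilon>) * (2 / (1 / \<epsilon>)) = 1" using assms by simp
  ultimately show ?thesis by simp
qed

lemma integrable_g_ker: "\<epsilon> > 0 \<Longrightarrow> integrable lborel (g_ker \<epsilon>)"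
  and integral_g_ker: "\<epsilon> > 0 \<Longrightarrow> (LINT x|lborel. g_ker \<epsilon> x) = 1"
  using has_bochner_integral_g_ker by (auto simp: has_bochner_integral_iff)

lemma integrable_dg_ker: "\<epsilon> > 0 \<Longrightarrow> integrable lborel (dg_ker \<epsilon>)"
  by (rule Bochner_Integration.integrable_bound[OF integrable_mult_right[OF integrable_g_ker[of \<epsilon>], of "1/\<epsilon>"]])
     (auto simp: dg_ker_def abs_mult g_ker_nonneg sgn_if)

text \<open>Half of the exponential decay absorbs the weight, because |z| <= 2\<epsilon> exp(|z| /
  (2\<epsilon>)); this is the origin of the factor 1 + 2\<epsilon> in \<open>?C\<close>.\<close>

lemma integrable_weighted_g_ker:
  assumes "\<epsilon> > 0" shows "integrable lborel (\<lambda>z. g_ker \<epsilon> z * (1 + \<bar>z\<bar>))"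
proof (rule Bochner_Integration.integrable_bound)
  let ?C = "1 / (2 * \<epsilon>) * (1 + 2 * \<epsilon>)"
  show "integrable lborel (\<lambda>z. ?C * exp (- (1 / (2 * \<epsilon>) * \<bar>z\<bar>)))"
    by (intro integrable_mult_right integrable_exp_abs) (use assms in auto)
  have "norm (g_ker \<epsilon> z * (1 + \<bar>z\<bar>)) \<le> norm (?C * exp (- (1 / (2 * \<epsilon>) * \<bar>z\<bar>)))" for z
  proof -
    let ?e = "exp (\<bar>z\<bar> / (2 * \<epsilon>))"
    have "\<bar>z\<bar> / (2 * \<epsilon>) \<le> ?e" using exp_ge_add_one_self[of "\<bar>z\<bar> / (2 * \<epsilon>)"] by linarith
    then have "\<bar>z\<bar> \<le> 2 * \<epsilon> * ?e" using assms by (simp add: field_simps)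
    moreover have "1 \<le> ?e" using assms by simp
    ultimately have "1 + \<bar>z\<bar> \<le> ?e + 2 * \<epsilon> * ?e" by linarith
    then have "1 + \<bar>z\<bar> \<le> (1 + 2 * \<epsilon>) * ?e" by (simp only: distrib_right mult_1)
    then have "exp (- \<bar>z\<bar> / \<epsilon>) * (1 + \<bar>z\<bar>) \<le> exp (- \<bar>z\<bar> / \<epsilon>) * ((1 + 2 * \<epsilon>) * ?e)"
      by (intro mult_left_mono) auto
    also have "\<dots> = (1 + 2 * \<epsilon>) * exp (- (1 / (2 * \<epsilon>) * \<bar>z\<bar>))"
      using assms by (simp add: mult_exp_exp[symmetric] ac_simps) (simp add: mult_exp_exp field_simps)
    finally have "1 / (2 * \<epsilon>) * (exp (- \<bar>z\<bar> / \<epsilon>) * (1 + \<bar>z\<bar>)) \<le> 1 / (2 * \<epsilon>) * ((1 + 2 * \<epsilon>) * exp (- (1 / (2 * \<epsilon>) * \<bar>z\<bar>)))"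
      by (intro mult_left_mono) (use assms in auto)
    then show ?thesis using assms by (simp add: g_ker_def abs_mult)
  qed
  then show "AE z in lborel. norm (g_ker \<epsilon> z * (1 + \<bar>z\<bar>)) \<le> norm (?C * exp (- (1 / (2 * \<epsilon>) * \<bar>z\<bar>)))"
    by simp
qed measurable

text \<open>Splits a growth bound in y into a factor depending on x and a weight in x - y, which the
  kernel at x - y can absorb.\<close>

lemma weight_submult: "1 + \<bar>y::real\<bar> \<le> (1 + \<bar>x\<bar>) * (1 + \<bar>x - y\<bar>)"
proof -
  have "\<bar>y\<bar> \<le> \<bar>x\<bar> + \<bar>x - y\<bar>" by linarith
  moreover have "0 \<le> \<bar>x\<bar> * \<bar>x - y\<bar>" by simp
  ultimately show ?thesis unfolding distrib_left distrib_right by linarith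
qed

lemma lborel_integral_reflect: "(LINT y|lborel. f (x - y)) = (LINT y|lborel. f (y::real) :: real)"
  using lborel_integral_real_affine[of "-1" f x] by simp

lemma lborel_integrable_reflect: "integrable lborel (\<lambda>y. f (x - y) :: real) \<longleftrightarrow> integrable lborel (f :: real \<Rightarrow> real)"
  using lborel_integrable_real_affine_iff[of "-1" f x] by simp

lemma lborel_integral_shift: "(LINT y|lborel. f (x + y)) = (LINT y|lborel. f (y::real) :: real)"
  using lborel_integral_real_affine[of "1" f x] by simp

lemma lborel_integrable_shift: "integrable lborel (\<lambda>y. f (x + y) :: real) \<longleftrightarrow> integrable lborel (f :: real \<Rightarrow> real)"
  using lborel_integrable_real_affine_iff[of "1" f x] by simp

section \<open>Functions of linear growth and their convolutions\<close>

lemma lin_growthD: "lin_growth w \<Longrightarrow> w \<in> borel_measurable borel"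
  by (simp add: lin_growth_def)

lemma lin_growth_bound:
  assumes "lin_growth w"
  obtains A where "A \<ge> 0" "\<And>x. \<bar>w x\<bar> \<le> A * (1 + \<bar>x\<bar>)"
proof -
  from assms obtain A where A: "\<And>x. \<bar>w x\<bar> \<le> A * (1 + \<bar>x\<bar>)" by (auto simp: lin_growth_def)
  have "0 \<le> A" using A[of 0] abs_ge_zero[of "w 0"] by (simp del: abs_ge_zero)
  with A that show thesis by blast
qed

lemma lin_growth_conv_bound:
  assumes "lin_growth w" "\<epsilon> > 0"
  obtains A where "A \<ge> 0" "\<And>x y. \<bar>g_ker \<epsilon> (x - y) * w y\<bar> \<le> A * (1 + \<bar>x\<bar>) * (g_ker \<epsilon> (x - y) * (1 + \<bar>x - y\<bar>))"
proof -
  obtain A where A: "A \<ge> 0" "\<And>x. \<bar>w x\<bar> \<le> A * (1 + \<bar>x\<bar>)" using lin_growth_bound[OF assms(1)] by blast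
  have "\<bar>g_ker \<epsilon> (x - y) * w y\<bar> \<le> A * (1 + \<bar>x\<bar>) * (g_ker \<epsilon> (x - y) * (1 + \<bar>x - y\<bar>))" for x y
  proof -
    have "\<bar>w y\<bar> \<le> A * ((1 + \<bar>x\<bar>) * (1 + \<bar>x - y\<bar>))"
      using A(2)[of y] mult_left_mono[OF weight_submult[of y x] A(1)] by linarith
    from mult_left_mono[OF this g_ker_nonneg[OF assms(2), of "x - y"]] show ?thesis
      by (simp add: abs_mult g_ker_nonneg[OF assms(2)] ac_simps)
  qed
  with A(1) that show thesis by blast
qed

lemma integrable_g_lin:
  assumes "lin_growth w" "\<epsilon> > 0"
  shows "integrable lborel (\<lambda>y. g_ker \<epsilon> (x - y) * w y)"
proof -
  have [measurable]: "w \<in> borel_measurable borel" using assms(1) by (rule lin_growthD)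
  obtain A where A: "A \<ge> 0" "\<And>x y. \<bar>g_ker \<epsilon> (x - y) * w y\<bar> \<le> A * (1 + \<bar>x\<bar>) * (g_ker \<epsilon> (x - y) * (1 + \<bar>x - y\<bar>))"
    using lin_growth_conv_bound[OF assms] by blast
  have "integrable lborel (\<lambda>y. A * (1 + \<bar>x\<bar>) * (g_ker \<epsilon> (x - y) * (1 + \<bar>x - y\<bar>)))"
    using integrable_weighted_g_ker[OF assms(2)] lborel_integrable_reflect[of "\<lambda>z. g_ker \<epsilon> z * (1 + \<bar>z\<bar>)" x]
    by (intro integrable_mult_right) simp
  then show ?thesis
    by (rule Bochner_Integration.integrable_bound) (auto intro: order_trans[OF A(2) abs_ge_self])
qed

lemma lin_growth_conv:
  assumes "lin_growth w" "\<epsilon> > 0"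
  shows "lin_growth (conv (g_ker \<epsilon>) w)"
proof -
  have [measurable]: "w \<in> borel_measurable borel" using assms(1) by (rule lin_growthD)
  obtain A where A: "A \<ge> 0" "\<And>x y. \<bar>g_ker \<epsilon> (x - y) * w y\<bar> \<le> A * (1 + \<bar>x\<bar>) * (g_ker \<epsilon> (x - y) * (1 + \<bar>x - y\<bar>))"
    using lin_growth_conv_bound[OF assms] by blast
  have "\<bar>conv (g_ker \<epsilon>) w x\<bar> \<le> A * (LINT z|lborel. g_ker \<epsilon> z * (1 + \<bar>z\<bar>)) * (1 + \<bar>x\<bar>)" for x
  proof -
    have i: "integrable lborel (\<lambda>y. g_ker \<epsilon> (x - y) * (1 + \<bar>x - y\<bar>))"
      using integrable_weighted_g_ker[OF assms(2)] lborel_integrable_reflect[of "\<lambda>z. g_ker \<epsilon> z * (1 + \<bar>z\<bar>)" x] by simp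
    have "\<bar>conv (g_ker \<epsilon>) w x\<bar> \<le> (LINT y|lborel. \<bar>g_ker \<epsilon> (x - y) * w y\<bar>)"
      unfolding conv_def by (rule integral_abs_bound)
    also have "\<dots> \<le> (LINT y|lborel. A * (1 + \<bar>x\<bar>) * (g_ker \<epsilon> (x - y) * (1 + \<bar>x - y\<bar>)))"
      using A(2) by (intro integral_mono integrable_abs integrable_g_lin assms integrable_mult_right i) auto
    also have "\<dots> = A * (1 + \<bar>x\<bar>) * (LINT y|lborel. g_ker \<epsilon> (x - y) * (1 + \<bar>x - y\<bar>))"
      using i by simp
    also have "(LINT y|lborel. g_ker \<epsilon> (x - y) * (1 + \<bar>x - y\<bar>)) = (LINT z|lborel. g_ker \<epsilon> z * (1 + \<bar>z\<bar>))"
      by (rule lborel_integral_reflect)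
    finally show ?thesis by (simp add: ac_simps)
  qed
  then show ?thesis by (auto simp: lin_growth_def)
qed

lemma lin_growth_add: 
  assumes "lin_growth v" "lin_growth w" shows "lin_growth (\<lambda>x. v x + w x)"
proof -
  obtain A B where "\<And>x. \<bar>v x\<bar> \<le> A * (1 + \<bar>x\<bar>)" "\<And>x. \<bar>w x\<bar> \<le> B * (1 + \<bar>x\<bar>)"
    using assms by (auto simp: lin_growth_def)
  then have "\<bar>v x + w x\<bar> \<le> (A + B) * (1 + \<bar>x\<bar>)" for x
    unfolding distrib_right by (rule order_trans[OF abs_triangle_ineq add_mono])
  then show ?thesis using assms by (auto simp: lin_growth_def)
qed

lemma lin_growth_minus: "lin_growth w \<Longrightarrow> lin_growth (\<lambda>x. - w x)"
  by (auto simp: lin_growth_def)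

lemma lin_growth_diff: "lin_growth v \<Longrightarrow> lin_growth w \<Longrightarrow> lin_growth (\<lambda>x. v x - w x)"
  using lin_growth_add[OF _ lin_growth_minus, of v w] by simp

lemma lin_growth_bounded:
  assumes "w \<in> borel_measurable borel" "\<And>x. \<bar>w x\<bar> \<le> B" shows "lin_growth w"
proof -
  have "\<bar>w x\<bar> \<le> B * (1 + \<bar>x\<bar>)" for x
  proof -
    have "0 \<le> B" using assms(2)[of 0] abs_ge_zero[of "w 0"] by linarith
    then show ?thesis using assms(2)[of x] by (simp add: algebra_simps add_increasing2)
  qed
  then show ?thesis using assms by (auto simp: lin_growth_def)
qed

lemma lin_growth_sgn: "lin_growth (\<lambda>x. sgn (x - a))"
  by (rule lin_growth_bounded[of _ 1]) (auto simp: sgn_if)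

lemma conv_add: "lin_growth v \<Longrightarrow> lin_growth w \<Longrightarrow> \<epsilon> > 0 \<Longrightarrow> conv (g_ker \<epsilon>) (\<lambda>x. v x + w x) x = conv (g_ker \<epsilon>) v x + conv (g_ker \<epsilon>) w x"
  unfolding conv_def using integrable_g_lin[of v \<epsilon> x] integrable_g_lin[of w \<epsilon> x]
  by (simp add: distrib_left)

lemma conv_diff: "lin_growth v \<Longrightarrow> lin_growth w \<Longrightarrow> \<epsilon> > 0 \<Longrightarrow> conv (g_ker \<epsilon>) (\<lambda>x. v x - w x) x = conv (g_ker \<epsilon>) v x - conv (g_ker \<epsilon>) w x"
  unfolding conv_def using integrable_g_lin[of v \<epsilon> x] integrable_g_lin[of w \<epsilon> x]
  by (simp add: right_diff_distrib)

lemma conv_minus: "conv k (\<lambda>x. - w x) x = - conv k w x"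
  unfolding conv_def by simp

lemma conv_const: "\<epsilon> > 0 \<Longrightarrow> conv (g_ker \<epsilon>) (\<lambda>_. c) x = c"
  unfolding conv_def using lborel_integral_reflect[of "g_ker \<epsilon>" x]
  by (simp add: integral_g_ker)

text \<open>The triangle inequality in the exponent. It becomes an equality when a lies between x
  and y, which is the case of \<open>g_ker_between\<close>.\<close>

lemma g_ker_compare:
  assumes "\<epsilon> > 0" shows "exp (- \<bar>x - a\<bar> / \<epsilon>) * g_ker \<epsilon> (a - y) \<le> g_ker \<epsilon> (x - y)"
proof -
  have "- \<bar>x - a\<bar> / \<epsilon> + - \<bar>a - y\<bar> / \<epsilon> \<le> - \<bar>x - y\<bar> / \<epsilon>"
    using assms by (simp add: divide_simps)
  then have "exp (- \<bar>x - a\<bar> / \<epsilon>) * exp (- \<bar>a - y\<bar> / \<epsilon>) \<le> exp (- \<bar>x - y\<bar> / \<epsilon>)"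
    by (simp add: mult_exp_exp)
  then have "1 / (2 * \<epsilon>) * (exp (- \<bar>x - a\<bar> / \<epsilon>) * exp (- \<bar>a - y\<bar> / \<epsilon>)) \<le> 1 / (2 * \<epsilon>) * exp (- \<bar>x - y\<bar> / \<epsilon>)"
    using assms by (intro mult_left_mono) auto
  then show ?thesis by (simp add: g_ker_def ac_simps)
qed

lemma g_ker_between:
  assumes "\<epsilon> > 0" "x \<le> a \<and> a \<le> y \<or> y \<le> a \<and> a \<le> x"
  shows "exp (- \<bar>x - a\<bar> / \<epsilon>) * g_ker \<epsilon> (a - y) = g_ker \<epsilon> (x - y)"
proof -
  have "- \<bar>x - a\<bar> / \<epsilon> + - \<bar>a - y\<bar> / \<epsilon> = - \<bar>x - y\<bar> / \<epsilon>"
    using assms by (auto simp: divide_simps)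
  then have "exp (- \<bar>x - a\<bar> / \<epsilon>) * exp (- \<bar>a - y\<bar> / \<epsilon>) = exp (- \<bar>x - y\<bar> / \<epsilon>)"
    by (simp add: mult_exp_exp)
  then show ?thesis by (simp add: g_ker_def)
qed

text \<open>A Harnack inequality: the sign of \<open>w\<close> only matters on the side of \<open>a\<close> that contains \<open>x\<close>.\<close>

lemma conv_harnack:
  assumes "lin_growth w" "\<epsilon> > 0" "\<And>y. w y \<ge> 0 \<or> x \<le> a \<and> a \<le> y \<or> y \<le> a \<and> a \<le> x"
  shows "exp (- \<bar>x - a\<bar> / \<epsilon>) * conv (g_ker \<epsilon>) w a \<le> conv (g_ker \<epsilon>) w x"
proof -
  have "exp (- \<bar>x - a\<bar> / \<epsilon>) * (g_ker \<epsilon> (a - y) * w y) \<le> g_ker \<epsilon> (x - y) * w y" for y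
    using assms(3)[of y]
  proof
    assume "w y \<ge> 0"
    from mult_right_mono[OF g_ker_compare[OF assms(2)] this] show ?thesis by (simp add: ac_simps)
  next
    assume "x \<le> a \<and> a \<le> y \<or> y \<le> a \<and> a \<le> x"
    from g_ker_between[OF assms(2) this] show ?thesis by (simp add: mult.assoc[symmetric])
  qed
  then have "(LINT y|lborel. exp (- \<bar>x - a\<bar> / \<epsilon>) * (g_ker \<epsilon> (a - y) * w y)) \<le> (LINT y|lborel. g_ker \<epsilon> (x - y) * w y)"
    using assms by (intro integral_mono integrable_mult_right integrable_g_lin) auto
  then show ?thesis by (simp add: conv_def)
qed

text \<open>Comparing the kernels at x and a in both directions gives the relative bound |g(x - y) -
  g(a - y)| <= (exp h - 1) g(a - y) with h = |x - a| / \<epsilon>. The modulus of continuity is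
  therefore explicit.\<close>

lemma continuous_conv_g:
  assumes "lin_growth w" "\<epsilon> > 0"
  shows "continuous_on UNIV (conv (g_ker \<epsilon>) w)"
proof -
  have [measurable]: "w \<in> borel_measurable borel" using assms(1) by (rule lin_growthD)
  have w': "lin_growth (\<lambda>x. \<bar>w x\<bar>)" using assms by (auto simp: lin_growth_def)
  have bd: "\<bar>conv (g_ker \<epsilon>) w x - conv (g_ker \<epsilon>) w a\<bar> \<le> (exp (\<bar>x - a\<bar> / \<epsilon>) - 1) * conv (g_ker \<epsilon>) (\<lambda>x. \<bar>w x\<bar>) a" for x a
  proof -
    define h where "h = \<bar>x - a\<bar> / \<epsilon>"
    have h0: "h \<ge> 0" using assms by (simp add: h_def)
    have pt: "\<bar>g_ker \<epsilon> (x - y) - g_ker \<epsilon> (a - y)\<bar> \<le> (exp h - 1) * g_ker \<epsilon> (a - y)" for y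
    proof -
      have g0: "0 \<le> g_ker \<epsilon> (a - y)" using assms g_ker_nonneg by blast
      have 1: "exp (- h) * g_ker \<epsilon> (a - y) \<le> g_ker \<epsilon> (x - y)"
        using g_ker_compare[OF assms(2), of x a y] by (simp add: h_def)
      have "exp (- h) * g_ker \<epsilon> (x - y) \<le> g_ker \<epsilon> (a - y)"
        using g_ker_compare[OF assms(2), of a x y] by (simp add: h_def abs_minus_commute)
      then have "exp h * (exp (- h) * g_ker \<epsilon> (x - y)) \<le> exp h * g_ker \<epsilon> (a - y)"
        by (intro mult_left_mono) auto
      then have 2: "g_ker \<epsilon> (x - y) \<le> exp h * g_ker \<epsilon> (a - y)"
        by (simp add: mult.assoc[symmetric] mult_exp_exp)
      \<comment> \<open>Adding exp h >= 1 + h and exp(-h) >= 1 - h shows that the lower deviation is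
        dominated by the upper one.\<close>
      have "1 - exp (- h) \<le> exp h - 1"
        using exp_ge_add_one_self[of h] exp_ge_add_one_self[of "- h"] by linarith
      from mult_right_mono[OF this g0] 1 2 show ?thesis by (simp add: algebra_simps abs_if)
    qed
    have "\<bar>conv (g_ker \<epsilon>) w x - conv (g_ker \<epsilon>) w a\<bar> = \<bar>LINT y|lborel. g_ker \<epsilon> (x - y) * w y - g_ker \<epsilon> (a - y) * w y\<bar>"
      using integrable_g_lin[OF assms] by (simp add: conv_def)
    also have "\<dots> \<le> (LINT y|lborel. \<bar>g_ker \<epsilon> (x - y) * w y - g_ker \<epsilon> (a - y) * w y\<bar>)"
      by (rule integral_abs_bound)
    also have "\<dots> \<le> (LINT y|lborel. (exp h - 1) * (g_ker \<epsilon> (a - y) * \<bar>w y\<bar>))"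
    proof (intro integral_mono integrable_mult_right integrable_g_lin integrable_abs Bochner_Integration.integrable_diff assms w')
      fix y
      have "\<bar>g_ker \<epsilon> (x - y) * w y - g_ker \<epsilon> (a - y) * w y\<bar> = \<bar>g_ker \<epsilon> (x - y) - g_ker \<epsilon> (a - y)\<bar> * \<bar>w y\<bar>"
        by (simp add: abs_mult[symmetric] left_diff_distrib)
      also have "\<dots> \<le> ((exp h - 1) * g_ker \<epsilon> (a - y)) * \<bar>w y\<bar>" by (intro mult_right_mono pt) auto
      finally show "\<bar>g_ker \<epsilon> (x - y) * w y - g_ker \<epsilon> (a - y) * w y\<bar> \<le> (exp h - 1) * (g_ker \<epsilon> (a - y) * \<bar>w y\<bar>)" by (simp add: ac_simps)
    qed
    finally show ?thesis by (simp add: conv_def h_def)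
  qed
  show ?thesis
    unfolding continuous_on_eq_continuous_at[OF open_UNIV]
  proof
    fix a
    have "((\<lambda>x. (exp (\<bar>x - a\<bar> / \<epsilon>) - 1) * conv (g_ker \<epsilon>) (\<lambda>x. \<bar>w x\<bar>) a) \<longlongrightarrow> (exp (\<bar>a - a\<bar> / \<epsilon>) - 1) * conv (g_ker \<epsilon>) (\<lambda>x. \<bar>w x\<bar>) a) (at a)"
      by (intro tendsto_intros) (use assms in auto)
    then have "((\<lambda>x. (exp (\<bar>x - a\<bar> / \<epsilon>) - 1) * conv (g_ker \<epsilon>) (\<lambda>x. \<bar>w x\<bar>) a) \<longlongrightarrow> 0) (at a)" by simp
    then have "((\<lambda>x. conv (g_ker \<epsilon>) w x - conv (g_ker \<epsilon>) w a) \<longlongrightarrow> 0) (at a)"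
      by (rule Lim_null_comparison[rotated]) (simp add: bd)
    then show "isCont (conv (g_ker \<epsilon>) w) a"
      unfolding isCont_def by (rule Lim_null[THEN iffD2])
  qed
qed

text \<open>Folding at the origin removes the absolute values in the kernels, so that only integrals
  over a half-line remain. The origin is a null set, hence counting it twice is harmless.\<close>

lemma integral_fold_abs:
  fixes F :: "real \<Rightarrow> real"
  assumes "integrable lborel F"
  shows "(LINT z|lborel. F z) = (LINT z|lborel. indicator {0..} z * (F z + F (- z)))"
proof -
  have [measurable]: "F \<in> borel_measurable borel" using assms by auto
  have i: "integrable lborel (\<lambda>z. indicator {0..} z * F z)" "integrable lborel (\<lambda>z. indicator {..<0} z * F z)"
    using integrable_mult_indicator[OF _ assms] by auto
  have i': "integrable lborel (\<lambda>z. indicator {0..} z * F (- z))"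
    using integrable_mult_indicator[of "{0..}" lborel "\<lambda>z. F (- z)"] lborel_integrable_reflect[of F 0] assms by auto
  have "(LINT z|lborel. F z) = (LINT z|lborel. indicator {0..} z * F z + indicator {..<0} z * F z)"
    by (intro Bochner_Integration.integral_cong) (auto split: split_indicator)
  also have "\<dots> = (LINT z|lborel. indicator {0..} z * F z) + (LINT z|lborel. indicator {..<0} z * F z)"
    using i by simp
  also have "(LINT z|lborel. indicator {..<0} z * F z) = (LINT z|lborel. indicator {..<0} (0 - z) * F (0 - z))"
    by (rule lborel_integral_reflect[symmetric])
  also have "\<dots> = (LINT z|lborel. indicator {0..} z * F (- z))"
  proof (rule integral_cong_AE)
    show "AE z in lborel. indicator {..<0} (0 - z) * F (0 - z) = indicator {0..} z * F (- z)"
      by (rule AE_mp[OF AE_lborel_singleton[of 0] AE_I2]) (auto split: split_indicator)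
  qed measurable
  finally show ?thesis using i i' by (simp add: distrib_left)
qed

text \<open>Off the jump this says that sgn minus its convolution is \<open>s_ker\<close>, the link
  between the source term of the scheme and the interface. At the jump the convolved sign vanishes
  by oddness.\<close>

lemma conv_g_sgn:
  assumes "\<epsilon> > 0"
  shows "conv (g_ker \<epsilon>) (\<lambda>y. sgn (y - a)) x = sgn (x - a) * (1 - exp (- \<bar>x - a\<bar> / \<epsilon>))"
proof -
  have pos: "conv (g_ker \<epsilon>) (\<lambda>y. sgn (y - a)) x = 1 - exp (- (x - a) / \<epsilon>)" if "x > a" for x a
  proof -
    define d where "d = x - a"
    have d: "d > 0" using that by (simp add: d_def)
    have int: "integrable lborel (\<lambda>y. g_ker \<epsilon> (x - y) * sgn (y - a))"
      by (rule integrable_g_lin[OF lin_growth_sgn assms])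
    have "conv (g_ker \<epsilon>) (\<lambda>y. sgn (y - a)) x = (LINT z|lborel. g_ker \<epsilon> (x - (x + z)) * sgn (x + z - a))"
      unfolding conv_def by (rule lborel_integral_shift[symmetric])
    also have "\<dots> = (LINT z|lborel. g_ker \<epsilon> z * sgn (d + z))"
      by (simp add: d_def algebra_simps)
    also have "\<dots> = (LINT z|lborel. indicator {0..} z * (g_ker \<epsilon> z * sgn (d + z) + g_ker \<epsilon> (- z) * sgn (d + - z)))"
    proof (rule integral_fold_abs)
      show "integrable lborel (\<lambda>z. g_ker \<epsilon> z * sgn (d + z))"
        using int lborel_integrable_shift[of "\<lambda>y. g_ker \<epsilon> (x - y) * sgn (y - a)" x] by (simp add: d_def algebra_simps)
    qed
    \<comment> \<open>Beyond distance d the contributions of z and -z cancel; below d they add up.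
      The part over [0, d) is written as a difference of two tails.\<close>
    also have "\<dots> = (LINT z|lborel. 1 / \<epsilon> * (indicator {0..} z * exp (- (1 / \<epsilon> * z))) - 1 / \<epsilon> * (indicator {d..} z * exp (- (1 / \<epsilon> * z))))"
    proof (intro integral_cong_AE)
      show "AE z in lborel. indicator {0..} z * (g_ker \<epsilon> z * sgn (d + z) + g_ker \<epsilon> (- z) * sgn (d + - z)) =
        1 / \<epsilon> * (indicator {0..} z * exp (- (1 / \<epsilon> * z))) - 1 / \<epsilon> * (indicator {d..} z * exp (- (1 / \<epsilon> * z)))"
        by (rule AE_mp[OF AE_lborel_singleton[of d]], rule AE_I2)
           (use d in \<open>auto simp: g_ker_def sgn_if field_simps split: split_indicator\<close>)
    qed measurable
    also have "\<dots> = 1 / \<epsilon> * (exp (- (1 / \<epsilon> * 0)) / (1 / \<epsilon>)) - 1 / \<epsilon> * (exp (- (1 / \<epsilon> * d)) / (1 / \<epsilon>))"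
      by (intro has_bochner_integral_integral_eq has_bochner_integral_diff has_bochner_integral_mult_right has_bochner_integral_exp_atLeast)
         (use assms in auto)
    also have "\<dots> = 1 - exp (- (x - a) / \<epsilon>)" using assms by (simp add: d_def minus_divide_left)
    finally show ?thesis .
  qed
  consider "x > a" | "x < a" | "x = a" by linarith
  then show ?thesis
  proof cases
    case 1 then show ?thesis using pos by simp
  next
    case 2
    have "conv (g_ker \<epsilon>) (\<lambda>y. sgn (y - a)) x = (LINT y|lborel. g_ker \<epsilon> (x - (0 - y)) * sgn ((0 - y) - a))"
      unfolding conv_def by (rule lborel_integral_reflect[symmetric])
    also have "\<dots> = - conv (g_ker \<epsilon>) (\<lambda>y. sgn (y - (- a))) (- x)"
      unfolding conv_def integral_minus[symmetric]
    proof (intro Bochner_Integration.integral_cong refl)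
      fix y
      have "g_ker \<epsilon> (x - (0 - y)) = g_ker \<epsilon> (- x - y)" by (simp add: g_ker_def abs_if)
      then show "g_ker \<epsilon> (x - (0 - y)) * sgn (0 - y - a) = - (g_ker \<epsilon> (- x - y) * sgn (y - - a))"
        by (simp add: sgn_if)
    qed
    also have "conv (g_ker \<epsilon>) (\<lambda>y. sgn (y - (- a))) (- x) = 1 - exp (- (- x - - a) / \<epsilon>)"
      by (rule pos) (use 2 in simp)
    finally show ?thesis using 2 by simp
  next
    case 3
    have "conv (g_ker \<epsilon>) (\<lambda>y. sgn (y - a)) a = (LINT y|lborel. g_ker \<epsilon> (a - (2 * a - y)) * sgn ((2 * a - y) - a))"
      unfolding conv_def by (rule lborel_integral_reflect[symmetric])
    also have "\<dots> = - conv (g_ker \<epsilon>) (\<lambda>y. sgn (y - a)) a"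
      unfolding conv_def integral_minus[symmetric]
    proof (intro Bochner_Integration.integral_cong refl)
      fix y
      have "g_ker \<epsilon> (a - (2 * a - y)) = g_ker \<epsilon> (a - y)" by (simp add: g_ker_def abs_if)
      then show "g_ker \<epsilon> (a - (2 * a - y)) * sgn (2 * a - y - a) = - (g_ker \<epsilon> (a - y) * sgn (y - a))"
        by (simp add: sgn_if)
    qed
    finally show ?thesis using 3 by simp
  qed
qed

text \<open>With the Fourier symbol \<open>m = 1 / (1 + \<epsilon>\<^sup>2 k\<^sup>2)\<close> of \<^term>\<open>g_ker \<epsilon>\<close> this reads
  \<open>m\<^sup>2 + \<epsilon>\<^sup>2 k\<^sup>2 m\<^sup>2 = m\<close>.\<close>

lemma g_g_identity:
  assumes "\<epsilon> > 0"
  shows "conv (g_ker \<epsilon>) (g_ker \<epsilon>) x - \<epsilon>\<^sup>2 * conv (dg_ker \<epsilon>) (dg_ker \<epsilon>) x = g_ker \<epsilon> x"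
proof -
  have pos: "has_bochner_integral lborel (\<lambda>y. g_ker \<epsilon> (x - y) * g_ker \<epsilon> y - \<epsilon>\<^sup>2 * (dg_ker \<epsilon> (x - y) * dg_ker \<epsilon> y)) (g_ker \<epsilon> x)"
    if "x \<ge> 0" for x
  proof -
    let ?c = "2 / \<epsilon>"
    have A: "has_bochner_integral lborel (\<lambda>y. indicator {x..} y * exp (- (?c * y))) (exp (- (?c * x)) / ?c)"
      and B0: "has_bochner_integral lborel (\<lambda>y. indicator {0..} y * exp (- (?c * y))) (exp (- (?c * 0)) / ?c)"
      using assms by (intro has_bochner_integral_exp_atLeast; simp)+
    have B: "has_bochner_integral lborel (\<lambda>y. indicator {0..} (0 - y) * exp (- (?c * (0 - y)))) (exp (- (?c * 0)) / ?c)"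
      using B0 lborel_integral_reflect[of "\<lambda>y. indicator {0..} y * exp (- (?c * y))" 0]
        lborel_integrable_reflect[of "\<lambda>y. indicator {0..} y * exp (- (?c * y))" 0]
      by (simp add: has_bochner_integral_iff)
    have "has_bochner_integral lborel (\<lambda>y. 1 / (2 * \<epsilon>\<^sup>2) * exp (x / \<epsilon>) * (indicator {x..} y * exp (- (?c * y))) + 1 / (2 * \<epsilon>\<^sup>2) * exp (- x / \<epsilon>) * (indicator {0..} (0 - y) * exp (- (?c * (0 - y)))))
      (1 / (2 * \<epsilon>\<^sup>2) * exp (x / \<epsilon>) * (exp (- (?c * x)) / ?c) + 1 / (2 * \<epsilon>\<^sup>2) * exp (- x / \<epsilon>) * (exp (- (?c * 0)) / ?c))"
      by (intro has_bochner_integral_add has_bochner_integral_mult_right A B)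
    moreover have "1 / (2 * \<epsilon>\<^sup>2) * exp (x / \<epsilon>) * (exp (- (?c * x)) / ?c) + 1 / (2 * \<epsilon>\<^sup>2) * exp (- x / \<epsilon>) * (exp (- (?c * 0)) / ?c) = g_ker \<epsilon> x"
    proof -
      have "exp (x / \<epsilon>) * exp (- (?c * x)) = exp (- x / \<epsilon>)" using assms by (simp add: mult_exp_exp field_simps)
      then show ?thesis using assms that by (simp add: g_ker_def power2_eq_square field_simps)
    qed
    moreover have "AE y in lborel. 1 / (2 * \<epsilon>\<^sup>2) * exp (x / \<epsilon>) * (indicator {x..} y * exp (- (?c * y))) + 1 / (2 * \<epsilon>\<^sup>2) * exp (- x / \<epsilon>) * (indicator {0..} (0 - y) * exp (- (?c * (0 - y))))
       = g_ker \<epsilon> (x - y) * g_ker \<epsilon> y - \<epsilon>\<^sup>2 * (dg_ker \<epsilon> (x - y) * dg_ker \<epsilon> y)"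
    proof (rule AE_mp[OF AE_lborel_singleton[of x]], rule AE_mp[OF AE_lborel_singleton[of 0]], rule AE_I2, intro impI)
      fix y assume y: "y \<noteq> 0" "y \<noteq> x"
      \<comment> \<open>The product of derivatives carries the sign sgn(x - y) sgn y: the integrand
        vanishes between 0 and x and doubles outside, leaving two exponential tails.\<close>
      have s: "g_ker \<epsilon> (x - y) * g_ker \<epsilon> y - \<epsilon>\<^sup>2 * (dg_ker \<epsilon> (x - y) * dg_ker \<epsilon> y) = (1 - sgn (x - y) * sgn y) * (g_ker \<epsilon> (x - y) * g_ker \<epsilon> y)"
        using assms by (simp add: dg_ker_def power2_eq_square field_simps)
      have gg: "g_ker \<epsilon> (x - y) * g_ker \<epsilon> y = 1 / (4 * \<epsilon>\<^sup>2) * exp (- (\<bar>x - y\<bar> + \<bar>y\<bar>) / \<epsilon>)"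
        using assms by (simp add: g_ker_def power2_eq_square mult_exp_exp add_divide_distrib diff_divide_distrib)
      consider "y < 0" | "0 < y" "y < x" | "y > x" using y by linarith
      then show "1 / (2 * \<epsilon>\<^sup>2) * exp (x / \<epsilon>) * (indicator {x..} y * exp (- (?c * y))) + 1 / (2 * \<epsilon>\<^sup>2) * exp (- x / \<epsilon>) * (indicator {0..} (0 - y) * exp (- (?c * (0 - y))))
       = g_ker \<epsilon> (x - y) * g_ker \<epsilon> y - \<epsilon>\<^sup>2 * (dg_ker \<epsilon> (x - y) * dg_ker \<epsilon> y)"
      proof cases
        case 1
        have "exp (- x / \<epsilon>) * exp (?c * y) = exp (- (\<bar>x - y\<bar> + \<bar>y\<bar>) / \<epsilon>)"
          using 1 that assms by (simp add: mult_exp_exp field_simps)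
        with 1 that show ?thesis unfolding s unfolding gg by simp
      next
        case 2 then show ?thesis unfolding s by simp
      next
        case 3
        have "exp (x / \<epsilon>) * exp (- (?c * y)) = exp (- (\<bar>x - y\<bar> + \<bar>y\<bar>) / \<epsilon>)"
          using 3 that assms by (simp add: mult_exp_exp field_simps)
        with 3 that show ?thesis unfolding s unfolding gg by simp
      qed
    qed
    ultimately show ?thesis
      by (subst has_bochner_integral_cong_AE[symmetric]) auto
  qed
  have hb: "has_bochner_integral lborel (\<lambda>y. g_ker \<epsilon> (x - y) * g_ker \<epsilon> y - \<epsilon>\<^sup>2 * (dg_ker \<epsilon> (x - y) * dg_ker \<epsilon> y)) (g_ker \<epsilon> x)"
  proof (cases "x \<ge> 0")
    case False
    let ?F = "\<lambda>y. g_ker \<epsilon> (- x - y) * g_ker \<epsilon> y - \<epsilon>\<^sup>2 * (dg_ker \<epsilon> (- x - y) * dg_ker \<epsilon> y)"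
    have "has_bochner_integral lborel ?F (g_ker \<epsilon> (- x))"
      by (rule pos) (use False in simp)
    then have "has_bochner_integral lborel (\<lambda>y. ?F (0 - y)) (g_ker \<epsilon> (- x))"
      using lborel_integral_reflect[of ?F 0] lborel_integrable_reflect[of ?F 0] by (simp add: has_bochner_integral_iff)
    moreover have "?F (0 - y) = g_ker \<epsilon> (x - y) * g_ker \<epsilon> y - \<epsilon>\<^sup>2 * (dg_ker \<epsilon> (x - y) * dg_ker \<epsilon> y)" for y
      using g_ker_even[of \<epsilon> "x - y"] dg_ker_odd[of \<epsilon> "x - y"] by simp
    ultimately show ?thesis by simp
  qed (rule pos)
  have b: "\<bar>g_ker \<epsilon> z\<bar> \<le> 1 / (2 * \<epsilon>)" "\<bar>dg_ker \<epsilon> z\<bar> \<le> 1 / \<epsilon> * (1 / (2 * \<epsilon>))" for z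
  proof -
    show 1: "\<bar>g_ker \<epsilon> z\<bar> \<le> 1 / (2 * \<epsilon>)" for z using assms by (simp add: g_ker_def abs_mult divide_right_mono)
    have "\<bar>dg_ker \<epsilon> z\<bar> \<le> 1 / \<epsilon> * \<bar>g_ker \<epsilon> z\<bar>"
      using assms by (auto simp: dg_ker_def abs_mult sgn_if divide_simps)
    also have "\<dots> \<le> 1 / \<epsilon> * (1 / (2 * \<epsilon>))" by (intro mult_left_mono 1) (use assms in auto)
    finally show "\<bar>dg_ker \<epsilon> z\<bar> \<le> 1 / \<epsilon> * (1 / (2 * \<epsilon>))" .
  qed
  have i1: "integrable lborel (\<lambda>y. g_ker \<epsilon> (x - y) * g_ker \<epsilon> y)"
    by (rule integrable_g_lin[OF lin_growth_bounded[OF _ b(1)] assms]) measurable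
  have i2: "integrable lborel (\<lambda>y. dg_ker \<epsilon> (x - y) * dg_ker \<epsilon> y)"
  proof (rule Bochner_Integration.integrable_bound)
    show "integrable lborel (\<lambda>y. 1 / \<epsilon> * (1 / (2 * \<epsilon>)) * \<bar>dg_ker \<epsilon> y\<bar>)"
      by (intro integrable_mult_right integrable_abs integrable_dg_ker assms)
    have "norm (dg_ker \<epsilon> (x - y) * dg_ker \<epsilon> y) \<le> norm (1 / \<epsilon> * (1 / (2 * \<epsilon>)) * \<bar>dg_ker \<epsilon> y\<bar>)" for y
      using mult_right_mono[OF b(2) abs_ge_zero, of "x - y" "dg_ker \<epsilon> y"] abs_ge_self order_trans
      unfolding abs_mult real_norm_def by fastforce
    then show "AE y in lborel. norm (dg_ker \<epsilon> (x - y) * dg_ker \<epsilon> y) \<le> norm (1 / \<epsilon> * (1 / (2 * \<epsilon>)) * \<bar>dg_ker \<epsilon> y\<bar>)"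
      by simp
  qed measurable
  show ?thesis
    using hb i1 i2 by (simp add: has_bochner_integral_iff conv_def)
qed

subsection \<open>Convolutions: duality, energy and weak derivatives\<close>

lemma integrable_conv_pair:
  assumes "integrable lborel K" "integrable lborel c"
  shows "integrable (lborel \<Otimes>\<^sub>M lborel) (\<lambda>(x, y::real). K (x - y) * c x :: real)"
proof (rule lborel_pair.Fubini_integrable)
  have [measurable]: "K \<in> borel_measurable borel" "c \<in> borel_measurable borel" using assms by auto
  show "(\<lambda>(x, y::real). K (x - y) * c x) \<in> borel_measurable (lborel \<Otimes>\<^sub>M lborel)" by measurable
  have "integrable lborel (\<lambda>x. \<bar>c x\<bar> * (LINT y|lborel. \<bar>K y\<bar>))"
    using assms by (intro integrable_mult_left integrable_abs)
  moreover have "(LINT y|lborel. norm (case (x, y) of (x, y) \<Rightarrow> K (x - y) * c x)) = \<bar>c x\<bar> * (LINT y|lborel. \<bar>K y\<bar>)" for x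
    using lborel_integral_reflect[of "\<lambda>z. \<bar>K z\<bar>" x] by (simp add: abs_mult mult.commute)
  ultimately show "integrable lborel (\<lambda>x. LINT y|lborel. norm (case (x, y) of (x, y) \<Rightarrow> K (x - y) * c x))"
    by simp
  have "integrable lborel (\<lambda>y. K (x - y) * c x)" for x
    using assms(1) lborel_integrable_reflect[of K x] by (intro integrable_mult_left) simp
  then show "AE x in lborel. integrable lborel (\<lambda>y. case (x, y) of (x, y) \<Rightarrow> K (x - y) * c x)"
    by simp
qed

text \<open>Fubini with an integrable majorant in product form \<open>K (x - y) * c x\<close>.
  Keeping K and c abstract allows the growth of a to be shared between the kernel and the test
  function.\<close>

lemma
  assumes k[measurable]: "k \<in> borel_measurable borel" and a[measurable]: "a \<in> borel_measurable borel"
    and b[measurable]: "b \<in> borel_measurable borel"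
    and K: "integrable lborel K" and c: "integrable lborel c"
    and dom: "\<And>x y. \<bar>k (x - y) * a y * b x\<bar> \<le> K (x - y) * c x"
  shows conv_dual: "(LINT x|lborel. conv k a x * b x) = (LINT y|lborel. a y * conv (\<lambda>z. k (- z)) b y)"
    and integrable_conv_mult: "integrable lborel (\<lambda>x. conv k a x * b x)"
    and integrable_mult_conv: "integrable lborel (\<lambda>y. a y * conv (\<lambda>z. k (- z)) b y)"
proof -
  have F: "integrable (lborel \<Otimes>\<^sub>M lborel) (\<lambda>(x, y). k (x - y) * a y * b x)"
  proof (rule Bochner_Integration.integrable_bound[OF integrable_conv_pair[OF K c]])
    show "AE z in lborel \<Otimes>\<^sub>M lborel. norm (case z of (x, y) \<Rightarrow> k (x - y) * a y * b x) \<le> norm (case z of (x, y) \<Rightarrow> K (x - y) * c x)"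
      by (rule AE_I2) (auto intro: order_trans[OF dom abs_ge_self])
  qed measurable
  have 1: "(LINT y|lborel. k (x - y) * a y * b x) = conv k a x * b x" for x
    by (simp add: conv_def)
  have 2: "(LINT x|lborel. k (x - y) * a y * b x) = a y * conv (\<lambda>z. k (- z)) b y" for y
    by (simp add: conv_def flip: integral_mult_right_zero) (simp add: ac_simps)
  show "(LINT x|lborel. conv k a x * b x) = (LINT y|lborel. a y * conv (\<lambda>z. k (- z)) b y)"
    using lborel_pair.Fubini_integral[OF F] by (simp only: 1 2)
  show "integrable lborel (\<lambda>x. conv k a x * b x)"
    using lborel_pair.integrable_fst[OF F] by (simp only: 1)
  show "integrable lborel (\<lambda>y. a y * conv (\<lambda>z. k (- z)) b y)"
    using lborel_pair.integrable_snd[OF F] by (simp only: 2)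
qed

text \<open>A class that convolution with an integrable kernel preserves and in which products are
  integrable; it supplies the finite energies of the fluctuations.\<close>

definition L1_bounded :: "(real \<Rightarrow> real) \<Rightarrow> bool" where
  "L1_bounded w \<longleftrightarrow> integrable lborel w \<and> (\<exists>B. \<forall>x. \<bar>w x\<bar> \<le> B)"

lemma L1_boundedE:
  assumes "L1_bounded w"
  obtains B where "w \<in> borel_measurable borel" "integrable lborel w" "B \<ge> 0" "\<And>x. \<bar>w x\<bar> \<le> B"
proof -
  from assms obtain B where B: "\<And>x. \<bar>w x\<bar> \<le> B" by (auto simp: L1_bounded_def)
  have "0 \<le> B" using B[of 0] by linarith
  with B assms that show thesis by (auto simp: L1_bounded_def)
qed

lemma L1_bounded_add:
  assumes "L1_bounded v" "L1_bounded w" shows "L1_bounded (\<lambda>x. v x + w x)"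
proof -
  obtain A B where "\<And>x. \<bar>v x\<bar> \<le> A" "\<And>x. \<bar>w x\<bar> \<le> B" using assms by (auto simp: L1_bounded_def)
  then have "\<bar>v x + w x\<bar> \<le> A + B" for x by (rule order_trans[OF abs_triangle_ineq add_mono])
  then show ?thesis using assms by (auto simp: L1_bounded_def)
qed

lemma L1_bounded_mult:
  assumes "L1_bounded v" "L1_bounded w" shows "integrable lborel (\<lambda>x. v x * w x)"
proof -
  obtain A where A: "v \<in> borel_measurable borel" "\<And>x. \<bar>v x\<bar> \<le> A" using L1_boundedE[OF assms(1)] by metis
  obtain B where B: "w \<in> borel_measurable borel" "integrable lborel w" using L1_boundedE[OF assms(2)] by metis
  have "\<bar>v x * w x\<bar> \<le> \<bar>A * w x\<bar>" for x
    unfolding abs_mult by (intro mult_right_mono order_trans[OF A(2) abs_ge_self]) auto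
  then show ?thesis
    by (intro Bochner_Integration.integrable_bound[OF integrable_mult_right[OF B(2), of A]]) (use A B in auto)
qed

lemma conv_bound:
  assumes k: "integrable lborel k" and w: "w \<in> borel_measurable borel" "\<And>x. \<bar>w x\<bar> \<le> B"
  shows "\<bar>conv k w x\<bar> \<le> (LINT z|lborel. \<bar>k z\<bar>) * B" and integrable_conv: "integrable lborel (\<lambda>y. k (x - y) * w y)"
proof -
  have [measurable]: "k \<in> borel_measurable borel" "w \<in> borel_measurable borel" using k w by auto
  have kx: "integrable lborel (\<lambda>y. \<bar>k (x - y)\<bar> * B)"
    using k lborel_integrable_reflect[of k x] by (intro integrable_mult_left integrable_abs) simp
  have bd: "\<bar>k (x - y) * w y\<bar> \<le> \<bar>k (x - y)\<bar> * B" for y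
    unfolding abs_mult by (intro mult_left_mono w) auto
  show i: "integrable lborel (\<lambda>y. k (x - y) * w y)"
    by (rule Bochner_Integration.integrable_bound[OF kx]) (auto intro!: order_trans[OF bd abs_ge_self])
  have "\<bar>conv k w x\<bar> \<le> (LINT y|lborel. \<bar>k (x - y) * w y\<bar>)"
    unfolding conv_def by (rule integral_abs_bound)
  also have "\<dots> \<le> (LINT y|lborel. \<bar>k (x - y)\<bar> * B)"
    by (intro integral_mono integrable_abs i kx bd)
  also have "\<dots> = (LINT z|lborel. \<bar>k z\<bar>) * B"
    using lborel_integral_reflect[of "\<lambda>z. \<bar>k z\<bar>" x] by simp
  finally show "\<bar>conv k w x\<bar> \<le> (LINT z|lborel. \<bar>k z\<bar>) * B" .
qed

lemma integrable_conv_L1: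
  assumes k: "integrable lborel k" and w: "integrable lborel w"
  shows "integrable lborel (conv k w)"
proof -
  have K: "integrable lborel (\<lambda>z. k (- z))" using k lborel_integrable_reflect[of k 0] by simp
  have F: "integrable (lborel \<Otimes>\<^sub>M lborel) (\<lambda>(y, x). k (x - y) * w y)"
    using integrable_conv_pair[OF K w] by simp
  show "integrable lborel (conv k w)"
    using lborel_pair.integrable_snd[OF F] by (simp add: conv_def[abs_def])
qed

lemma L1_bounded_conv:
  assumes "integrable lborel k" "L1_bounded w" shows "L1_bounded (conv k w)"
proof -
  obtain B where "w \<in> borel_measurable borel" "integrable lborel w" "\<And>x. \<bar>w x\<bar> \<le> B"
    using L1_boundedE[OF assms(2)] by metis
  with conv_bound(1)[OF assms(1)] integrable_conv_L1[OF assms(1)] show ?thesis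
    unfolding L1_bounded_def by blast
qed

lemma conv_dual_bounded:
  assumes k: "integrable lborel k" and w: "w \<in> borel_measurable borel" "\<And>x. \<bar>w x\<bar> \<le> B" and b: "integrable lborel b"
  shows "(LINT x|lborel. conv k w x * b x) = (LINT y|lborel. w y * conv (\<lambda>z. k (- z)) b y)"
proof (rule conv_dual)
  show "integrable lborel (\<lambda>z. \<bar>k z\<bar> * B)" "integrable lborel (\<lambda>x. \<bar>b x\<bar>)"
    using k b by auto
  fix x y
  have "\<bar>w y\<bar> * (\<bar>k (x - y)\<bar> * \<bar>b x\<bar>) \<le> B * (\<bar>k (x - y)\<bar> * \<bar>b x\<bar>)" by (intro mult_right_mono w) auto
  then show "\<bar>k (x - y) * w y * b x\<bar> \<le> \<bar>k (x - y)\<bar> * B * \<bar>b x\<bar>" by (simp add: abs_mult ac_simps)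
qed (use k w b in auto)

text \<open>The left-hand side is the pairing of \<open>conv l w\<close> with the function k(x - .).
  Duality moves l onto that function, and a translation recognises \<open>conv k l\<close>.\<close>

lemma conv_assoc:
  assumes k: "integrable lborel k" and l: "integrable lborel l"
    and w: "w \<in> borel_measurable borel" "\<And>x. \<bar>w x\<bar> \<le> B"
  shows "conv k (conv l w) x = conv (conv k l) w x"
proof -
  have m: "k \<in> borel_measurable borel" "l \<in> borel_measurable borel" using k l by auto
  have kx: "integrable lborel (\<lambda>y. k (x - y))" using k lborel_integrable_reflect[of k x] by simp
  have "conv k (conv l w) x = (LINT y|lborel. conv l w y * k (x - y))"
    by (simp add: conv_def[of k] mult.commute)
  also have "\<dots> = (LINT z|lborel. w z * conv (\<lambda>z. l (- z)) (\<lambda>y. k (x - y)) z)"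
    by (rule conv_dual_bounded[OF l w kx])
  also have "\<dots> = (LINT z|lborel. conv k l (x - z) * w z)"
  proof (rule Bochner_Integration.integral_cong[OF refl])
    fix z
    have "conv k l (x - z) = (LINT y|lborel. k (x - z - (- z + y)) * l (- z + y))"
      unfolding conv_def by (rule lborel_integral_shift[symmetric])
    also have "\<dots> = conv (\<lambda>z. l (- z)) (\<lambda>y. k (x - y)) z"
      unfolding conv_def by (intro Bochner_Integration.integral_cong) (auto simp: algebra_simps)
    finally show "w z * conv (\<lambda>z. l (- z)) (\<lambda>y. k (x - y)) z = conv k l (x - z) * w z" by simp
  qed
  finally show ?thesis by (simp add: conv_def[of "conv k l"])
qed

text \<open>With v = g * w and V = g' * w, duality turns the integral of v^2 + \<epsilon>^2 V^2 into
  that of w (g * v - \<epsilon>^2 g' * V), and \<open>g_g_identity\<close> reduces the bracket to v.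
  Young's inequality for w v absorbs half of the integral of v^2; clearing the halves gives the
  factor 2.\<close>

lemma conv_g_energy:
  assumes "\<epsilon> > 0" "L1_bounded w"
  defines "v \<equiv> conv (g_ker \<epsilon>) w" and "V \<equiv> conv (dg_ker \<epsilon>) w"
  shows "2 * \<epsilon>\<^sup>2 * (LINT x|lborel. (V x)\<^sup>2) + (LINT x|lborel. (v x)\<^sup>2) \<le> (LINT x|lborel. (w x)\<^sup>2)"
    and "integrable lborel (\<lambda>x. (V x)\<^sup>2)"
proof -
  obtain B where B: "w \<in> borel_measurable borel" "integrable lborel w" "B \<ge> 0" "\<And>x. \<bar>w x\<bar> \<le> B"
    using L1_boundedE[OF assms(2)] by metis
  note g = integrable_g_ker[OF assms(1)] and dg = integrable_dg_ker[OF assms(1)]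
  have vb: "L1_bounded v" "L1_bounded V" unfolding v_def V_def by (intro L1_bounded_conv g dg assms(2))+
  then have vm: "integrable lborel v" "integrable lborel V" by (auto simp: L1_bounded_def)
  have "(LINT x|lborel. v x * v x) = (LINT x|lborel. conv (g_ker \<epsilon>) w x * v x)" by (simp add: v_def)
  also have "\<dots> = (LINT y|lborel. w y * conv (\<lambda>z. g_ker \<epsilon> (- z)) v y)"
    by (rule conv_dual_bounded[OF g B(1,4) vm(1)])
  finally have vv: "(LINT x|lborel. v x * v x) = (LINT y|lborel. w y * conv (g_ker \<epsilon>) v y)" by simp
  have "(LINT x|lborel. V x * V x) = (LINT x|lborel. conv (dg_ker \<epsilon>) w x * V x)" by (simp add: V_def)
  also have "\<dots> = (LINT y|lborel. w y * conv (\<lambda>z. dg_ker \<epsilon> (- z)) V y)"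
    by (rule conv_dual_bounded[OF dg B(1,4) vm(2)])
  \<comment> \<open>Oddness of \<open>dg_ker\<close> produces the sign that matches the minus in
    \<open>g_g_identity\<close>.\<close>
  also have "\<dots> = - (LINT y|lborel. w y * conv (dg_ker \<epsilon>) V y)" by (simp add: conv_def)
  finally have VV: "(LINT x|lborel. V x * V x) = - (LINT y|lborel. w y * conv (dg_ker \<epsilon>) V y)" .
  have id: "conv (g_ker \<epsilon>) v y - \<epsilon>\<^sup>2 * conv (dg_ker \<epsilon>) V y = v y" for y
  proof -
    have "conv (g_ker \<epsilon>) v y - \<epsilon>\<^sup>2 * conv (dg_ker \<epsilon>) V y
        = conv (conv (g_ker \<epsilon>) (g_ker \<epsilon>)) w y - \<epsilon>\<^sup>2 * conv (conv (dg_ker \<epsilon>) (dg_ker \<epsilon>)) w y"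
      unfolding v_def V_def conv_assoc[OF g g B(1,4)] conv_assoc[OF dg dg B(1,4)] ..
    also have "\<dots> = (LINT z|lborel. conv (g_ker \<epsilon>) (g_ker \<epsilon>) (y - z) * w z - \<epsilon>\<^sup>2 * (conv (dg_ker \<epsilon>) (dg_ker \<epsilon>) (y - z) * w z))"
      using integrable_conv[OF integrable_conv_L1[OF g g] B(1,4), of y]
        integrable_conv[OF integrable_conv_L1[OF dg dg] B(1,4), of y]
      by (simp add: conv_def[of "conv _ _"])
    also have "\<dots> = (LINT z|lborel. (conv (g_ker \<epsilon>) (g_ker \<epsilon>) (y - z) - \<epsilon>\<^sup>2 * conv (dg_ker \<epsilon>) (dg_ker \<epsilon>) (y - z)) * w z)"
      by (simp add: left_diff_distrib mult.assoc)
    also have "\<dots> = v y" unfolding g_g_identity[OF assms(1)] by (simp add: v_def conv_def)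
    finally show ?thesis .
  qed
  have b2: "L1_bounded (conv (g_ker \<epsilon>) v)" "L1_bounded (conv (dg_ker \<epsilon>) V)" by (intro L1_bounded_conv g dg vb)+
  have "(LINT x|lborel. v x * v x) + \<epsilon>\<^sup>2 * (LINT x|lborel. V x * V x)
      = (LINT y|lborel. w y * conv (g_ker \<epsilon>) v y) - \<epsilon>\<^sup>2 * (LINT y|lborel. w y * conv (dg_ker \<epsilon>) V y)"
    unfolding vv VV by simp
  also have "\<dots> = (LINT y|lborel. w y * conv (g_ker \<epsilon>) v y - \<epsilon>\<^sup>2 * (w y * conv (dg_ker \<epsilon>) V y))"
    using L1_bounded_mult[OF assms(2) b2(1)] L1_bounded_mult[OF assms(2) b2(2)] by simp
  also have "\<dots> = (LINT y|lborel. w y * v y)"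
    by (intro Bochner_Integration.integral_cong refl) (simp add: id[symmetric] algebra_simps)
  also have "\<dots> \<le> (LINT y|lborel. 1/2 * (w y * w y) + 1/2 * (v y * v y))"
  proof (intro integral_mono Bochner_Integration.integrable_add integrable_mult_right L1_bounded_mult assms vb)
    fix y show "w y * v y \<le> 1/2 * (w y * w y) + 1/2 * (v y * v y)"
      using zero_le_square[of "w y - v y"] by (simp add: algebra_simps)
  qed
  also have "\<dots> = 1/2 * (LINT y|lborel. w y * w y) + 1/2 * (LINT y|lborel. v y * v y)"
    using L1_bounded_mult[OF assms(2,2)] L1_bounded_mult[OF vb(1,1)] by simp
  finally show "2 * \<epsilon>\<^sup>2 * (LINT x|lborel. (V x)\<^sup>2) + (LINT x|lborel. (v x)\<^sup>2) \<le> (LINT x|lborel. (w x)\<^sup>2)"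
    by (simp add: power2_eq_square)
  show "integrable lborel (\<lambda>x. (V x)\<^sup>2)" using L1_bounded_mult[OF vb(2,2)] by (simp add: power2_eq_square)
qed

section \<open>Integration by parts against compactly supported functions\<close>

definition cont_supp :: "real \<Rightarrow> (real \<Rightarrow> real) \<Rightarrow> bool" where
  "cont_supp R \<psi> \<longleftrightarrow> continuous_on UNIV \<psi> \<and> (\<forall>x. R < \<bar>x\<bar> \<longrightarrow> \<psi> x = 0)"

lemma cont_supp_integrable:
  assumes "cont_supp R \<psi>" "continuous_on UNIV h"
  shows "integrable lborel (\<lambda>x. h x * \<psi> x)"
proof -
  have "integrable lborel (\<lambda>x. (h x * \<psi> x) * indicator {-R..R} x)"
    by (rule borel_integrable_atLeastAtMost)
       (use assms in \<open>auto simp: cont_supp_def continuous_on_eq_continuous_at intro!: continuous_intros\<close>)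
  also have "(\<lambda>x. (h x * \<psi> x) * indicator {-R..R} x) = (\<lambda>x. h x * \<psi> x)"
    using assms by (auto simp: fun_eq_iff cont_supp_def split: split_indicator)
  finally show ?thesis .
qed

lemma cont_supp_measurable: "cont_supp R \<psi> \<Longrightarrow> \<psi> \<in> borel_measurable borel"
  by (auto simp: cont_supp_def intro: borel_measurable_continuous_onI)

lemma cont_supp_bounded:
  assumes "cont_supp R \<psi>" obtains B where "\<And>x. \<bar>\<psi> x\<bar> \<le> B"
proof -
  have "compact (\<psi> ` {-R..R})"
    using assms by (intro compact_continuous_image) (auto simp: cont_supp_def intro: continuous_on_subset)
  from compact_imp_bounded[OF this] obtain B where B: "\<forall>x\<in>{-R..R}. \<bar>\<psi> x\<bar> \<le> B"
    unfolding bounded_iff by auto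
  have "\<bar>\<psi> x\<bar> \<le> max B 0" for x
  proof (cases "x \<in> {-R..R}")
    case False
    then have "R < \<bar>x\<bar>" by auto
    then have "\<psi> x = 0" using assms by (simp add: cont_supp_def)
    then show ?thesis by simp
  qed (use B in force)
  then show thesis using that by blast
qed

lemma L1_bounded_cont_supp: "cont_supp R \<psi> \<Longrightarrow> L1_bounded \<psi>"
  using cont_supp_integrable[of R \<psi> "\<lambda>_. 1"] cont_supp_bounded[of R \<psi>] unfolding L1_bounded_def by auto

text \<open>Integration by parts along the ray x + s z. The sign s treats both half-lines at once,
  and the boundary term \<psi>(x) is what later becomes the Dirac mass in the second derivative of
  the kernel.\<close>

lemma half_line_parts:
  fixes \<psi> \<psi>' :: "real \<Rightarrow> real"
  assumes \<epsilon>: "\<epsilon> > 0" and d: "\<And>x. (\<psi> has_real_derivative \<psi>' x) (at x)"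
    and c: "cont_supp R \<psi>" "cont_supp R \<psi>'" and s: "s = 1 \<or> s = - 1"
  shows "(LINT z|lborel. indicator {0..} z * (exp (- (z / \<epsilon>)) * \<psi>' (x + s * z)))
      = s * (1 / \<epsilon> * (LINT z|lborel. indicator {0..} z * (exp (- (z / \<epsilon>)) * \<psi> (x + s * z))) - \<psi> x)"
proof -
  \<comment> \<open>Large enough that x + s N lies outside the support for either sign, so the upper
    boundary term vanishes.\<close>
  define N where "N = \<bar>R\<bar> + \<bar>x\<bar> + 1"
  have ind: "indicator {0..} z * (exp (- (z / \<epsilon>)) * h (x + s * z)) = (exp (- (z / \<epsilon>)) * h (x + s * z)) * indicator {0..N} z"
    if "cont_supp R h" for h z
  proof (cases "z \<in> {0..N}")
    case False
    then have "h (x + s * z) = 0 \<or> z < 0"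
      using s that unfolding cont_supp_def N_def by (auto simp: not_le) 
    then show ?thesis using False by (auto split: split_indicator)
  qed (auto split: split_indicator)
  have cont: "isCont (\<lambda>z. h (x + s * z)) z" if "cont_supp R h" for h z
  proof (rule isCont_o2[where g = h])
    show "isCont h (x + s * z)"
      using that by (simp add: cont_supp_def continuous_on_eq_continuous_at)
  qed (intro continuous_intros)
  have int: "integrable lborel (\<lambda>z. (exp (- (z / \<epsilon>)) * h (x + s * z)) * indicator {0..N} z)" if "cont_supp R h" for h
    by (rule borel_integrable_atLeastAtMost) (use \<epsilon> cont[OF that] in \<open>auto intro!: continuous_intros\<close>)
  have FTC: "has_bochner_integral lborel (\<lambda>z. (s * (exp (- (z / \<epsilon>)) * \<psi>' (x + s * z)) - 1 / \<epsilon> * (exp (- (z / \<epsilon>)) * \<psi> (x + s * z))) * indicator {0..N} z)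
     (exp (- (N / \<epsilon>)) * \<psi> (x + s * N) - exp (- (0 / \<epsilon>)) * \<psi> (x + s * 0))"
  proof (rule has_bochner_integral_FTC_Icc_real)
    show "0 \<le> N" by (simp add: N_def)
    fix z
    have 1: "((\<lambda>z. \<psi> (x + s * z)) has_real_derivative \<psi>' (x + s * z) * s) (at z)"
      by (rule DERIV_chain2[OF d]) (auto intro!: derivative_eq_intros)
    have 2: "((\<lambda>z. exp (- (z / \<epsilon>))) has_real_derivative exp (- (z / \<epsilon>)) * (- (1 / \<epsilon>))) (at z)"
      by (rule DERIV_fun_exp) (use \<epsilon> in \<open>auto intro!: derivative_eq_intros\<close>)
    show "((\<lambda>z. exp (- (z / \<epsilon>)) * \<psi> (x + s * z)) has_real_derivative
        s * (exp (- (z / \<epsilon>)) * \<psi>' (x + s * z)) - 1 / \<epsilon> * (exp (- (z / \<epsilon>)) * \<psi> (x + s * z))) (at z)"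
      using DERIV_mult[OF 2 1] by (simp add: algebra_simps)
    show "isCont (\<lambda>z. s * (exp (- (z / \<epsilon>)) * \<psi>' (x + s * z)) - 1 / \<epsilon> * (exp (- (z / \<epsilon>)) * \<psi> (x + s * z))) z"
      using \<epsilon> by (intro continuous_intros cont c) auto
  qed
  have N0: "\<psi> (x + s * N) = 0" using c(1) s by (auto simp: cont_supp_def N_def)
  have "- \<psi> x = (LINT z|lborel. s * ((exp (- (z / \<epsilon>)) * \<psi>' (x + s * z)) * indicator {0..N} z) - 1 / \<epsilon> * ((exp (- (z / \<epsilon>)) * \<psi> (x + s * z)) * indicator {0..N} z))"
    using has_bochner_integral_integral_eq[OF FTC, symmetric] N0
    by (simp only: left_diff_distrib mult.assoc) simp
  also have "\<dots> = s * (LINT z|lborel. (exp (- (z / \<epsilon>)) * \<psi>' (x + s * z)) * indicator {0..N} z) - 1 / \<epsilon> * (LINT z|lborel. (exp (- (z / \<epsilon>)) * \<psi> (x + s * z)) * indicator {0..N} z)"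
    using int[OF c(1)] int[OF c(2)] by simp
  finally have eq: "- \<psi> x = s * (LINT z|lborel. (exp (- (z / \<epsilon>)) * \<psi>' (x + s * z)) * indicator {0..N} z) - 1 / \<epsilon> * (LINT z|lborel. (exp (- (z / \<epsilon>)) * \<psi> (x + s * z)) * indicator {0..N} z)" .
  show "(LINT z|lborel. indicator {0..} z * (exp (- (z / \<epsilon>)) * \<psi>' (x + s * z)))
      = s * (1 / \<epsilon> * (LINT z|lborel. indicator {0..} z * (exp (- (z / \<epsilon>)) * \<psi> (x + s * z))) - \<psi> x)"
    unfolding ind[OF c(1)] ind[OF c(2)] using eq s by auto
qed

text \<open>Together these express \<epsilon>^2 g'' = g - (Dirac mass at 0) in the sense of
  distributions. The boundary terms of the two half-lines cancel for the even kernel and add up to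
  the Dirac mass for the odd one.\<close>

lemma
  fixes \<psi> \<psi>' :: "real \<Rightarrow> real"
  assumes \<epsilon>: "\<epsilon> > 0" and d: "\<And>x. (\<psi> has_real_derivative \<psi>' x) (at x)"
    and c: "cont_supp R \<psi>" "cont_supp R \<psi>'"
  shows conv_g_deriv: "conv (g_ker \<epsilon>) \<psi>' x = conv (dg_ker \<epsilon>) \<psi> x"
    and conv_dg_deriv: "\<epsilon>\<^sup>2 * conv (dg_ker \<epsilon>) \<psi>' x = conv (g_ker \<epsilon>) \<psi> x - \<psi> x"
proof -
  define J where "J s h = (LINT z|lborel. indicator {0..} z * (exp (- (z / \<epsilon>)) * h (x + s * z)))" for s :: real and h
  have J': "J s \<psi>' = s * (1 / \<epsilon> * J s \<psi> - \<psi> x)" if "s = 1 \<or> s = - 1" for s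
    unfolding J_def by (rule half_line_parts[OF \<epsilon> d c that])
  have Ji: "integrable lborel (\<lambda>z. indicator {0..} z * (exp (- (z / \<epsilon>)) * h (x + s * z)))"
    if "cont_supp R h" "s = 1 \<or> s = - 1" for h s
  proof -
    note h = that
    obtain B where B: "\<And>x. \<bar>h x\<bar> \<le> B" using cont_supp_bounded[OF h(1)] by metis
    have [measurable]: "h \<in> borel_measurable borel" by (rule cont_supp_measurable[OF h(1)])
    show ?thesis
    proof (rule Bochner_Integration.integrable_bound)
      show "integrable lborel (\<lambda>z. B * exp (- (1 / \<epsilon> * \<bar>z\<bar>)))" by (intro integrable_mult_right integrable_exp_abs) (use \<epsilon> in auto)
      have "norm (indicator {0..} z * (exp (- (z / \<epsilon>)) * h (x + s * z))) \<le> norm (B * exp (- (1 / \<epsilon> * \<bar>z\<bar>)))" for z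
        using mult_right_mono[OF order_trans[OF B abs_ge_self], where c = "exp (- (z / \<epsilon>))"]
        by (auto simp: abs_mult mult.commute split: split_indicator)
      then show "AE z in lborel. norm (indicator {0..} z * (exp (- (z / \<epsilon>)) * h (x + s * z))) \<le> norm (B * exp (- (1 / \<epsilon> * \<bar>z\<bar>)))" by simp
    qed measurable
  qed
  have fold: "conv k h x = (LINT z|lborel. indicator {0..} z * (k (- z) * h (x + z) + k z * h (x - z)))"
    if "integrable lborel k" "cont_supp R h" for k h
  proof -
    note h = that
    obtain B where B: "\<And>x. \<bar>h x\<bar> \<le> B" using cont_supp_bounded[OF h(2)] by metis
    have "integrable lborel (\<lambda>y. k (x - y) * h y)"
      by (rule integrable_conv[OF h(1) cont_supp_measurable[OF h(2)] B])
    then have i: "integrable lborel (\<lambda>z. k (x - (x + z)) * h (x + z))"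
      using lborel_integrable_shift[of "\<lambda>y. k (x - y) * h y" x] by simp
    have "conv k h x = (LINT z|lborel. k (x - (x + z)) * h (x + z))"
      unfolding conv_def by (rule lborel_integral_shift[symmetric])
    also have "\<dots> = (LINT z|lborel. indicator {0..} z * (k (x - (x + z)) * h (x + z) + k (x - (x + - z)) * h (x + - z)))"
      by (rule integral_fold_abs[OF i])
    finally show ?thesis by simp
  qed
  have G: "conv (g_ker \<epsilon>) h x = 1 / (2 * \<epsilon>) * (J 1 h + J (- 1) h)" if "cont_supp R h" for h
  proof -
    have "conv (g_ker \<epsilon>) h x = (LINT z|lborel. 1 / (2 * \<epsilon>) * (indicator {0..} z * (exp (- (z / \<epsilon>)) * h (x + 1 * z)) + indicator {0..} z * (exp (- (z / \<epsilon>)) * h (x + - 1 * z))))"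
      unfolding fold[OF integrable_g_ker[OF \<epsilon>] that]
      by (intro Bochner_Integration.integral_cong refl) (auto simp: g_ker_def distrib_left split: split_indicator)
    then show ?thesis using Ji[OF that, of 1] Ji[OF that, of "- 1"] by (simp add: J_def)
  qed
  have DG: "conv (dg_ker \<epsilon>) h x = 1 / (2 * \<epsilon>\<^sup>2) * (J 1 h - J (- 1) h)" if "cont_supp R h" for h
  proof -
    have [measurable]: "h \<in> borel_measurable borel" by (rule cont_supp_measurable[OF that])
    have "conv (dg_ker \<epsilon>) h x = (LINT z|lborel. 1 / (2 * \<epsilon>\<^sup>2) * (indicator {0..} z * (exp (- (z / \<epsilon>)) * h (x + 1 * z)) - indicator {0..} z * (exp (- (z / \<epsilon>)) * h (x + - 1 * z))))"
      unfolding fold[OF integrable_dg_ker[OF \<epsilon>] that]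
    proof (rule integral_cong_AE)
      show "AE z in lborel. indicator {0..} z * (dg_ker \<epsilon> (- z) * h (x + z) + dg_ker \<epsilon> z * h (x - z))
        = 1 / (2 * \<epsilon>\<^sup>2) * (indicator {0..} z * (exp (- (z / \<epsilon>)) * h (x + 1 * z)) - indicator {0..} z * (exp (- (z / \<epsilon>)) * h (x + - 1 * z)))"
        by (rule AE_mp[OF AE_lborel_singleton[of 0] AE_I2])
           (use \<epsilon> in \<open>auto simp: dg_ker_def g_ker_def power2_eq_square field_simps split: split_indicator\<close>)
    qed measurable
    then show ?thesis using Ji[OF that, of 1] Ji[OF that, of "- 1"] by (simp add: J_def)
  qed
  show "conv (g_ker \<epsilon>) \<psi>' x = conv (dg_ker \<epsilon>) \<psi> x"
    unfolding G[OF c(2)] DG[OF c(1)] using \<epsilon> by (simp add: J' power2_eq_square field_simps)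
  show "\<epsilon>\<^sup>2 * conv (dg_ker \<epsilon>) \<psi>' x = conv (g_ker \<epsilon>) \<psi> x - \<psi> x"
    unfolding G[OF c(1)] DG[OF c(2)] using \<epsilon> by (simp add: J' power2_eq_square field_simps)
qed

text \<open>Both derivatives rest on \<psi>, so w may have jumps and grow linearly. The growth is
  put into the weighted kernel and a weight 1 + |x| on the test function, which gives the majorant
  required by \<open>conv_dual\<close>.\<close>

lemma conv_g_weak_step:
  fixes \<psi> \<psi>' \<psi>'' :: "real \<Rightarrow> real"
  assumes \<epsilon>: "\<epsilon> > 0" and w: "lin_growth w"
    and d: "\<And>x. (\<psi> has_real_derivative \<psi>' x) (at x)" "\<And>x. (\<psi>' has_real_derivative \<psi>'' x) (at x)"
    and c: "cont_supp R \<psi>" "cont_supp R \<psi>'" "cont_supp R \<psi>''"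
  shows "(LINT x|lborel. (conv (g_ker \<epsilon>) w x - w x) * \<psi> x) = \<epsilon>\<^sup>2 * (LINT x|lborel. conv (g_ker \<epsilon>) w x * \<psi>'' x)"
proof -
  note wm = lin_growthD[OF w]
  obtain A where A: "A \<ge> 0" "\<And>x y. \<bar>g_ker \<epsilon> (x - y) * w y\<bar> \<le> A * (1 + \<bar>x\<bar>) * (g_ker \<epsilon> (x - y) * (1 + \<bar>x - y\<bar>))"
    using lin_growth_conv_bound[OF w \<epsilon>] by blast
  have dom: "\<bar>g_ker \<epsilon> (x - y) * w y * h x\<bar> \<le> A * (g_ker \<epsilon> (x - y) * (1 + \<bar>x - y\<bar>)) * ((1 + \<bar>x\<bar>) * \<bar>h x\<bar>)" for h x y
    using mult_right_mono[OF A(2) abs_ge_zero, of x y "h x"] by (simp add: abs_mult ac_simps)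
  have ci: "integrable lborel (\<lambda>x. (1 + \<bar>x\<bar>) * \<bar>h x\<bar>)" if "cont_supp R h" for h
    by (rule cont_supp_integrable[of R]) (use that in \<open>auto simp: cont_supp_def intro!: continuous_intros\<close>)
  have iK: "integrable lborel (\<lambda>z. A * (g_ker \<epsilon> z * (1 + \<bar>z\<bar>)))"
    by (intro integrable_mult_right integrable_weighted_g_ker \<epsilon>)
  have dual: "(LINT x|lborel. conv (g_ker \<epsilon>) w x * h x) = (LINT y|lborel. w y * conv (\<lambda>z. g_ker \<epsilon> (- z)) h y)" if "cont_supp R h" for h
    by (rule conv_dual[where K = "\<lambda>z. A * (g_ker \<epsilon> z * (1 + \<bar>z\<bar>))" and c = "\<lambda>x. (1 + \<bar>x\<bar>) * \<bar>h x\<bar>" and k = "g_ker \<epsilon>" and a = w and b = h, OF g_ker_measurable wm cont_supp_measurable[OF that] iK ci[OF that] dom[where h = h]])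
  have i1: "integrable lborel (\<lambda>x. conv (g_ker \<epsilon>) w x * h x)" if "cont_supp R h" for h
    by (rule integrable_conv_mult[where K = "\<lambda>z. A * (g_ker \<epsilon> z * (1 + \<bar>z\<bar>))" and c = "\<lambda>x. (1 + \<bar>x\<bar>) * \<bar>h x\<bar>" and k = "g_ker \<epsilon>" and a = w and b = h, OF g_ker_measurable wm cont_supp_measurable[OF that] iK ci[OF that] dom[where h = h]])
  have i2: "integrable lborel (\<lambda>y. w y * conv (\<lambda>z. g_ker \<epsilon> (- z)) h y)" if "cont_supp R h" for h
    by (rule integrable_mult_conv[where K = "\<lambda>z. A * (g_ker \<epsilon> z * (1 + \<bar>z\<bar>))" and c = "\<lambda>x. (1 + \<bar>x\<bar>) * \<bar>h x\<bar>" and k = "g_ker \<epsilon>" and a = w and b = h, OF g_ker_measurable wm cont_supp_measurable[OF that] iK ci[OF that] dom[where h = h]])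
  obtain A' where A': "\<And>x. \<bar>w x\<bar> \<le> A' * (1 + \<bar>x\<bar>)" using lin_growth_bound[OF w] by metis
  have i3: "integrable lborel (\<lambda>x. w x * \<psi> x)"
  proof (rule Bochner_Integration.integrable_bound[OF integrable_mult_right[OF ci[OF c(1)], of A']])
    show "(\<lambda>x. w x * \<psi> x) \<in> borel_measurable lborel" using wm cont_supp_measurable[OF c(1)] by simp
    have "\<bar>w x * \<psi> x\<bar> \<le> \<bar>A' * ((1 + \<bar>x\<bar>) * \<bar>\<psi> x\<bar>)\<bar>" for x
      using mult_right_mono[OF A' abs_ge_zero, of x "\<psi> x"] abs_ge_self order_trans by (fastforce simp: abs_mult mult.assoc)
    then show "AE x in lborel. norm (w x * \<psi> x) \<le> norm (A' * ((1 + \<bar>x\<bar>) * \<bar>\<psi> x\<bar>))" by simp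
  qed
  have key: "\<epsilon>\<^sup>2 * conv (g_ker \<epsilon>) \<psi>'' x = conv (g_ker \<epsilon>) \<psi> x - \<psi> x" for x
    unfolding conv_g_deriv[OF \<epsilon> d(2) c(2,3)] by (rule conv_dg_deriv[OF \<epsilon> d(1) c(1,2)])
  have "\<epsilon>\<^sup>2 * (LINT x|lborel. conv (g_ker \<epsilon>) w x * \<psi>'' x) = \<epsilon>\<^sup>2 * (LINT y|lborel. w y * conv (g_ker \<epsilon>) \<psi>'' y)"
    using dual[OF c(3)] by simp
  also have "\<dots> = (LINT y|lborel. w y * (\<epsilon>\<^sup>2 * conv (g_ker \<epsilon>) \<psi>'' y))"
    by (subst integral_mult_right_zero[symmetric]) (simp add: mult.left_commute)
  also have "\<dots> = (LINT y|lborel. w y * conv (g_ker \<epsilon>) \<psi> y - w y * \<psi> y)"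
    unfolding key by (simp add: right_diff_distrib)
  also have "\<dots> = (LINT y|lborel. w y * conv (g_ker \<epsilon>) \<psi> y) - (LINT y|lborel. w y * \<psi> y)"
    using i2[OF c(1)] i3 by simp
  also have "(LINT y|lborel. w y * conv (g_ker \<epsilon>) \<psi> y) = (LINT x|lborel. conv (g_ker \<epsilon>) w x * \<psi> x)"
    using dual[OF c(1)] by simp
  also have "(LINT x|lborel. conv (g_ker \<epsilon>) w x * \<psi> x) - (LINT y|lborel. w y * \<psi> y) = (LINT x|lborel. (conv (g_ker \<epsilon>) w x - w x) * \<psi> x)"
    using i1[OF c(1)] i3 by (simp add: left_diff_distrib)
  finally show ?thesis by simp
qed

lemma conv_g_weak_deriv:
  fixes \<psi> \<psi>' :: "real \<Rightarrow> real"
  assumes \<epsilon>: "\<epsilon> > 0" and w: "L1_bounded w"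
    and d: "\<And>x. (\<psi> has_real_derivative \<psi>' x) (at x)" and c: "cont_supp R \<psi>" "cont_supp R \<psi>'"
  shows "(LINT x|lborel. conv (g_ker \<epsilon>) w x * \<psi>' x) = - (LINT x|lborel. conv (dg_ker \<epsilon>) w x * \<psi> x)"
proof -
  obtain B where B: "w \<in> borel_measurable borel" "integrable lborel w" "B \<ge> 0" "\<And>x. \<bar>w x\<bar> \<le> B"
    using L1_boundedE[OF w] by metis
  note g = integrable_g_ker[OF \<epsilon>] and dg = integrable_dg_ker[OF \<epsilon>]
  have ci: "integrable lborel \<psi>" "integrable lborel \<psi>'" using c[THEN L1_bounded_cont_supp] by (auto simp: L1_bounded_def)
  have "(LINT x|lborel. conv (g_ker \<epsilon>) w x * \<psi>' x) = (LINT y|lborel. w y * conv (\<lambda>z. g_ker \<epsilon> (- z)) \<psi>' y)"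
    by (rule conv_dual_bounded[OF g B(1,4) ci(2)])
  also have "\<dots> = (LINT y|lborel. w y * conv (dg_ker \<epsilon>) \<psi> y)"
    by (simp add: conv_g_deriv[OF \<epsilon> d c])
  also have "\<dots> = - (LINT y|lborel. w y * conv (\<lambda>z. dg_ker \<epsilon> (- z)) \<psi> y)" by (simp add: conv_def)
  also have "(LINT y|lborel. w y * conv (\<lambda>z. dg_ker \<epsilon> (- z)) \<psi> y) = (LINT x|lborel. conv (dg_ker \<epsilon>) w x * \<psi> x)"
    by (rule conv_dual_bounded[symmetric, OF dg B(1,4) ci(1)])
  finally show ?thesis .
qed

subsection \<open>The scheme\<close>

text \<open>The invariant carried through the iteration: the sign conditions, with a growth bound
  that convolution preserves.\<close>

definition interface_state :: "(real \<Rightarrow> real) \<Rightarrow> real \<Rightarrow> bool" where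
  "interface_state u \<xi> \<longleftrightarrow> lin_growth u \<and> (\<forall>x\<le>\<xi>. - 2 \<le> u x \<and> u x \<le> 0) \<and> (\<forall>x>\<xi>. 0 \<le> u x)"

lemma admissible_interface_state:
  assumes "admissible_state u \<xi>" shows "interface_state u \<xi>"
proof -
  note adm = assms[unfolded admissible_state_def]
  from adm obtain \<alpha> where \<alpha>: "\<alpha> > 0" "\<And>x. x > \<xi> \<Longrightarrow> u x \<le> \<alpha> * (x - \<xi>) + 2" by blast
  have lo: "\<And>x. x \<le> \<xi> \<Longrightarrow> - 2 \<le> u x \<and> u x \<le> 0" and hi: "\<And>x. x > \<xi> \<Longrightarrow> 0 \<le> u x" using adm by blast+
  have "continuous_on ({..<\<xi>} \<union> {\<xi><..}) u" using adm by (intro continuous_on_open_Un) auto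
  also have "{..<\<xi>} \<union> {\<xi><..} = - {\<xi>}" by auto
  finally have m: "u \<in> borel_measurable borel"
    by (intro borel_measurable_continuous_countable_exceptions[of "{\<xi>}"]) auto
  have "\<bar>u x\<bar> \<le> (\<alpha> + \<alpha> * \<bar>\<xi>\<bar> + 2) * (1 + \<bar>x\<bar>)" for x
  proof -
    have pos: "0 \<le> \<alpha> * \<bar>x\<bar>" "0 \<le> \<alpha> * \<bar>\<xi>\<bar>" "0 \<le> \<alpha> * \<bar>\<xi>\<bar> * \<bar>x\<bar>" using \<alpha> by auto
    have "\<alpha> * (x - \<xi>) \<le> \<alpha> * (\<bar>x\<bar> + \<bar>\<xi>\<bar>)" using \<alpha> by (intro mult_left_mono) auto
    then have up: "x > \<xi> \<Longrightarrow> \<bar>u x\<bar> \<le> \<alpha> * \<bar>x\<bar> + \<alpha> * \<bar>\<xi>\<bar> + 2"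
      using hi[of x] \<alpha>(2)[of x] by (simp add: distrib_left)
    have "\<bar>u x\<bar> \<le> \<alpha> * \<bar>x\<bar> + \<alpha> * \<bar>\<xi>\<bar> + 2"
      using up lo[of x] pos by (cases "x \<le> \<xi>") auto
    also have "\<dots> \<le> (\<alpha> + \<alpha> * \<bar>\<xi>\<bar> + 2) * (1 + \<bar>x\<bar>)"
      using pos \<alpha>(1) by (simp add: algebra_simps)
    finally show ?thesis .
  qed
  with m lo hi show ?thesis by (auto simp: interface_state_def lin_growth_def)
qed

section \<open>Motion of the interface and propagation of the sign bounds\<close>

lemma conv_mono_except:
  assumes "lin_growth v" "lin_growth w" "\<epsilon> > 0" "\<And>y. y \<noteq> a \<Longrightarrow> v y \<le> w y"
  shows "conv (g_ker \<epsilon>) v x \<le> conv (g_ker \<epsilon>) w x"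
  unfolding conv_def
proof (rule integral_mono_AE)
  show "AE y in lborel. g_ker \<epsilon> (x - y) * v y \<le> g_ker \<epsilon> (x - y) * w y"
    by (rule AE_mp[OF AE_lborel_singleton[of a] AE_I2]) (auto intro!: mult_left_mono g_ker_nonneg assms)
qed (intro integrable_g_lin assms)+

text \<open>A lower comparison function rules out v(\<xi>) < -1, so the interface never moves right.
  If v(\<xi>) > 1, the Harnack inequality for -u makes v decay to the left of \<xi>; the level 1 is
  therefore attained, and the largest point where this happens bounds an interval on which v >=
  1.\<close>

lemma next_interface_cases:
  assumes "interface_state u \<xi>" "\<epsilon> > 0"
  defines "v \<equiv> conv (g_ker \<epsilon>) u" and "\<xi>' \<equiv> next_interface (conv (g_ker \<epsilon>) u) \<xi>"
  shows "\<xi>' = \<xi> \<and> \<bar>v \<xi>\<bar> \<le> 1 \<or> \<xi>' < \<xi> \<and> v \<xi>' = 1 \<and> (\<forall>x. \<xi>' \<le> x \<and> x \<le> \<xi> \<longrightarrow> 1 \<le> v x)"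
proof -
  have lg: "lin_growth u" and neg: "\<And>y. y \<le> \<xi> \<Longrightarrow> u y \<le> 0" and lo: "\<And>y. y \<le> \<xi> \<Longrightarrow> - 2 \<le> u y" and hi: "\<And>y. y > \<xi> \<Longrightarrow> 0 \<le> u y"
    using assms(1) by (auto simp: interface_state_def)
  have cv: "continuous_on UNIV v" unfolding v_def by (rule continuous_conv_g[OF lg assms(2)])
  \<comment> \<open>The smallest profile compatible with the sign bounds: -2 on the left and 0 on
    the right. By symmetry its convolution at \<xi> is -1.\<close>
  have "conv (g_ker \<epsilon>) (\<lambda>y. sgn (y - \<xi>) + - 1) \<xi> \<le> v \<xi>"
    unfolding v_def
  proof (rule conv_mono_except[of _ _ _ \<xi>])
    show "lin_growth (\<lambda>y. sgn (y - \<xi>) + - 1)" by (intro lin_growth_add lin_growth_sgn) (auto intro: lin_growth_bounded[of _ 1])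
    fix y assume "y \<noteq> \<xi>"
    then show "sgn (y - \<xi>) + - 1 \<le> u y" using lo[of y] hi[of y] by (auto simp: sgn_if)
  qed (use lg assms in auto)
  moreover have "conv (g_ker \<epsilon>) (\<lambda>y. sgn (y - \<xi>) + - 1) \<xi> = - 1"
    by (subst conv_add) (auto simp: conv_g_sgn conv_const assms lin_growth_sgn intro: lin_growth_bounded[of _ 1])
  ultimately have ge: "- 1 \<le> v \<xi>" by simp
  show ?thesis
  proof (cases "v \<xi> > 1")
    case False
    then have "\<xi>' = \<xi>" using ge by (simp add: \<xi>'_def next_interface_def v_def)
    with False ge show ?thesis by auto
  next
    case True
    \<comment> \<open>The greatest point at level 1 is found as the supremum of a sublevel set,
      which is closed and bounded above; the intermediate value theorem excludes v < 1
      there.\<close>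
    define S where "S = {y. y \<le> \<xi> \<and> v y \<le> 1}"
    have dec: "v x \<le> exp (- \<bar>x - \<xi>\<bar> / \<epsilon>) * v \<xi>" if "x \<le> \<xi>" for x
    proof -
      have "exp (- \<bar>x - \<xi>\<bar> / \<epsilon>) * conv (g_ker \<epsilon>) (\<lambda>y. - u y) \<xi> \<le> conv (g_ker \<epsilon>) (\<lambda>y. - u y) x"
      proof (rule conv_harnack[OF lin_growth_minus[OF lg] assms(2)])
        show "0 \<le> - u y \<or> x \<le> \<xi> \<and> \<xi> \<le> y \<or> y \<le> \<xi> \<and> \<xi> \<le> x" for y using neg[of y] that by fastforce
      qed
      then show ?thesis by (simp add: conv_minus v_def)
    qed
    \<comment> \<open>The distance at which the Harnack factor exp(-|x - \<xi>| / \<epsilon>) has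
      reduced v(\<xi>) to 1.\<close>
    define x0 where "x0 = \<xi> - \<epsilon> * ln (v \<xi>)"
    have "x0 \<le> \<xi>" using True assms by (simp add: x0_def)
    moreover have "v x0 \<le> 1"
    proof -
      have "- \<bar>x0 - \<xi>\<bar> / \<epsilon> = - ln (v \<xi>)" using True assms by (simp add: x0_def abs_mult)
      then have "exp (- \<bar>x0 - \<xi>\<bar> / \<epsilon>) * v \<xi> = 1" using True by (simp add: exp_minus)
      then show ?thesis using dec[OF \<open>x0 \<le> \<xi>\<close>] by simp
    qed
    ultimately have ne: "S \<noteq> {}" by (auto simp: S_def)
    have S_eq: "S = {..\<xi>} \<inter> v -` {..1}" by (auto simp: S_def)
    have cl: "closed S" unfolding S_eq using cv
      by (intro closed_Int closed_atMost) (simp add: continuous_on_closed_vimage)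
    have bd: "bdd_above S" by (auto simp: S_def)
    define m where "m = Sup S"
    have mS: "m \<in> S" unfolding m_def by (rule closed_contains_Sup[OF ne bd cl])
    have up: "y \<le> m" if "y \<le> \<xi>" "v y \<le> 1" for y
      unfolding m_def by (rule cSup_upper[OF _ bd]) (use that in \<open>simp add: S_def\<close>)
    have "m < \<xi>" using mS True by (cases "m = \<xi>") (auto simp: S_def)
    have v1: "v m = 1"
    proof (rule ccontr)
      assume "v m \<noteq> 1"
      then have "v m \<le> 1" "v m < 1" using mS by (auto simp: S_def)
      then obtain y where y: "m \<le> y" "y \<le> \<xi>" "v y = 1"
        using IVT'[of v m 1 \<xi>] True \<open>m < \<xi>\<close> continuous_on_subset[OF cv] by auto
      then show False using up[of y] \<open>v m \<noteq> 1\<close> by auto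
    qed
    have "\<xi>' = (GREATEST y. y < \<xi> \<and> v y = 1)" using True by (simp add: \<xi>'_def next_interface_def v_def)
    also have "\<dots> = m" by (rule Greatest_equality) (use \<open>m < \<xi>\<close> v1 up in auto)
    finally have "\<xi>' = m" .
    moreover have "1 \<le> v x" if "m \<le> x" "x \<le> \<xi>" for x
      using up[of x] that v1 by (cases "x = m") (auto intro: leI)
    ultimately show ?thesis using \<open>m < \<xi>\<close> v1 by blast
  qed
qed

lemma s_ker_eq: "x \<noteq> 0 \<Longrightarrow> s_ker \<epsilon> x = sgn x * exp (- \<bar>x\<bar> / \<epsilon>)"
  by (auto simp: s_ker_def sgn_if)

text \<open>The source -exp(-|x - \<xi>'| / \<epsilon>) on the left is minus the Harnack factor.
  Since -1 <= v(\<xi>') <= 1, the inequality for -u gives the upper bound and that for u + 2 the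
  lower one. On the right, u is known to be nonnegative only beyond the old interface, so the
  inequality is based at \<xi>, and v >= 1 covers the interval in between.\<close>

lemma interface_state_step:
  assumes st: "interface_state u \<xi>" and \<epsilon>: "\<epsilon> > 0"
  defines "v \<equiv> conv (g_ker \<epsilon>) u" and "\<xi>' \<equiv> next_interface (conv (g_ker \<epsilon>) u) \<xi>"
  shows "interface_state (\<lambda>x. v x + s_ker \<epsilon> (x - \<xi>')) \<xi>'"
proof -
  have lg: "lin_growth u" and neg: "\<And>y. y \<le> \<xi> \<Longrightarrow> u y \<le> 0" and lo: "\<And>y. y \<le> \<xi> \<Longrightarrow> - 2 \<le> u y" and hi: "\<And>y. y > \<xi> \<Longrightarrow> 0 \<le> u y"
    using st by (auto simp: interface_state_def)
  from next_interface_cases[OF st \<epsilon>]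
  have cs: "\<xi>' = \<xi> \<and> \<bar>v \<xi>\<bar> \<le> 1 \<or> \<xi>' < \<xi> \<and> v \<xi>' = 1 \<and> (\<forall>x. \<xi>' \<le> x \<and> x \<le> \<xi> \<longrightarrow> 1 \<le> v x)"
    unfolding v_def \<xi>'_def .
  then have le: "\<xi>' \<le> \<xi>" and vxi: "- 1 \<le> v \<xi>'" "v \<xi>' \<le> 1" by auto
  have s_meas: "(\<lambda>x. s_ker \<epsilon> (x - \<xi>')) \<in> borel_measurable borel" unfolding s_ker_def by measurable
  have "\<bar>s_ker \<epsilon> (x - \<xi>')\<bar> \<le> 1" for x using \<epsilon> by (auto simp: s_ker_def divide_le_0_iff)
  then have lgu: "lin_growth (\<lambda>x. v x + s_ker \<epsilon> (x - \<xi>'))"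
    unfolding v_def by (intro lin_growth_add lin_growth_conv lg \<epsilon> lin_growth_bounded[OF s_meas])
  have left: "- 2 \<le> v x + s_ker \<epsilon> (x - \<xi>') \<and> v x + s_ker \<epsilon> (x - \<xi>') \<le> 0" if "x \<le> \<xi>'" for x
  proof -
    let ?e = "exp (- \<bar>x - \<xi>'\<bar> / \<epsilon>)"
    have s: "s_ker \<epsilon> (x - \<xi>') = - ?e" using that by (simp add: s_ker_def)
    have "?e * conv (g_ker \<epsilon>) (\<lambda>y. - u y) \<xi>' \<le> conv (g_ker \<epsilon>) (\<lambda>y. - u y) x"
    proof (rule conv_harnack[OF lin_growth_minus[OF lg] \<epsilon>])
      show "0 \<le> - u y \<or> x \<le> \<xi>' \<and> \<xi>' \<le> y \<or> y \<le> \<xi>' \<and> \<xi>' \<le> x" for y using neg[of y] le that by fastforce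
    qed
    then have "v x \<le> ?e * v \<xi>'" by (simp add: conv_minus v_def)
    also have "\<dots> \<le> ?e" using vxi by simp
    finally have 1: "v x \<le> ?e" .
    have l2: "lin_growth (\<lambda>y. 2)" by (rule lin_growth_bounded[of _ 2]) auto
    have add2: "conv (g_ker \<epsilon>) (\<lambda>y. u y + 2) z = v z + 2" for z
      unfolding v_def by (subst conv_add[OF lg l2 \<epsilon>]) (simp add: conv_const[OF \<epsilon>])
    have "?e * conv (g_ker \<epsilon>) (\<lambda>y. u y + 2) \<xi>' \<le> conv (g_ker \<epsilon>) (\<lambda>y. u y + 2) x"
    proof (rule conv_harnack[OF lin_growth_add[OF lg l2] \<epsilon>])
      show "0 \<le> u y + 2 \<or> x \<le> \<xi>' \<and> \<xi>' \<le> y \<or> y \<le> \<xi>' \<and> \<xi>' \<le> x" for y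
        using lo[of y] hi[of y] by (cases "y \<le> \<xi>") auto
    qed
    then have "?e * (v \<xi>' + 2) \<le> v x + 2" unfolding add2 .
    moreover have "?e * 1 \<le> ?e * (v \<xi>' + 2)" using vxi by (intro mult_left_mono) auto
    ultimately have "?e \<le> v x + 2" by (simp only: mult_1_right)
    then show ?thesis using 1 s by simp
  qed
  have right: "0 \<le> v x + s_ker \<epsilon> (x - \<xi>')" if "x > \<xi>'" for x
  proof -
    let ?e = "exp (- \<bar>x - \<xi>'\<bar> / \<epsilon>)"
    have s: "s_ker \<epsilon> (x - \<xi>') = ?e" using that by (simp add: s_ker_def)
    have har: "exp (- \<bar>x - \<xi>\<bar> / \<epsilon>) * v \<xi> \<le> v x" if "x > \<xi>" for x
      unfolding v_def
    proof (rule conv_harnack[OF lg \<epsilon>])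
      show "0 \<le> u y \<or> x \<le> \<xi> \<and> \<xi> \<le> y \<or> y \<le> \<xi> \<and> \<xi> \<le> x" for y using hi[of y] that by fastforce
    qed
    from cs show ?thesis
    proof
      assume *: "\<xi>' = \<xi> \<and> \<bar>v \<xi>\<bar> \<le> 1"
      then have "?e * - 1 \<le> ?e * v \<xi>" by (intro mult_left_mono) auto
      then show ?thesis using har[of x] that * s by simp
    next
      assume *: "\<xi>' < \<xi> \<and> v \<xi>' = 1 \<and> (\<forall>x. \<xi>' \<le> x \<and> x \<le> \<xi> \<longrightarrow> 1 \<le> v x)"
      have e: "0 \<le> ?e" by simp
      show ?thesis
      proof (cases "x \<le> \<xi>")
        case True
        then have "1 \<le> v x" using * that by auto
        then show ?thesis unfolding s using e by linarith
      next
        case False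
        have "1 \<le> v \<xi>" using * by auto
        then have "0 \<le> exp (- \<bar>x - \<xi>\<bar> / \<epsilon>) * v \<xi>" by simp
        then show ?thesis unfolding s using e har[of x] False by linarith
      qed
    qed
  qed
  show ?thesis unfolding interface_state_def using lgu left right by blast
qed

lemma conv_g_shift_sgn_continuous:
  assumes st: "interface_state u \<xi>" and \<epsilon>: "\<epsilon> > 0"
  shows "continuous_on UNIV (conv (g_ker \<epsilon>) (\<lambda>y. u y - sgn (y - a)))"
    and "lin_growth (conv (g_ker \<epsilon>) (\<lambda>y. u y - sgn (y - a)))"
  using st \<epsilon> by (auto simp: interface_state_def intro!: continuous_conv_g lin_growth_conv lin_growth_diff lin_growth_sgn)

text \<open>Off a, \<open>s_ker\<close> turns g * u - sgn into g * (u - sgn) by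
  \<open>conv_g_sgn\<close>. The right-hand side is continuous, which fixes the value that
  \<open>p_of\<close> assigns at a by a limit.\<close>

lemma p_of_step:
  assumes st: "interface_state u \<xi>" and \<epsilon>: "\<epsilon> > 0"
  shows "p_of (\<lambda>x. conv (g_ker \<epsilon>) u x + s_ker \<epsilon> (x - a)) a = conv (g_ker \<epsilon>) (\<lambda>y. u y - sgn (y - a))"
proof
  fix x
  have lg: "lin_growth u" using st by (simp add: interface_state_def)
  have off: "conv (g_ker \<epsilon>) u y + s_ker \<epsilon> (y - a) - sgn (y - a) = conv (g_ker \<epsilon>) (\<lambda>y. u y - sgn (y - a)) y" if "y \<noteq> a" for y
    using that by (simp add: conv_diff[OF lg lin_growth_sgn \<epsilon>] conv_g_sgn[OF \<epsilon>] s_ker_eq algebra_simps)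
  have "((\<lambda>y. conv (g_ker \<epsilon>) (\<lambda>y. u y - sgn (y - a)) y) \<longlongrightarrow> conv (g_ker \<epsilon>) (\<lambda>y. u y - sgn (y - a)) a) (at a)"
    using conv_g_shift_sgn_continuous(1)[OF st \<epsilon>, of a] by (simp add: continuous_on_def)
  moreover have "\<forall>\<^sub>F y in at a. conv (g_ker \<epsilon>) (\<lambda>y. u y - sgn (y - a)) y = conv (g_ker \<epsilon>) u y + s_ker \<epsilon> (y - a) - sgn (y - a)"
    by (auto simp: eventually_at_filter off)
  ultimately have "((\<lambda>y. conv (g_ker \<epsilon>) u y + s_ker \<epsilon> (y - a) - sgn (y - a)) \<longlongrightarrow> conv (g_ker \<epsilon>) (\<lambda>y. u y - sgn (y - a)) a) (at a)"
    by (blast intro: Lim_transform_eventually)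
  then have "Lim (at a) (\<lambda>y. conv (g_ker \<epsilon>) u y + s_ker \<epsilon> (y - a) - sgn (y - a)) = conv (g_ker \<epsilon>) (\<lambda>y. u y - sgn (y - a)) a"
    by (intro tendsto_Lim) auto
  then show "p_of (\<lambda>x. conv (g_ker \<epsilon>) u x + s_ker \<epsilon> (x - a)) a x = conv (g_ker \<epsilon>) (\<lambda>y. u y - sgn (y - a)) x"
    using off by (simp add: p_of_def)
qed

text \<open>The jump 2 of u matches that of the sign, so both one-sided limits of u - sgn equal l +
  1.\<close>

lemma p_of_initial:
  assumes "admissible_state u \<xi>"
  shows "continuous_on UNIV (p_of u \<xi>)" "lin_growth (p_of u \<xi>)"
proof -
  from assms obtain l r where lr: "(u \<longlongrightarrow> l) (at_left \<xi>)" "(u \<longlongrightarrow> r) (at_right \<xi>)" "r - l = 2"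
    by (auto simp: admissible_state_def)
  have "((\<lambda>y. u y - sgn (y - \<xi>)) \<longlongrightarrow> l + 1) (at_left \<xi>)"
  proof (rule Lim_transform_eventually)
    show "((\<lambda>y. u y - - 1) \<longlongrightarrow> l + 1) (at_left \<xi>)" using tendsto_diff[OF lr(1) tendsto_const[of "- 1"]] by simp
    show "\<forall>\<^sub>F y in at_left \<xi>. u y - - 1 = u y - sgn (y - \<xi>)"
      by (auto simp: eventually_at_filter sgn_if)
  qed
  moreover have "((\<lambda>y. u y - sgn (y - \<xi>)) \<longlongrightarrow> l + 1) (at_right \<xi>)"
  proof (rule Lim_transform_eventually)
    have "((\<lambda>y. u y - 1) \<longlongrightarrow> r - 1) (at_right \<xi>)" by (intro tendsto_diff lr tendsto_const)
    then show "((\<lambda>y. u y - 1) \<longlongrightarrow> l + 1) (at_right \<xi>)" using lr(3) by (simp add: algebra_simps)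
    show "\<forall>\<^sub>F y in at_right \<xi>. u y - 1 = u y - sgn (y - \<xi>)"
      by (auto simp: eventually_at_filter sgn_if)
  qed
  ultimately have lim: "((\<lambda>y. u y - sgn (y - \<xi>)) \<longlongrightarrow> l + 1) (at \<xi>)"
    by (simp add: filterlim_at_split)
  have at: "p_of u \<xi> \<xi> = l + 1" unfolding p_of_def by (simp add: tendsto_Lim[OF _ lim])
  have pt: "(p_of u \<xi> \<longlongrightarrow> l + 1) (at \<xi>)"
    by (rule Lim_transform_eventually[OF lim]) (auto simp: eventually_at_filter p_of_def)
  have cu: "isCont u x" if "x \<noteq> \<xi>" for x
    using assms that by (cases "x < \<xi>") (auto simp: admissible_state_def continuous_on_eq_continuous_at)
  have cx: "isCont (p_of u \<xi>) x" if "x \<noteq> \<xi>" for x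
  proof -
    have s: "isCont (\<lambda>y. sgn (y - \<xi>)) x" using that by (intro continuous_intros) auto
    have "((\<lambda>y. u y - sgn (y - \<xi>)) \<longlongrightarrow> u x - sgn (x - \<xi>)) (at x)"
      using isCont_diff[OF cu[OF that] s] by (simp add: isCont_def)
    moreover have "\<forall>\<^sub>F y in at x. u y - sgn (y - \<xi>) = p_of u \<xi> y"
      using eventually_neq_at_within[of \<xi> x UNIV] by eventually_elim (simp add: p_of_def)
    ultimately have "(p_of u \<xi> \<longlongrightarrow> u x - sgn (x - \<xi>)) (at x)" by (rule Lim_transform_eventually)
    then show ?thesis using that by (simp add: isCont_def p_of_def)
  qed
  show c: "continuous_on UNIV (p_of u \<xi>)"
    unfolding continuous_on_eq_continuous_at[OF open_UNIV]
  proof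
    fix x show "isCont (p_of u \<xi>) x" using cx[of x] pt at by (cases "x = \<xi>") (auto simp: isCont_def)
  qed
  have "lin_growth (\<lambda>x. u x - sgn (x - \<xi>))"
    using admissible_interface_state[OF assms] by (intro lin_growth_diff lin_growth_sgn) (simp add: interface_state_def)
  from lin_growth_bound[OF this] obtain A where A: "A \<ge> 0" "\<And>x. \<bar>u x - sgn (x - \<xi>)\<bar> \<le> A * (1 + \<bar>x\<bar>)" by blast
  have "\<bar>p_of u \<xi> x\<bar> \<le> (A + \<bar>l + 1\<bar>) * (1 + \<bar>x\<bar>)" for x
  proof (cases "x = \<xi>")
    case True
    have "\<bar>l + 1\<bar> \<le> \<bar>l + 1\<bar> * (1 + \<bar>x\<bar>)" by (simp add: algebra_simps)
    moreover have "0 \<le> A * (1 + \<bar>x\<bar>)" using A(1) by simp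
    ultimately show ?thesis using at True by (simp add: distrib_right)
  next
    case False
    have "0 \<le> \<bar>l + 1\<bar> * (1 + \<bar>x\<bar>)" by simp
    moreover have "\<bar>p_of u \<xi> x\<bar> \<le> A * (1 + \<bar>x\<bar>)" using A(2)[of x] False by (simp add: p_of_def)
    ultimately show ?thesis unfolding distrib_right[of A "\<bar>l + 1\<bar>" "1 + \<bar>x\<bar>"] by linarith
  qed
  then show "lin_growth (p_of u \<xi>)"
    using borel_measurable_continuous_onI[OF c] by (auto simp: lin_growth_def)
qed

text \<open>Turns the closed formula for the fluctuations into a recursion. The zeroth power is the
  identity operator rather than a function, hence the separate case k = 0; otherwise this is
  associativity.\<close>

lemma g_pow_conv_Suc:
  assumes \<epsilon>: "\<epsilon> > 0" and h: "L1_bounded h"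
  shows "g_pow_conv \<epsilon> (Suc k) h = conv (g_ker \<epsilon>) (g_pow_conv \<epsilon> k h)" and "L1_bounded (g_pow_conv \<epsilon> k h)"
proof -
  obtain B where B: "h \<in> borel_measurable borel" "\<And>x. \<bar>h x\<bar> \<le> B" using L1_boundedE[OF h] by metis
  have i: "integrable lborel (conv_power_Suc (g_ker \<epsilon>) m)" for m
    by (induction m) (auto intro!: integrable_conv_L1 integrable_g_ker \<epsilon>)
  show "g_pow_conv \<epsilon> (Suc k) h = conv (g_ker \<epsilon>) (g_pow_conv \<epsilon> k h)"
  proof (cases k)
    case (Suc m)
    show ?thesis unfolding Suc
      by (rule ext) (simp add: g_pow_conv_def conv_assoc[OF integrable_g_ker[OF \<epsilon>] i B])
  qed (simp add: g_pow_conv_def)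
  show "L1_bounded (g_pow_conv \<epsilon> k h)"
    by (cases k) (auto simp: g_pow_conv_def intro!: L1_bounded_conv i h)
qed

lemma L1_bounded_lin_growth: "L1_bounded w \<Longrightarrow> lin_growth w"
  by (metis L1_boundedE lin_growth_bounded)

lemma conv_sum:
  assumes "\<And>i. i \<in> I \<Longrightarrow> lin_growth (h i)" "\<epsilon> > 0"
  shows "conv (g_ker \<epsilon>) (\<lambda>y. \<Sum>i\<in>I. h i y) x = (\<Sum>i\<in>I. conv (g_ker \<epsilon>) (h i) x)"
  unfolding conv_def sum_distrib_left
  by (rule Bochner_Integration.integral_sum) (intro integrable_g_lin assms)

text \<open>For a <= b this is, almost everywhere, twice the indicator of the interval from a to b:
  the region that the interface sweeps in one step.\<close>

definition rho :: "real \<Rightarrow> real \<Rightarrow> real \<Rightarrow> real" where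
  "rho a b y = sgn (y - a) - sgn (y - b)"

lemma rho_measurable [measurable]: "rho a b \<in> borel_measurable borel"
  unfolding rho_def by measurable

lemma
  assumes "a \<le> b"
  shows rho_bounds: "0 \<le> rho a b y" "rho a b y \<le> 2"
    and rho_support: "y \<notin> {a..b} \<Longrightarrow> rho a b y = 0"
    and has_bochner_integral_rho: "has_bochner_integral lborel (rho a b) (2 * (b - a))"
proof -
  show 1: "0 \<le> rho a b y" "rho a b y \<le> 2" "y \<notin> {a..b} \<Longrightarrow> rho a b y = 0"
    using assms by (auto simp: rho_def sgn_if)
  have "has_bochner_integral lborel (\<lambda>y. indicator {a..b} y *\<^sub>R 2 :: real) (measure lborel {a..b} *\<^sub>R 2)"
    by (rule has_bochner_integral_indicator) (auto simp: emeasure_lborel_Icc_eq)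
  moreover have "AE y in lborel. indicator {a..b} y *\<^sub>R 2 = rho a b y"
    by (rule AE_mp[OF AE_lborel_singleton[of a]], rule AE_mp[OF AE_lborel_singleton[of b] AE_I2])
       (use assms in \<open>auto simp: rho_def sgn_if split: split_indicator\<close>)
  ultimately show "has_bochner_integral lborel (rho a b) (2 * (b - a))"
    using assms by (subst has_bochner_integral_cong_AE[symmetric, of "\<lambda>y. indicator {a..b} y *\<^sub>R 2"]) (auto simp: mult.commute)
qed

lemma L1_bounded_rho: "a \<le> b \<Longrightarrow> L1_bounded (rho a b)"
  using has_bochner_integral_rho[of a b] rho_bounds[of a b]
  by (auto simp: L1_bounded_def has_bochner_integral_iff intro!: exI[of _ 2])

section \<open>The iterates for a fixed \<epsilon>\<close>

locale scheme_run =
  fixes \<epsilon> :: real and u_ini :: "real \<Rightarrow> real" and \<xi>_ini :: real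
  assumes eps: "\<epsilon> > 0" and adm: "admissible_state u_ini \<xi>_ini"
begin

abbreviation "us \<equiv> u_seq \<epsilon> u_ini \<xi>_ini"
abbreviation "xs \<equiv> xi_seq \<epsilon> u_ini \<xi>_ini"
abbreviation "ps \<equiv> p_seq \<epsilon> u_ini \<xi>_ini"
abbreviation "fs \<equiv> f_seq \<epsilon> u_ini \<xi>_ini"
abbreviation "rs n \<equiv> rho (xs (Suc n)) (xs n)"
abbreviation "ws n \<equiv> (\<lambda>y. fs n y + rs n y)"

lemma xs_Suc: "xs (Suc n) = next_interface (conv (g_ker \<epsilon>) (us n)) (xs n)"
  and us_Suc: "us (Suc n) = (\<lambda>x. conv (g_ker \<epsilon>) (us n) x + s_ker \<epsilon> (x - xs (Suc n)))"
  by (auto simp: u_seq_def xi_seq_def scheme_def scheme_step_def Let_def split: prod.split)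

lemma state: "interface_state (us n) (xs n)"
proof (induction n)
  case 0
  then show ?case using admissible_interface_state[OF adm] by (simp add: u_seq_def xi_seq_def scheme_def)
next
  case (Suc n)
  from interface_state_step[OF this eps] show ?case unfolding us_Suc xs_Suc .
qed

lemma xs_cases:
  "xs (Suc n) = xs n \<or> xs (Suc n) < xs n \<and> conv (g_ker \<epsilon>) (us n) (xs (Suc n)) = 1"
  using next_interface_cases[OF state eps, of n] unfolding xs_Suc by auto

lemma xs_decreasing: "xs (Suc n) \<le> xs n"
  using xs_cases[of n] by auto

lemma xs_antimono: "m \<le> n \<Longrightarrow> xs n \<le> xs m"
  by (rule lift_Suc_antimono_le[of xs]) (rule xs_decreasing)

lemma lin_growth_us: "lin_growth (us n)"
  using state[of n] by (simp add: interface_state_def)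

lemma ps_Suc: "ps (Suc n) = conv (g_ker \<epsilon>) (\<lambda>y. us n y - sgn (y - xs (Suc n)))"
  unfolding p_seq_def us_Suc by (rule p_of_step[OF state eps])

lemma continuous_ps: "continuous_on UNIV (ps n)" and lin_growth_ps: "lin_growth (ps n)"
proof -
  have "continuous_on UNIV (ps n) \<and> lin_growth (ps n)"
  proof (cases n)
    case 0
    then show ?thesis using p_of_initial[OF adm] by (simp add: p_seq_def u_seq_def xi_seq_def scheme_def)
  next
    case (Suc m)
    then show ?thesis using conv_g_shift_sgn_continuous[OF state eps] by (simp add: ps_Suc)
  qed
  then show "continuous_on UNIV (ps n)" "lin_growth (ps n)" by auto
qed

lemma ps_eq: "x \<noteq> xs n \<Longrightarrow> ps n x = us n x - sgn (x - xs n)"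
  by (simp add: p_seq_def p_of_def)

lemma us_bounds: "x \<le> xs n \<Longrightarrow> - 2 \<le> us n x" "x \<le> xs n \<Longrightarrow> us n x \<le> 0" "xs n < x \<Longrightarrow> 0 \<le> us n x"
  using state[of n] by (auto simp: interface_state_def)

lemma ps_ge: "x \<noteq> xs n \<Longrightarrow> - 1 \<le> ps n x"
  using us_bounds[where x = x and n = n] by (auto simp: ps_eq sgn_if)

lemma ps_le: "x < xs n \<Longrightarrow> ps n x \<le> 1"
  using us_bounds[where x = x and n = n] by (auto simp: ps_eq)

lemma ps_at_moved_interface: "xs (Suc n) \<noteq> xs n \<Longrightarrow> ps (Suc n) (xs (Suc n)) = 1"
  using xs_cases[of n] unfolding ps_Suc
  by (simp add: conv_diff[OF lin_growth_us lin_growth_sgn eps] conv_g_sgn[OF eps])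

lemma weak_step:
  fixes \<psi> \<psi>' \<psi>'' :: "real \<Rightarrow> real"
  assumes d: "\<And>x. (\<psi> has_real_derivative \<psi>' x) (at x)" "\<And>x. (\<psi>' has_real_derivative \<psi>'' x) (at x)"
    and c: "cont_supp R \<psi>" "cont_supp R \<psi>'" "cont_supp R \<psi>''"
  shows "(LINT x|lborel. ((ps (Suc n) x + sgn (x - xs (Suc n))) - (ps n x + sgn (x - xs n))) * \<psi> x)
    = \<epsilon>\<^sup>2 * (LINT x|lborel. ps (Suc n) x * \<psi>'' x)"
proof -
  let ?w = "\<lambda>y. us n y - sgn (y - xs (Suc n))"
  have [measurable]: "ps m \<in> borel_measurable borel" "us m \<in> borel_measurable borel" for m
    using lin_growth_ps lin_growth_us by (auto dest: lin_growthD)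
  have [measurable]: "\<psi> \<in> borel_measurable borel" by (rule cont_supp_measurable[OF c(1)])
  have "(LINT x|lborel. ((ps (Suc n) x + sgn (x - xs (Suc n))) - (ps n x + sgn (x - xs n))) * \<psi> x)
     = (LINT x|lborel. (conv (g_ker \<epsilon>) ?w x - ?w x) * \<psi> x)"
  proof (rule integral_cong_AE)
    \<comment> \<open>The old interface is left out because there \<open>p_seq\<close> takes a limit
      instead of the value of u - sgn.\<close>
    show "AE x in lborel. ((ps (Suc n) x + sgn (x - xs (Suc n))) - (ps n x + sgn (x - xs n))) * \<psi> x = (conv (g_ker \<epsilon>) ?w x - ?w x) * \<psi> x"
      by (rule AE_mp[OF AE_lborel_singleton[of "xs n"] AE_I2]) (simp add: ps_eq[of _ n] ps_Suc algebra_simps)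
  qed measurable
  also have "\<dots> = \<epsilon>\<^sup>2 * (LINT x|lborel. ps (Suc n) x * \<psi>'' x)"
    unfolding ps_Suc by (rule conv_g_weak_step[OF eps lin_growth_diff[OF lin_growth_us lin_growth_sgn] d c])
  finally show ?thesis .
qed

lemma r_seq_eq: "r_seq \<epsilon> u_ini \<xi>_ini n = conv (g_ker \<epsilon>) (rs n)"
  by (rule ext) (simp add: r_seq_def rho_def[abs_def] conv_diff[OF lin_growth_sgn lin_growth_sgn eps])

lemma L1_bounded_rs: "L1_bounded (rs n)"
  by (rule L1_bounded_rho[OF xs_decreasing])

lemma L1_bounded_fs: "L1_bounded (fs n)"
proof -
  have "L1_bounded (\<lambda>x. \<Sum>i\<in>I. g_pow_conv \<epsilon> (n - i) (r_seq \<epsilon> u_ini \<xi>_ini (i - 1)) x)" if "finite I" for I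
    using that
  proof induction
    case empty
    then show ?case by (auto simp: L1_bounded_def)
  next
    case (insert i I)
    have "L1_bounded (g_pow_conv \<epsilon> (n - i) (r_seq \<epsilon> u_ini \<xi>_ini (i - 1)))"
      unfolding r_seq_eq by (intro g_pow_conv_Suc(2) eps L1_bounded_conv integrable_g_ker L1_bounded_rs)
    from L1_bounded_add[OF this insert.IH] insert.hyps show ?case by simp
  qed
  from this[of "{1..n}"] show ?thesis by (simp add: f_seq_def[abs_def])
qed

lemma L1_bounded_ws: "L1_bounded (ws n)"
  by (intro L1_bounded_add L1_bounded_fs L1_bounded_rs)

lemma fs_0: "fs 0 x = 0"
  by (simp add: f_seq_def)

text \<open>The last summand has the zeroth power and contributes the new source; each earlier one
  acquires one more factor g because n + 1 - i = (n - i) + 1 for i <= n.\<close>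

lemma fs_Suc: "fs (Suc n) = conv (g_ker \<epsilon>) (ws n)"
proof
  fix x
  have lr: "L1_bounded (r_seq \<epsilon> u_ini \<xi>_ini i)" for i
    unfolding r_seq_eq by (intro L1_bounded_conv integrable_g_ker eps L1_bounded_rs)
  have "fs (Suc n) x = (\<Sum>i=1..n. g_pow_conv \<epsilon> (Suc n - i) (r_seq \<epsilon> u_ini \<xi>_ini (i - 1)) x) + g_pow_conv \<epsilon> 0 (r_seq \<epsilon> u_ini \<xi>_ini n) x"
    by (simp add: f_seq_def)
  also have "(\<Sum>i=1..n. g_pow_conv \<epsilon> (Suc n - i) (r_seq \<epsilon> u_ini \<xi>_ini (i - 1)) x)
      = (\<Sum>i=1..n. conv (g_ker \<epsilon>) (g_pow_conv \<epsilon> (n - i) (r_seq \<epsilon> u_ini \<xi>_ini (i - 1))) x)"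
    by (intro sum.cong refl) (auto simp: Suc_diff_le g_pow_conv_Suc(1)[OF eps lr])
  also have "\<dots> = conv (g_ker \<epsilon>) (fs n) x"
    unfolding f_seq_def[abs_def]
    by (rule conv_sum[symmetric]) (intro L1_bounded_lin_growth g_pow_conv_Suc(2) eps lr, rule eps)
  also have "g_pow_conv \<epsilon> 0 (r_seq \<epsilon> u_ini \<xi>_ini n) x = conv (g_ker \<epsilon>) (rs n) x"
    by (simp add: g_pow_conv_def r_seq_eq)
  also have "conv (g_ker \<epsilon>) (fs n) x + conv (g_ker \<epsilon>) (rs n) x = conv (g_ker \<epsilon>) (ws n) x"
    by (rule conv_add[symmetric]) (intro L1_bounded_lin_growth L1_bounded_fs L1_bounded_rs eps)+
  finally show "fs (Suc n) x = conv (g_ker \<epsilon>) (ws n) x" .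
qed

lemma continuous_fs: "continuous_on UNIV (fs n)"
  by (cases n) (auto simp: fs_0[abs_def] fs_Suc intro!: continuous_conv_g L1_bounded_lin_growth L1_bounded_ws eps)

text \<open>The weak spatial derivative of \<open>fs n\<close>, obtained by applying g' to the input
  of the step that produces it; \<open>fs 0\<close> vanishes, hence the constant 0.\<close>

definition dfs :: "nat \<Rightarrow> real \<Rightarrow> real" where
  "dfs n = (case n of 0 \<Rightarrow> (\<lambda>_. 0) | Suc m \<Rightarrow> conv (dg_ker \<epsilon>) (ws m))"

lemma dfs_measurable: "dfs n \<in> borel_measurable borel"
proof -
  have "ws m \<in> borel_measurable borel" for m by (rule lin_growthD[OF L1_bounded_lin_growth[OF L1_bounded_ws]])
  then show ?thesis by (cases n) (auto simp: dfs_def)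
qed

lemma dfs_weak_deriv:
  fixes \<psi> \<psi>' :: "real \<Rightarrow> real"
  assumes d: "\<And>x. (\<psi> has_real_derivative \<psi>' x) (at x)" and c: "cont_supp R \<psi>" "cont_supp R \<psi>'"
  shows "(LINT x|lborel. fs n x * \<psi>' x) = - (LINT x|lborel. dfs n x * \<psi> x)"
proof (cases n)
  case (Suc m)
  then show ?thesis using conv_g_weak_deriv[OF eps L1_bounded_ws d c, of m] by (simp add: fs_Suc dfs_def)
qed (simp add: fs_0 dfs_def)

text \<open>Expanding (f + \<rho>)^2 = f^2 + (2 f + \<rho>) \<rho> and using \<rho> <= 2 gives the
  increment (2M + 2) \<rho>, whose integral is 4 (M + 1) times the displacement. M has to bound f
  only on the interval swept in the same step, where \<rho> lives. Summation telescopes, starting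
  from f = 0, and the factor 2 of the energy inequality halves the constant.\<close>

lemma dfs_energy:
  assumes M: "\<And>n x. n < N \<Longrightarrow> xs (Suc n) \<le> x \<Longrightarrow> x \<le> xs n \<Longrightarrow> fs n x \<le> M"
  shows "(\<Sum>n<N. \<epsilon>\<^sup>2 * (LINT x|lborel. (dfs (Suc n) x)\<^sup>2)) \<le> 2 * (M + 1) * (xs 0 - xs N)"
proof -
  have step: "2 * \<epsilon>\<^sup>2 * (LINT x|lborel. (dfs (Suc n) x)\<^sup>2) + (LINT x|lborel. (fs (Suc n) x)\<^sup>2)
      \<le> (LINT x|lborel. (fs n x)\<^sup>2) + 4 * (M + 1) * (xs n - xs (Suc n))" if "n < N" for n
  proof -
    note hb = has_bochner_integral_rho[OF xs_decreasing[of n]]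
    have "2 * \<epsilon>\<^sup>2 * (LINT x|lborel. (dfs (Suc n) x)\<^sup>2) + (LINT x|lborel. (fs (Suc n) x)\<^sup>2) \<le> (LINT x|lborel. (ws n x)\<^sup>2)"
      using conv_g_energy(1)[OF eps L1_bounded_ws[of n]] by (simp add: fs_Suc dfs_def)
    also have "\<dots> \<le> (LINT x|lborel. (fs n x)\<^sup>2 + (2 * M + 2) * rs n x)"
    proof (rule integral_mono)
      show "integrable lborel (\<lambda>x. (ws n x)\<^sup>2)"
        using L1_bounded_mult[OF L1_bounded_ws[of n] L1_bounded_ws[of n]] by (simp add: power2_eq_square)
      show "integrable lborel (\<lambda>x. (fs n x)\<^sup>2 + (2 * M + 2) * rs n x)"
        using L1_bounded_mult[OF L1_bounded_fs[of n] L1_bounded_fs[of n]] hb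
        by (auto simp: power2_eq_square has_bochner_integral_iff)
      fix x
      show "(ws n x)\<^sup>2 \<le> (fs n x)\<^sup>2 + (2 * M + 2) * rs n x"
      proof (cases "x \<in> {xs (Suc n)..xs n}")
        case True
        have r: "0 \<le> rs n x" "rs n x \<le> 2" using rho_bounds[OF xs_decreasing[of n], of x] by auto
        have f: "fs n x \<le> M" using M[OF that] True by auto
        have "(ws n x)\<^sup>2 = (fs n x)\<^sup>2 + (2 * fs n x + rs n x) * rs n x" by (simp add: power2_eq_square algebra_simps)
        also have "\<dots> \<le> (fs n x)\<^sup>2 + (2 * M + 2) * rs n x" using r f by (intro add_left_mono mult_right_mono) auto
        finally show ?thesis .
      next
        case False
        show ?thesis by (simp add: rho_support[OF xs_decreasing False])
      qed
    qed
    also have "\<dots> = (LINT x|lborel. (fs n x)\<^sup>2) + 4 * (M + 1) * (xs n - xs (Suc n))"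
    proof -
      have "(LINT x|lborel. rs n x) = 2 * (xs n - xs (Suc n))" using hb by (simp add: has_bochner_integral_iff)
      then show ?thesis
        using L1_bounded_mult[OF L1_bounded_fs[of n] L1_bounded_fs[of n]] hb
        by (simp add: power2_eq_square has_bochner_integral_iff) (simp add: algebra_simps)
    qed
    finally show ?thesis .
  qed
  have "2 * (\<Sum>n<k. \<epsilon>\<^sup>2 * (LINT x|lborel. (dfs (Suc n) x)\<^sup>2)) + (LINT x|lborel. (fs k x)\<^sup>2) \<le> 4 * (M + 1) * (xs 0 - xs k)" if "k \<le> N" for k
    using that
  proof (induction k)
    case (Suc k)
    then show ?case using step[of k] by (simp add: algebra_simps)
  qed (simp add: fs_0)
  from this[of N] have "2 * (\<Sum>n<N. \<epsilon>\<^sup>2 * (LINT x|lborel. (dfs (Suc n) x)\<^sup>2)) + (LINT x|lborel. (fs N x)\<^sup>2) \<le> 4 * (M + 1) * (xs 0 - xs N)" by simp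
  moreover have "0 \<le> (LINT x|lborel. (fs N x)\<^sup>2)" by simp
  moreover have "4 * (M + 1) * (xs 0 - xs N) = 2 * (2 * (M + 1) * (xs 0 - xs N))" by simp
  ultimately show ?thesis by linarith
qed

lemma integrable_dfs_square: "integrable lborel (\<lambda>x. (dfs n x)\<^sup>2)"
  by (cases n) (auto simp: dfs_def intro!: conv_g_energy(2) eps L1_bounded_ws)

end

subsection \<open>Test functions and integrals on the plane\<close>

lemma Linf_tendsto_bound:
  assumes "Linf_tendsto S F f" "c > 0"
  shows "\<forall>\<^sub>F k in sequentially. AE z in lebesgue_on S. \<bar>F k z - f z\<bar> \<le> c"
proof -
  have "\<forall>\<^sub>F k in sequentially. Linf_norm S (\<lambda>z. F k z - f z) < ennreal c"
    using assms by (intro order_tendstoD(2)[of _ 0]) (auto simp: Linf_tendsto_def)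
  then show ?thesis
  proof eventually_elim
    case (elim k)
    show ?case
      using esssup_AE[of "\<lambda>z. ennreal \<bar>F k z - f z\<bar>" "lebesgue_on S"]
    proof eventually_elim
      fix z assume "ennreal \<bar>F k z - f z\<bar> \<le> esssup (lebesgue_on S) (\<lambda>z. ennreal \<bar>F k z - f z\<bar>)"
      also have "\<dots> < ennreal c" using elim by (simp add: Linf_norm_def)
      finally show "\<bar>F k z - f z\<bar> \<le> c" by (simp add: ennreal_less_iff)
    qed
  qed
qed

text \<open>Only the countably many thresholds 1 / (m + 1) are tested, so the union of the
  exceptional sets is null and the whole sequence converges.\<close>

lemma Linf_tendsto_AE:
  assumes "Linf_tendsto S F f"
  shows "AE z in lebesgue_on S. (\<lambda>k. F k z) \<longlonglongrightarrow> f z"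
proof -
  have "\<exists>N. \<forall>k\<ge>N. AE z in lebesgue_on S. \<bar>F k z - f z\<bar> \<le> inverse (real (Suc m))" for m
    using Linf_tendsto_bound[OF assms, of "inverse (real (Suc m))"] by (simp add: eventually_sequentially)
  then obtain N where "\<forall>m. \<forall>k\<ge>N m. AE z in lebesgue_on S. \<bar>F k z - f z\<bar> \<le> inverse (real (Suc m))"
    by metis
  then have "AE z in lebesgue_on S. \<forall>m. \<forall>k. k \<ge> N m \<longrightarrow> \<bar>F k z - f z\<bar> \<le> inverse (real (Suc m))"
    by (auto simp: AE_all_countable)
  then show ?thesis
  proof eventually_elim
    case (elim z)
    show ?case
    proof (rule LIMSEQ_I)
      fix r :: real assume "0 < r"
      then obtain m where "inverse (real (Suc m)) < r" using reals_Archimedean by blast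
      then have "\<forall>k\<ge>N m. norm (F k z - f z) < r" using elim by fastforce
      then show "\<exists>no. \<forall>k\<ge>no. norm (F k z - f z) < r" by blast
    qed
  qed
qed

text \<open>Norms and weak derivatives are stated with Lebesgue measure on a set, whereas Fubini and
  the measurability of compositions are handled in \<open>lborel\<close>. This lemma and the next
  two translate between them.\<close>

lemma AE_lebesgue_on_iff:
  fixes S :: "'a::euclidean_space set"
  assumes "S \<in> sets borel"
  shows "(AE z in lebesgue_on S. P z) \<longleftrightarrow> (AE z in lborel. z \<in> S \<longrightarrow> P z)"
proof -
  have "(AE z in lebesgue_on S. P z) \<longleftrightarrow> (AE z in lebesgue. z \<in> S \<longrightarrow> P z)"
    using assms by (intro AE_restrict_space_iff) simp
  then show ?thesis by (simp add: AE_completion_iff)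
qed

lemma integral_lebesgue_on_borel:
  fixes S :: "'a::euclidean_space set" and f :: "'a \<Rightarrow> real"
  assumes "S \<in> sets borel" "(\<lambda>z. indicator S z * f z) \<in> borel_measurable borel"
  shows "(LINT z|lebesgue_on S. f z) = (LINT z|lborel. indicator S z * f z)"
  using assms by (simp add: integral_restrict_space integral_completion)

lemma integrable_lebesgue_on_borel:
  fixes S :: "'a::euclidean_space set" and f :: "'a \<Rightarrow> real"
  assumes "S \<in> sets borel" "(\<lambda>z. indicator S z * f z) \<in> borel_measurable borel"
  shows "integrable (lebesgue_on S) f \<longleftrightarrow> integrable lborel (\<lambda>z. indicator S z * f z)"
  using assms by (simp add: integrable_restrict_space integrable_completion)

section \<open>Test functions on the strip\<close>

lemma plane_Basis: "(1, 0) \<in> (Basis :: (real \<times> real) set)" "(0, 1) \<in> (Basis :: (real \<times> real) set)"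
  by (auto simp: Basis_prod_def)

lemma partial_deriv_zero_outside:
  assumes "closed S" "\<And>z. z \<notin> S \<Longrightarrow> \<phi> z = 0" "z \<notin> S"
  shows "partial_deriv b \<phi> z = 0"
proof -
  let ?U = "(\<lambda>s. z + s *\<^sub>R b) -` (- S)"
  have "open ?U" using assms(1) by (intro open_vimage continuous_intros) (auto simp: open_closed)
  then have "((\<lambda>s. \<phi> (z + s *\<^sub>R b)) has_field_derivative 0) (at 0)"
    by (rule has_field_derivative_transform_within_open[where f = "\<lambda>_. 0", rotated])
       (use assms in auto)
  then show ?thesis unfolding partial_deriv_def by (rule DERIV_imp_deriv)
qed

lemma test_function_zero: "test_function \<Omega> \<phi> \<Longrightarrow> z \<notin> closure {z. \<phi> z \<noteq> 0} \<Longrightarrow> \<phi> z = 0"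
  using subsetD[OF closure_subset[of "{z. \<phi> z \<noteq> 0}"], of z] by auto

lemma test_function_partial_deriv:
  assumes "test_function \<Omega> \<phi>" "b \<in> Basis" shows "test_function \<Omega> (partial_deriv b \<phi>)"
proof -
  let ?S = "closure {z. \<phi> z \<noteq> 0}"
  have "partial_deriv b \<phi> z = 0" if "z \<notin> ?S" for z
    by (rule partial_deriv_zero_outside[OF closed_closure test_function_zero[OF assms(1)] that])
  then have "{z. partial_deriv b \<phi> z \<noteq> 0} \<subseteq> ?S" by blast
  then have sub: "closure {z. partial_deriv b \<phi> z \<noteq> 0} \<subseteq> ?S" by (intro closure_minimal) auto
  then have "closure {z. partial_deriv b \<phi> z \<noteq> 0} = ?S \<inter> closure {z. partial_deriv b \<phi> z \<noteq> 0}" by blast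
  also have "compact \<dots>" using assms(1) by (intro compact_Int_closed) (auto simp: test_function_def)
  finally have "compact (closure {z. partial_deriv b \<phi> z \<noteq> 0})" .
  moreover have "Ck k (partial_deriv b \<phi>)" for k
  proof -
    have "Ck (Suc k) \<phi>" using assms(1) unfolding test_function_def by blast
    then show ?thesis using assms(2) by simp
  qed
  ultimately show ?thesis using assms(1) sub unfolding test_function_def by blast
qed

lemma test_function_continuous: "test_function \<Omega> \<phi> \<Longrightarrow> continuous_on UNIV \<phi>"
  unfolding test_function_def using Ck.simps(1) by blast

lemma test_function_measurable: "test_function \<Omega> \<phi> \<Longrightarrow> \<phi> \<in> borel_measurable borel"
  by (intro borel_measurable_continuous_onI test_function_continuous)

lemma test_function_partial_DERIV:
  assumes "test_function \<Omega> \<phi>" "b \<in> Basis"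
  shows "((\<lambda>s. \<phi> (z + s *\<^sub>R b)) has_real_derivative partial_deriv b \<phi> (z + r *\<^sub>R b)) (at r)"
proof -
  have "Ck (Suc 0) \<phi>" using assms(1) unfolding test_function_def by blast
  then have "(\<lambda>s. \<phi> (z + r *\<^sub>R b + s *\<^sub>R b)) field_differentiable at 0" using assms(2) by simp
  then have "((\<lambda>s. \<phi> (z + r *\<^sub>R b + s *\<^sub>R b)) has_real_derivative partial_deriv b \<phi> (z + r *\<^sub>R b)) (at 0)"
    unfolding partial_deriv_def by (simp add: DERIV_deriv_iff_field_differentiable)
  moreover have "(\<lambda>s. \<phi> (z + r *\<^sub>R b + s *\<^sub>R b)) = (\<lambda>s. \<phi> (z + (s + r) *\<^sub>R b))"
    by (simp add: algebra_simps)
  ultimately show ?thesis using DERIV_shift[of "\<lambda>s. \<phi> (z + s *\<^sub>R b)" _ 0 r] by simp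
qed

lemma test_function_DERIV_x:
  fixes \<phi> :: "real \<times> real \<Rightarrow> real"
  assumes "test_function \<Omega> \<phi>"
  shows "((\<lambda>x. \<phi> (t, x)) has_real_derivative partial_deriv (0, 1) \<phi> (t, x)) (at x)"
  using test_function_partial_DERIV[OF assms plane_Basis(2), of "(t, 0)" x] by simp

lemma test_function_bounded:
  assumes "test_function \<Omega> \<phi>"
  obtains B where "B \<ge> 0" "\<And>z. \<bar>\<phi> z\<bar> \<le> B"
proof -
  let ?S = "closure {z. \<phi> z \<noteq> 0}"
  have "compact (\<phi> ` ?S)"
    using assms test_function_continuous[OF assms]
    by (intro compact_continuous_image) (auto simp: test_function_def intro: continuous_on_subset)
  from compact_imp_bounded[OF this] obtain B where B: "\<forall>z\<in>?S. \<bar>\<phi> z\<bar> \<le> B"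
    unfolding bounded_iff by auto
  have "\<bar>\<phi> z\<bar> \<le> max B 0" for z
    using B test_function_zero[OF assms, of z] by (cases "z \<in> ?S") force+
  then show thesis using that[of "max B 0"] by simp
qed

text \<open>Compactness keeps the support at a distance \<delta> from both time boundaries. That
  distance is the room for shifting the test function in time by \<epsilon>^2.\<close>

lemma strip_test_function_support:
  fixes \<phi> :: "real \<times> real \<Rightarrow> real"
  assumes "test_function ({0<..<T} \<times> UNIV) \<phi>"
  obtains \<delta> R where "\<delta> > 0" "R \<ge> 0" "\<And>z. z \<notin> {\<delta>..T - \<delta>} \<times> {-R..R} \<Longrightarrow> \<phi> z = 0"
proof -
  let ?S = "closure {z. \<phi> z \<noteq> 0}"
  have c: "compact ?S" and sub: "?S \<subseteq> {0<..<T} \<times> UNIV" using assms by (auto simp: test_function_def)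
  show thesis
  proof (cases "?S = {}")
    case True
    then have "\<phi> z = 0" for z using test_function_zero[OF assms, of z] by (metis empty_iff)
    with that[of 1 0] show thesis by simp
  next
    case False
    obtain a where a: "a \<in> ?S" "\<And>z. z \<in> ?S \<Longrightarrow> fst a \<le> fst z"
      using continuous_attains_inf[OF c False continuous_on_fst[OF continuous_on_id]] by blast
    obtain b where b: "b \<in> ?S" "\<And>z. z \<in> ?S \<Longrightarrow> fst z \<le> fst b"
      using continuous_attains_sup[OF c False continuous_on_fst[OF continuous_on_id]] by blast
    obtain d :: "real \<times> real" where d: "\<And>z. z \<in> ?S \<Longrightarrow> \<bar>snd z\<bar> \<le> \<bar>snd d\<bar>"
      using continuous_attains_sup[OF c False continuous_on_rabs[OF continuous_on_snd[OF continuous_on_id]]] by blast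
    define \<delta> where "\<delta> = min (fst a) (T - fst b)"
    have "\<delta> > 0" using a(1) b(1) sub by (auto simp: \<delta>_def)
    moreover have "\<phi> z = 0" if "z \<notin> {\<delta>..T - \<delta>} \<times> {-\<bar>snd d\<bar>..\<bar>snd d\<bar>}" for z
    proof (rule test_function_zero[OF assms], rule notI)
      assume z: "z \<in> ?S"
      have "fst a \<le> fst z" "fst z \<le> fst b" "\<bar>snd z\<bar> \<le> \<bar>snd d\<bar>" using a(2) b(2) d z by auto
      then have "z \<in> {\<delta>..T - \<delta>} \<times> {-\<bar>snd d\<bar>..\<bar>snd d\<bar>}" by (cases z) (auto simp: \<delta>_def)
      with that show False by blast
    qed
    ultimately show thesis using that[of \<delta> "\<bar>snd d\<bar>"] by auto
  qed
qed

lemma test_function_cont_supp: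
  fixes \<phi> :: "real \<times> real \<Rightarrow> real"
  assumes "test_function \<Omega> \<phi>" "\<And>z. z \<notin> A \<times> {-R..R} \<Longrightarrow> \<phi> z = 0"
  shows "cont_supp R (\<lambda>x. \<phi> (t, x))"
proof -
  have "continuous_on UNIV (\<lambda>x. \<phi> (t, x))"
    using test_function_continuous[OF assms(1)]
    by (intro continuous_on_compose2[of UNIV \<phi> UNIV "\<lambda>x. (t, x)"] continuous_intros) auto
  moreover have "\<phi> (t, x) = 0" if "R < \<bar>x\<bar>" for x by (rule assms(2)) (use that in auto)
  ultimately show ?thesis by (simp add: cont_supp_def)
qed

section \<open>Integration, convergence and null sets on the plane\<close>

lemma lborel_integral_translate:
  fixes f :: "'a::euclidean_space \<Rightarrow> real"
  assumes "f \<in> borel_measurable borel"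
  shows "(LINT z|lborel. f (c + z)) = (LINT z|lborel. f z)"
  using integral_distr[of "(+) c" lborel borel f] assms by (simp add: lborel_distr_plus)

lemma lborel_integrable_translate:
  fixes f :: "'a::euclidean_space \<Rightarrow> real"
  assumes "integrable lborel f"
  shows "integrable lborel (\<lambda>z. f (c + z))"
  using integrable_distr[of "(+) c" lborel borel f] assms by (simp add: lborel_distr_plus)

lemma integrable_local_mult:
  fixes h \<psi> :: "'a::euclidean_space \<Rightarrow> real"
  assumes "h \<in> borel_measurable borel" "\<psi> \<in> borel_measurable borel" "compact S"
    "\<And>z. z \<in> S \<Longrightarrow> \<bar>h z\<bar> \<le> C" "\<And>z. \<bar>\<psi> z\<bar> \<le> D" "\<And>z. z \<notin> S \<Longrightarrow> \<psi> z = 0"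
  shows "integrable lborel (\<lambda>z. h z * \<psi> z)"
proof (rule Bochner_Integration.integrable_bound)
  show "integrable lborel (\<lambda>z. \<bar>C\<bar> * \<bar>D\<bar> * indicator S z)"
    using assms(3) by (intro integrable_mult_right integrable_real_indicator emeasure_compact_finite)
      (auto simp: compact_imp_closed borel_closed)
  have "norm (h z * \<psi> z) \<le> norm (\<bar>C\<bar> * \<bar>D\<bar> * indicator S z)" for z
  proof (cases "z \<in> S")
    case True
    then show ?thesis
      using mult_mono[OF order_trans[OF assms(4) abs_ge_self] order_trans[OF assms(5) abs_ge_self], of z z] by (simp add: abs_mult)
  qed (use assms(6) in simp)
  then show "AE z in lborel. norm (h z * \<psi> z) \<le> norm (\<bar>C\<bar> * \<bar>D\<bar> * indicator S z)" by simp
qed (use assms in measurable)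

text \<open>Dominated convergence when H is controlled only on S, only almost everywhere and only
  for late k; the common support of the \<Phi> supplies the rest. The second factor may depend on k,
  so that difference quotients of a test function can be inserted.\<close>

lemma tendsto_integral_local:
  fixes h :: "'a::euclidean_space \<Rightarrow> real"
  assumes meas: "\<And>k. H k \<in> borel_measurable borel" "h \<in> borel_measurable borel"
    "\<And>k. \<Phi> k \<in> borel_measurable borel" "\<phi> \<in> borel_measurable borel"
    and S: "compact S"
    and lim: "AE z in lborel. z \<in> S \<longrightarrow> (\<lambda>k. H k z) \<longlonglongrightarrow> h z" "\<And>z. (\<lambda>k. \<Phi> k z) \<longlonglongrightarrow> \<phi> z"
    and bound: "\<forall>\<^sub>F k in sequentially. AE z in lborel. z \<in> S \<longrightarrow> \<bar>H k z\<bar> \<le> C"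
    and supp: "\<forall>\<^sub>F k in sequentially. \<forall>z. \<bar>\<Phi> k z\<bar> \<le> D \<and> (z \<notin> S \<longrightarrow> \<Phi> k z = 0)"
  shows "(\<lambda>k. LINT z|lborel. H k z * \<Phi> k z) \<longlonglongrightarrow> (LINT z|lborel. h z * \<phi> z)"
proof -
  from eventually_conj[OF bound supp] obtain N where N: "\<And>k. k \<ge> N \<Longrightarrow> AE z in lborel. z \<in> S \<longrightarrow> \<bar>H k z\<bar> \<le> C"
    "\<And>k z. k \<ge> N \<Longrightarrow> \<bar>\<Phi> k z\<bar> \<le> D" "\<And>k z. k \<ge> N \<Longrightarrow> z \<notin> S \<Longrightarrow> \<Phi> k z = 0"
    unfolding eventually_sequentially by blast
  have "(\<lambda>k. LINT z|lborel. H (k + N) z * \<Phi> (k + N) z) \<longlonglongrightarrow> (LINT z|lborel. h z * \<phi> z)"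
  proof (rule integral_dominated_convergence)
    show "integrable lborel (\<lambda>z. \<bar>C\<bar> * \<bar>D\<bar> * indicator S z)"
      using S by (intro integrable_mult_right integrable_real_indicator emeasure_compact_finite)
        (auto simp: compact_imp_closed borel_closed)
    show "AE z in lborel. (\<lambda>k. H (k + N) z * \<Phi> (k + N) z) \<longlonglongrightarrow> h z * \<phi> z"
      using lim(1)
    proof eventually_elim
      case (elim z)
      show ?case
      proof (cases "z \<in> S")
        case True
        then have "(\<lambda>k. H k z * \<Phi> k z) \<longlonglongrightarrow> h z * \<phi> z" using elim lim(2) by (intro tendsto_mult) auto
        then show ?thesis by (rule LIMSEQ_ignore_initial_segment)
      next
        case False
        \<comment> \<open>Off S nothing is known about H, but \<Phi> vanishes there for late k,
          hence so does its limit.\<close>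
        have "(\<lambda>k. \<Phi> (k + N) z) \<longlonglongrightarrow> \<phi> z" by (rule LIMSEQ_ignore_initial_segment[OF lim(2)])
        then have "(\<lambda>k. 0) \<longlonglongrightarrow> \<phi> z" using N(3)[OF _ False] by simp
        then have "\<phi> z = 0" using LIMSEQ_unique tendsto_const by blast
        then show ?thesis using N(3)[OF _ False] by simp
      qed
    qed
    fix k
    show "AE z in lborel. norm (H (k + N) z * \<Phi> (k + N) z) \<le> \<bar>C\<bar> * \<bar>D\<bar> * indicator S z"
      using N(1)[of "k + N", OF le_add2]
    proof eventually_elim
      case (elim z)
      show ?case
      proof (cases "z \<in> S")
        case True
        have "\<bar>H (k + N) z\<bar> * \<bar>\<Phi> (k + N) z\<bar> \<le> \<bar>C\<bar> * \<bar>D\<bar>"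
          using elim True N(2)[OF le_add2, of k z] by (intro mult_mono) auto
        then show ?thesis using True by (simp add: abs_mult)
      next
        case False
        then show ?thesis using N(3)[OF le_add2 False] by simp
      qed
    qed
  qed (use meas in measurable)
  then show ?thesis by (rule LIMSEQ_offset)
qed

lemma AE_lborel_fst:
  fixes P :: "real \<Rightarrow> bool"
  assumes "AE t in lborel. P t"
  shows "AE z in lborel. P (fst (z :: real \<times> real))"
proof -
  obtain N where N: "N \<in> null_sets lborel" "{t. \<not> P t} \<subseteq> N"
    using assms by (auto simp: eventually_ae_filter)
  have "AE z in lborel \<Otimes>\<^sub>M lborel. fst z \<notin> N"
  proof (rule lborel_pair.AE_pair_measure)
    have [measurable]: "N \<in> sets borel" using N(1) by (auto simp: null_sets_def)
    show "{z \<in> space (lborel \<Otimes>\<^sub>M lborel). fst z \<notin> N} \<in> sets (lborel \<Otimes>\<^sub>M lborel)" by measurable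
    show "AE x in lborel. AE y in lborel. fst (x, y) \<notin> N"
      using AE_not_in[OF N(1)] by auto
  qed
  then have "AE z in lborel. fst (z :: real \<times> real) \<notin> N" unfolding lborel_prod .
  then show ?thesis
  proof eventually_elim
    case (elim z) then show ?case using N(2) by blast
  qed
qed

text \<open>By Fubini a graph is a null set. This disposes of the interface, the only place where
  the sign is discontinuous.\<close>

lemma AE_lborel_graph:
  fixes a :: "real \<Rightarrow> real"
  assumes [measurable]: "a \<in> borel_measurable borel"
  shows "AE z in lborel. snd z \<noteq> a (fst z)"
proof -
  have "AE z in lborel \<Otimes>\<^sub>M lborel. snd z \<noteq> a (fst z)"
  proof (rule lborel_pair.AE_pair_measure)
    show "{z \<in> space (lborel \<Otimes>\<^sub>M lborel). snd z \<noteq> a (fst z)} \<in> sets (lborel \<Otimes>\<^sub>M lborel)" by measurable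
    show "AE x in lborel. AE y in lborel. snd (x, y) \<noteq> a (fst (x, y))"
    proof (rule AE_I2)
      fix x show "AE y in lborel. snd (x, y) \<noteq> a (fst (x, y))"
        using AE_lborel_singleton[of "a x"] by simp
    qed
  qed
  then show ?thesis unfolding lborel_prod .
qed

text \<open>Nonempty open sets are not negligible. This is the device by which almost everywhere
  information is evaluated at points.\<close>

lemma AE_open_dense:
  fixes P :: "'a::euclidean_space \<Rightarrow> bool"
  assumes "AE z in lborel. z \<in> U \<longrightarrow> P z" "open U" "U \<noteq> {}"
  shows "\<exists>z\<in>U. P z"
proof (rule ccontr)
  assume "\<not> (\<exists>z\<in>U. P z)"
  then have "AE z in lborel. z \<notin> U" using assms(1) by auto
  then have "emeasure lborel U = 0"
    using AE_iff_null_sets[of U lborel] borel_open[OF assms(2)] by auto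
  then have "negligible U" using assms(2) by (simp add: negligible_iff_emeasure0 emeasure_completion borel_open)
  then show False using open_not_negligible[OF assms(2,3)] by blast
qed

text \<open>At t = 0 or t = T a neighbourhood is cut by the strip. The open time interval is dense
  in the closed one, so the neighbourhood still contains an open set inside the strip.\<close>

lemma strip_AE_dense:
  fixes P :: "real \<times> real \<Rightarrow> bool"
  assumes "AE z in lborel. z \<in> {0..T} \<times> UNIV \<longrightarrow> P z" "T > 0" "t \<in> {0..T}" "open U" "(t, x) \<in> U"
  shows "\<exists>z\<in>U \<inter> ({0..T} \<times> UNIV). P z"
proof -
  obtain A B where AB: "open A" "open B" "t \<in> A" "x \<in> B" "A \<times> B \<subseteq> U"
    using assms(4,5) by (rule open_prod_elim) auto
  have "t \<in> closure {0<..<T}" using assms(2,3) by (simp add: closure_greaterThanLessThan)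
  then have "A \<inter> {0<..<T} \<noteq> {}" using AB(1,3) by (auto simp: closure_iff_nhds_not_empty)
  then have ne: "(A \<inter> {0<..<T}) \<times> B \<noteq> {}" using AB(4) by auto
  have op: "open ((A \<inter> {0<..<T}) \<times> B)" using AB by (intro open_Times open_Int) auto
  have "AE z in lborel. z \<in> (A \<inter> {0<..<T}) \<times> B \<longrightarrow> P z"
    using assms(1) by eventually_elim auto
  from AE_open_dense[OF this op ne] have "\<exists>z\<in>(A \<inter> {0<..<T}) \<times> B. P z" .
  then show ?thesis using AB(5) by auto
qed

section \<open>Piecewise constant interpolation in time\<close>

lemma time_index_measurable [measurable]: "time_index \<epsilon> \<in> borel \<rightarrow>\<^sub>M count_space UNIV"
  unfolding time_index_def by measurable

lemma time_indexed_measurable: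
  assumes [measurable]: "\<And>n. g n \<in> borel_measurable borel"
  shows "(\<lambda>z. g (time_index \<epsilon> (fst z)) (snd z)) \<in> borel_measurable (borel :: (real \<times> real) measure)"
proof -
  have "(\<lambda>z. g (time_index \<epsilon> (fst z)) (snd z)) \<in> borel_measurable (borel \<Otimes>\<^sub>M borel)"
    by (rule measurable_compose_countable[where f = "\<lambda>n z. g n (snd z)" and g = "\<lambda>z. time_index \<epsilon> (fst z)"]) measurable
  then show ?thesis by (simp add: borel_prod)
qed

text \<open>Shifting time by \<epsilon>^2 is the passage to the next iterate. For negative t the
  truncation to natural numbers destroys this, hence the sign condition.\<close>

lemma time_index_step:
  assumes "\<epsilon> > 0" "t \<ge> 0" shows "time_index \<epsilon> (t + \<epsilon>\<^sup>2) = Suc (time_index \<epsilon> t)"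
proof -
  have "(t + \<epsilon>\<^sup>2) / \<epsilon>\<^sup>2 = t / \<epsilon>\<^sup>2 + 1" using assms by (simp add: field_simps)
  then have "\<lfloor>(t + \<epsilon>\<^sup>2) / \<epsilon>\<^sup>2\<rfloor> = \<lfloor>t / \<epsilon>\<^sup>2\<rfloor> + 1" by simp
  then show ?thesis using assms by (simp add: time_index_def nat_add_distrib)
qed

context scheme_run
begin

abbreviation "pe \<equiv> p_eps \<epsilon> u_ini \<xi>_ini"
abbreviation "fe \<equiv> f_eps \<epsilon> u_ini \<xi>_ini"
abbreviation "xe \<equiv> xi_eps \<epsilon> u_ini \<xi>_ini"
abbreviation "se \<equiv> (\<lambda>z. sgn (snd z - xe (fst z)))"

lemma pe_eq: "pe = (\<lambda>z. ps (time_index \<epsilon> (fst z)) (snd z))"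
  and fe_eq: "fe = (\<lambda>z. fs (time_index \<epsilon> (fst z)) (snd z))"
  by (auto simp: p_eps_def f_eps_def)

lemma pe_measurable [measurable]: "pe \<in> borel_measurable borel"
  unfolding pe_eq by (rule time_indexed_measurable) (rule lin_growthD[OF lin_growth_ps])

lemma fe_measurable [measurable]: "fe \<in> borel_measurable borel"
  unfolding fe_eq by (rule time_indexed_measurable) (rule borel_measurable_continuous_onI[OF continuous_fs])

lemma xe_measurable [measurable]: "xe \<in> borel_measurable borel"
  unfolding xi_eps_def[abs_def] by (rule measurable_compose[OF time_index_measurable]) simp

lemma se_measurable [measurable]: "se \<in> borel_measurable borel"
proof -
  have "se \<in> borel_measurable (borel \<Otimes>\<^sub>M borel)" by measurable
  then show ?thesis by (simp add: borel_prod)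
qed

lemma pe_locally_bounded:
  assumes "compact S" obtains C where "\<And>z. z \<in> S \<Longrightarrow> \<bar>pe z\<bar> \<le> C"
proof -
  from compact_imp_bounded[OF assms] obtain b where b: "\<And>z. z \<in> S \<Longrightarrow> norm z \<le> b" unfolding bounded_iff by blast
  have "\<exists>A\<ge>0. \<forall>x. \<bar>ps n x\<bar> \<le> A * (1 + \<bar>x\<bar>)" for n using lin_growth_bound[OF lin_growth_ps[of n]] by metis
  then obtain A where A: "\<And>n. A n \<ge> 0" "\<And>n x. \<bar>ps n x\<bar> \<le> A n * (1 + \<bar>x\<bar>)" by metis
  \<comment> \<open>Only finitely many iterates occur up to time b; the sum dominates each of their
    growth constants.\<close>
  have "\<bar>pe z\<bar> \<le> (\<Sum>n\<le>time_index \<epsilon> b. A n) * (1 + b)" if "z \<in> S" for z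
  proof -
    have n: "\<bar>fst z\<bar> \<le> b" "\<bar>snd z\<bar> \<le> b" using b[OF that] norm_fst_le[of "fst z" "snd z"] norm_snd_le[of "snd z" "fst z"] by auto
    then have "time_index \<epsilon> (fst z) \<le> time_index \<epsilon> b"
      unfolding time_index_def using eps by (intro nat_mono floor_mono divide_right_mono) auto
    then have "A (time_index \<epsilon> (fst z)) \<le> (\<Sum>n\<le>time_index \<epsilon> b. A n)"
      using A(1) by (intro member_le_sum) auto
    then have "A (time_index \<epsilon> (fst z)) * (1 + \<bar>snd z\<bar>) \<le> (\<Sum>n\<le>time_index \<epsilon> b. A n) * (1 + b)"
      using A(1) n by (intro mult_mono sum_nonneg) auto
    then show ?thesis using A(2) order_trans by (fastforce simp: pe_eq)
  qed
  then show thesis by (rule that)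
qed

text \<open>Integrating \<open>weak_step\<close> over the slices of constant t compares the iterates
  at times t and t + \<epsilon>^2. A translation of the plane moves the shift to the test function,
  so no time regularity of the iterates enters.\<close>

lemma weak_form_step:
  fixes \<phi> :: "real \<times> real \<Rightarrow> real"
  assumes tf: "test_function ({0<..<T} \<times> UNIV) \<phi>"
  defines "\<phi>xx \<equiv> partial_deriv (0, 1) (partial_deriv (0, 1) \<phi>)"
  shows "(LINT z|lborel. (pe z + se z) * (\<phi> (z - (\<epsilon>\<^sup>2, 0)) - \<phi> z)) = \<epsilon>\<^sup>2 * (LINT z|lborel. pe z * \<phi>xx (z - (\<epsilon>\<^sup>2, 0)))"
proof -
  let ?c = "(\<epsilon>\<^sup>2, 0::real)"
  let ?\<phi>x = "partial_deriv (0, 1) \<phi>"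
  note tfx = test_function_partial_deriv[OF tf plane_Basis(2)]
  have tfxx: "test_function ({0<..<T} \<times> UNIV) \<phi>xx"
    unfolding \<phi>xx_def by (rule test_function_partial_deriv[OF tfx plane_Basis(2)])
  obtain \<delta> R where \<delta>: "\<delta> > 0" "R \<ge> 0" and z0: "\<And>z. z \<notin> {\<delta>..T - \<delta>} \<times> {-R..R} \<Longrightarrow> \<phi> z = 0"
    using strip_test_function_support[OF tf] by metis
  let ?S = "{\<delta>..T - \<delta>} \<times> {-R..R}"
  have clS: "closed ?S" and coS: "compact ?S" by (auto intro!: closed_Times compact_Times)
  have zx: "?\<phi>x z = 0" if "z \<notin> ?S" for z by (rule partial_deriv_zero_outside[OF clS z0 that])
  have zxx: "\<phi>xx z = 0" if "z \<notin> ?S" for z unfolding \<phi>xx_def by (rule partial_deriv_zero_outside[OF clS zx that])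
  let ?u = "\<lambda>z. pe z + se z"
  have um [measurable]: "?u \<in> borel_measurable borel" by measurable
  have \<phi>m [measurable]: "\<phi> \<in> borel_measurable borel" "\<phi>xx \<in> borel_measurable borel"
    using tf tfxx by (auto intro: test_function_measurable)
  have um' [measurable]: "(\<lambda>z. h (?c + z)) \<in> borel_measurable borel" "(\<lambda>z. h (z - ?c)) \<in> borel_measurable borel" if [measurable]: "h \<in> borel_measurable borel" for h :: "real \<times> real \<Rightarrow> real"
    by measurable
  obtain C where C: "\<And>z. z \<in> ?S \<Longrightarrow> \<bar>pe z\<bar> \<le> C" using pe_locally_bounded[OF coS] by metis
  obtain C' where C': "\<And>z. z \<in> (+) ?c ` ?S \<Longrightarrow> \<bar>pe z\<bar> \<le> C'" using pe_locally_bounded[OF compact_translation[OF coS]] by metis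
  obtain D where D: "\<And>z. \<bar>\<phi> z\<bar> \<le> D" using test_function_bounded[OF tf] by metis
  obtain D' where D': "\<And>z. \<bar>\<phi>xx z\<bar> \<le> D'" using test_function_bounded[OF tfxx] by metis
  have se1: "\<bar>se z\<bar> \<le> 1" for z by (simp add: sgn_if)
  have ub: "\<bar>?u z\<bar> \<le> C + 1" if "z \<in> ?S" for z using C[OF that] se1[of z] by linarith
  have ub': "\<bar>?u (?c + z)\<bar> \<le> C' + 1" if "z \<in> ?S" for z using C'[OF imageI[OF that]] se1[of "?c + z"] by linarith
  have i1: "integrable lborel (\<lambda>z. ?u z * \<phi> z)"
    by (rule integrable_local_mult[OF um \<phi>m(1) coS ub D z0])
  have i2: "integrable lborel (\<lambda>z. ?u (?c + z) * \<phi> z)"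
    by (rule integrable_local_mult[OF um'(1)[OF um] \<phi>m(1) coS ub' D z0])
  have i3: "integrable lborel (\<lambda>z. pe (?c + z) * \<phi>xx z)"
    by (rule integrable_local_mult[OF um'(1)[OF pe_measurable] \<phi>m(2) coS C'[OF imageI] D' zxx])
  have slice: "(LINT x|lborel. (?u (?c + (t, x)) - ?u (t, x)) * \<phi> (t, x)) = (LINT x|lborel. \<epsilon>\<^sup>2 * (pe (?c + (t, x)) * \<phi>xx (t, x)))" for t
  proof (cases "t \<ge> 0")
    case True
    have cs: "cont_supp R (\<lambda>x. \<phi> (t, x))" "cont_supp R (\<lambda>x. ?\<phi>x (t, x))" "cont_supp R (\<lambda>x. \<phi>xx (t, x))"
      using test_function_cont_supp[OF tf z0] test_function_cont_supp[OF tfx zx] test_function_cont_supp[OF tfxx zxx] by auto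
    have ti: "time_index \<epsilon> (\<epsilon>\<^sup>2 + t) = Suc (time_index \<epsilon> t)" using time_index_step[OF eps True] by (simp add: add.commute)
    show ?thesis
      using weak_step[OF test_function_DERIV_x[OF tf] test_function_DERIV_x[OF tfx, folded \<phi>xx_def] cs, of "time_index \<epsilon> t"]
      by (simp add: pe_eq xi_eps_def ti)
  next
    case False
    then have "\<phi> (t, x) = 0" "\<phi>xx (t, x) = 0" for x using z0[of "(t, x)"] zxx[of "(t, x)"] \<delta> by auto
    then show ?thesis by simp
  qed
  have i12: "integrable lborel (\<lambda>z. (?u (?c + z) - ?u z) * \<phi> z)"
    using i1 i2 by (simp add: left_diff_distrib)
  have "(LINT z|lborel. (?u (?c + z) - ?u z) * \<phi> z) = (LINT t|lborel. LINT x|lborel. (?u (?c + (t, x)) - ?u (t, x)) * \<phi> (t, x))"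
    using lborel_pair.integral_fst'[of "\<lambda>z. (?u (?c + z) - ?u z) * \<phi> z"] i12 unfolding lborel_prod by simp
  also have "\<dots> = (LINT t|lborel. LINT x|lborel. \<epsilon>\<^sup>2 * (pe (?c + (t, x)) * \<phi>xx (t, x)))"
    unfolding slice ..
  also have "\<dots> = (LINT z|lborel. \<epsilon>\<^sup>2 * (pe (?c + z) * \<phi>xx z))"
    using lborel_pair.integral_fst'[of "\<lambda>z. \<epsilon>\<^sup>2 * (pe (?c + z) * \<phi>xx z)"] i3 unfolding lborel_prod by simp
  also have "\<dots> = \<epsilon>\<^sup>2 * (LINT z|lborel. pe (?c + z) * \<phi>xx z)" by simp
  also have "(LINT z|lborel. pe (?c + z) * \<phi>xx z) = (LINT z|lborel. pe z * \<phi>xx (z - ?c))"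
    using lborel_integral_translate[of "\<lambda>z. pe z * \<phi>xx (z - ?c)" ?c] um'(2)[OF \<phi>m(2)] by simp
  finally have 1: "(LINT z|lborel. (?u (?c + z) - ?u z) * \<phi> z) = \<epsilon>\<^sup>2 * (LINT z|lborel. pe z * \<phi>xx (z - ?c))" .
  have i4: "integrable lborel (\<lambda>z. ?u z * \<phi> (z - ?c))"
  proof -
    have "?c + (- ?c + z) = z" "- ?c + z = z - ?c" for z by (simp_all add: prod_eq_iff)
    with lborel_integrable_translate[OF i2, of "- ?c"] show ?thesis by (simp only:)
  qed
  have "(LINT z|lborel. (?u (?c + z) - ?u z) * \<phi> z) = (LINT z|lborel. ?u (?c + z) * \<phi> z) - (LINT z|lborel. ?u z * \<phi> z)"
    using i1 i2 by (simp add: left_diff_distrib)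
  also have "(LINT z|lborel. ?u (?c + z) * \<phi> z) = (LINT z|lborel. ?u z * \<phi> (z - ?c))"
    using lborel_integral_translate[of "\<lambda>z. ?u z * \<phi> (z - ?c)" ?c] um'(2)[OF \<phi>m(1)] by simp
  also have "(LINT z|lborel. ?u z * \<phi> (z - ?c)) - (LINT z|lborel. ?u z * \<phi> z) = (LINT z|lborel. ?u z * (\<phi> (z - ?c) - \<phi> z))"
    using i1 i4 by (simp add: right_diff_distrib)
  finally show ?thesis using 1 by simp
qed

end

subsection \<open>The weak formulation and the bounds\<close>

locale sharp_limit =
  fixes T :: real and u_ini :: "real \<Rightarrow> real" and \<xi>_ini :: real and e :: "nat \<Rightarrow> real"
    and \<xi>0 :: "real \<Rightarrow> real" and q0 f0 p0 :: "real \<times> real \<Rightarrow> real"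
  assumes T_pos: "T > 0"
    and adm: "admissible_state u_ini \<xi>_ini"
    and e_pos: "0 < e k" and e_le: "(e k)\<^sup>2 \<le> T" and e_lim: "e \<longlonglongrightarrow> 0"
    and \<xi>_lim: "Linf_tendsto {0..T} (\<lambda>k. xi_eps (e k) u_ini \<xi>_ini) \<xi>0"
    and \<xi>_cont: "continuous_on {0..T} \<xi>0"
    and q_cont: "continuous_on ({0..T} \<times> UNIV) q0"
    and heat: "heat_solution T (p_of u_ini \<xi>_ini) q0"
    and f_lim: "compact K \<Longrightarrow> K \<subseteq> {0..T} \<times> UNIV \<Longrightarrow> Linf_tendsto K (\<lambda>k. f_eps (e k) u_ini \<xi>_ini) f0"
    and f_cont: "continuous_on ({0..T} \<times> UNIV) f0"
    and p0_eq: "p0 z = q0 z - f0 z"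
    and p_lim: "compact K \<Longrightarrow> K \<subseteq> {0..T} \<times> UNIV \<Longrightarrow> Linf_tendsto K (\<lambda>k. p_eps (e k) u_ini \<xi>_ini) p0"
begin

abbreviation "strip \<equiv> {0..T} \<times> (UNIV :: real set)"
abbreviation "pk k \<equiv> p_eps (e k) u_ini \<xi>_ini"
abbreviation "fk k \<equiv> f_eps (e k) u_ini \<xi>_ini"
abbreviation "xk k \<equiv> xi_eps (e k) u_ini \<xi>_ini"

lemma run: "scheme_run (e k) u_ini \<xi>_ini"
  by unfold_locales (rule e_pos adm)+

lemma p_cont: "continuous_on strip p0"
  unfolding p0_eq[abs_def] by (intro continuous_on_diff q_cont f_cont)

lemma strip_borel [measurable]: "strip \<in> sets borel"
  by (intro borel_closed closed_Times) auto

lemma strip_measurable: "continuous_on strip h \<Longrightarrow> (\<lambda>z. indicator strip z * h z :: real) \<in> borel_measurable borel"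
  using borel_measurable_continuous_on_indicator[OF strip_borel, of h] by simp

text \<open>The limits are only known to be continuous on the closed strip; extended by \<open>0\<close> they are
  Borel functions.\<close>

abbreviation "P \<equiv> (\<lambda>z. indicator strip z * p0 z)"
abbreviation "X \<equiv> (\<lambda>t. indicator {0..T} t * \<xi>0 t)"

lemma X_measurable [measurable]: "X \<in> borel_measurable borel"
  using borel_measurable_continuous_on_indicator[of "{0..T}", OF _ \<xi>_cont] by simp

lemma P_measurable [measurable]: "P \<in> borel_measurable borel"
  by (rule strip_measurable[OF p_cont])

lemma locally_AE_tendsto:
  assumes "\<And>K. compact K \<Longrightarrow> K \<subseteq> strip \<Longrightarrow> Linf_tendsto K F h"
  shows "AE z in lborel. z \<in> strip \<longrightarrow> (\<lambda>k. F k z) \<longlonglongrightarrow> h z"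
proof -
  have "AE z in lborel. z \<in> {0..T} \<times> {- real m..real m} \<longrightarrow> (\<lambda>k. F k z) \<longlonglongrightarrow> h z" for m
  proof -
    have c: "compact ({0..T} \<times> {- real m..real m})" by (intro compact_Times) auto
    have s: "{0..T} \<times> {- real m..real m} \<subseteq> strip" by auto
    from Linf_tendsto_AE[OF assms[OF c s]] show ?thesis
      by (subst (asm) AE_lebesgue_on_iff) (use c in \<open>auto intro: borel_closed compact_imp_closed\<close>)
  qed
  then have "AE z in lborel. \<forall>m. z \<in> {0..T} \<times> {- real m..real m} \<longrightarrow> (\<lambda>k. F k z) \<longlonglongrightarrow> h z"
    by (simp only: AE_all_countable) simp
  then show ?thesis
  proof eventually_elim
    case (elim z)
    obtain m where "\<bar>snd z\<bar> \<le> real m" using real_arch_simple by blast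
    then have "z \<in> strip \<Longrightarrow> z \<in> {0..T} \<times> {- real m..real m}" by (cases z) auto
    then show ?case using elim by blast
  qed
qed

lemma locally_AE_bounded:
  assumes "\<And>K. compact K \<Longrightarrow> K \<subseteq> strip \<Longrightarrow> Linf_tendsto K F h" "continuous_on strip h" "compact S" "S \<subseteq> strip"
  obtains C where "\<forall>\<^sub>F k in sequentially. AE z in lborel. z \<in> S \<longrightarrow> \<bar>F k z\<bar> \<le> C"
proof -
  have "compact (h ` S)" using assms by (intro compact_continuous_image) (auto intro: continuous_on_subset)
  from compact_imp_bounded[OF this] obtain C where C: "\<forall>z\<in>S. \<bar>h z\<bar> \<le> C" unfolding bounded_iff by auto
  have "\<forall>\<^sub>F k in sequentially. AE z in lebesgue_on S. \<bar>F k z - h z\<bar> \<le> 1"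
    by (rule Linf_tendsto_bound[OF assms(1)[OF assms(3,4)]]) simp
  then have "\<forall>\<^sub>F k in sequentially. AE z in lborel. z \<in> S \<longrightarrow> \<bar>F k z\<bar> \<le> C + 1"
  proof eventually_elim
    case (elim k)
    then have "AE z in lborel. z \<in> S \<longrightarrow> \<bar>F k z - h z\<bar> \<le> 1"
      by (subst (asm) AE_lebesgue_on_iff) (use assms(3) in \<open>auto intro: borel_closed compact_imp_closed\<close>)
    then show ?case by eventually_elim (use C in fastforce)
  qed
  then show thesis by (rule that)
qed

lemma p_AE: "AE z in lborel. z \<in> strip \<longrightarrow> (\<lambda>k. pk k z) \<longlonglongrightarrow> p0 z"
  by (rule locally_AE_tendsto[OF p_lim])

lemma x_AE: "AE t in lborel. t \<in> {0..T} \<longrightarrow> (\<lambda>k. xk k t) \<longlonglongrightarrow> \<xi>0 t"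
  using Linf_tendsto_AE[OF \<xi>_lim] by (subst (asm) AE_lebesgue_on_iff) auto

text \<open>Off the limiting graph, a null set, the sign is continuous, so convergence of the
  interface positions suffices.\<close>

lemma sgn_AE: "AE z in lborel. z \<in> strip \<longrightarrow> (\<lambda>k. sgn (snd z - xk k (fst z))) \<longlonglongrightarrow> sgn (snd z - X (fst z))"
  using AE_lborel_fst[OF x_AE] AE_lborel_graph[OF X_measurable]
proof eventually_elim
  case (elim z)
  show ?case
  proof
    assume "z \<in> strip"
    then have t: "fst z \<in> {0..T}" by auto
    then have X: "X (fst z) = \<xi>0 (fst z)" by simp
    have "(\<lambda>k. xk k (fst z)) \<longlonglongrightarrow> \<xi>0 (fst z)" using elim(1) t by blast
    then have "(\<lambda>k. sgn (snd z - xk k (fst z))) \<longlonglongrightarrow> sgn (snd z - \<xi>0 (fst z))"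
      by (rule tendsto_sgn[OF tendsto_diff[OF tendsto_const]]) (use elim(2) X in simp)
    then show "(\<lambda>k. sgn (snd z - xk k (fst z))) \<longlonglongrightarrow> sgn (snd z - X (fst z))" unfolding X .
  qed
qed

text \<open>Division of \<open>weak_form_step\<close> by \<epsilon>^2 puts a backward difference
  quotient on \<phi>. It is uniformly bounded by the mean value theorem and tends to minus the time
  derivative.\<close>

lemma weak_form_plane:
  assumes tf: "test_function ({0<..<T} \<times> UNIV) \<phi>"
  shows "(LINT z|lborel. P z * partial_deriv (0, 1) (partial_deriv (0, 1) \<phi>) z)
    = - (LINT z|lborel. (P z + sgn (snd z - X (fst z))) * partial_deriv (1, 0) \<phi> z)"
proof -
  let ?\<phi>x = "partial_deriv (0, 1) \<phi>"
  let ?\<phi>xx = "partial_deriv (0, 1) (partial_deriv (0, 1) \<phi>)"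
  let ?\<phi>t = "partial_deriv (1, 0) \<phi>"
  let ?c = "\<lambda>k. ((e k)\<^sup>2, 0 :: real)"
  note tfx = test_function_partial_deriv[OF tf plane_Basis(2)]
  note tfxx = test_function_partial_deriv[OF tfx plane_Basis(2)]
  note tft = test_function_partial_deriv[OF tf plane_Basis(1)]
  obtain \<delta> R where \<delta>: "\<delta> > 0" "R \<ge> 0" and z0: "\<And>z. z \<notin> {\<delta>..T - \<delta>} \<times> {-R..R} \<Longrightarrow> \<phi> z = 0"
    using strip_test_function_support[OF tf] by metis
  let ?S = "{\<delta>..T - \<delta>} \<times> {-R..R}"
  have clS: "closed ?S" by (auto intro!: closed_Times)
  have zx: "?\<phi>x z = 0" if "z \<notin> ?S" for z by (rule partial_deriv_zero_outside[OF clS z0 that])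
  have zxx: "?\<phi>xx z = 0" if "z \<notin> ?S" for z by (rule partial_deriv_zero_outside[OF clS zx that])
  \<comment> \<open>The support box enlarged in time by \<delta>/2: it contains the shifted supports
    once \<epsilon>^2 < \<delta>/2 and still lies in the strip, where the convergence is
    known.\<close>
  let ?K = "{\<delta>..T - \<delta> / 2} \<times> {-R..R}"
  have coK: "compact ?K" by (intro compact_Times) auto
  have subK: "?K \<subseteq> strip" using \<delta> by auto
  obtain C where C: "\<forall>\<^sub>F k in sequentially. AE z in lborel. z \<in> ?K \<longrightarrow> \<bar>pk k z\<bar> \<le> C"
    using locally_AE_bounded[OF p_lim p_cont coK subK] by metis
  obtain D where D: "\<And>z. \<bar>?\<phi>t z\<bar> \<le> D" using test_function_bounded[OF tft] by metis
  obtain D' where D': "\<And>z. \<bar>?\<phi>xx z\<bar> \<le> D'" using test_function_bounded[OF tfxx] by metis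
  have \<phi>m [measurable]: "\<phi> \<in> borel_measurable borel" "?\<phi>xx \<in> borel_measurable borel" "?\<phi>t \<in> borel_measurable borel"
    using tf tft tfxx by (auto intro: test_function_measurable)
  have e2: "(\<lambda>k. (e k)\<^sup>2) \<longlonglongrightarrow> 0" using tendsto_power[OF e_lim, of 2] by simp
  have small: "\<forall>\<^sub>F k in sequentially. (e k)\<^sup>2 < \<delta> / 2" by (rule order_tendstoD(2)[OF e2]) (use \<delta> in simp)
  have supp: "\<forall>\<^sub>F k in sequentially. \<forall>z. z \<notin> ?K \<longrightarrow> z - ?c k \<notin> ?S \<and> z \<notin> ?S"
    using small
  proof eventually_elim
    case (elim k)
    define h where "h = (e k)\<^sup>2"
    have "0 \<le> h" "h < \<delta> / 2" using elim by (auto simp: h_def)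
    with \<delta> show ?case unfolding h_def[symmetric] by (auto simp: mem_Times_iff)
  qed
  have quot: "\<bar>(\<phi> (z - ?c k) - \<phi> z) / (e k)\<^sup>2\<bar> \<le> D" for k z
  proof -
    have pos: "0 < (e k)\<^sup>2" using e_pos[of k] by simp
    obtain s where "\<phi> (z + 0 *\<^sub>R (1, 0)) - \<phi> (z + (- (e k)\<^sup>2) *\<^sub>R (1, 0)) = (0 - (- (e k)\<^sup>2)) * ?\<phi>t (z + s *\<^sub>R (1, 0))"
      using MVT2[of "- (e k)\<^sup>2" 0 "\<lambda>s. \<phi> (z + s *\<^sub>R (1, 0))" "\<lambda>r. ?\<phi>t (z + r *\<^sub>R (1, 0))"]
        test_function_partial_DERIV[OF tf plane_Basis(1)] pos by auto
    then have "\<phi> z - \<phi> (z - ?c k) = (e k)\<^sup>2 * ?\<phi>t (z + s *\<^sub>R (1, 0))" by (simp add: scaleR_prod_def minus_prod_def plus_prod_def zero_prod_def)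
    then have "(\<phi> (z - ?c k) - \<phi> z) / (e k)\<^sup>2 = - ?\<phi>t (z + s *\<^sub>R (1, 0))" using pos by (simp add: field_simps)
    then show ?thesis using D by simp
  qed
  have quot_lim: "(\<lambda>k. (\<phi> (z - ?c k) - \<phi> z) / (e k)\<^sup>2) \<longlonglongrightarrow> - ?\<phi>t z" for z
  proof -
    have "((\<lambda>h. (\<phi> (z + (0 + h) *\<^sub>R (1, 0)) - \<phi> (z + 0 *\<^sub>R (1, 0))) / h) \<longlongrightarrow> ?\<phi>t (z + 0 *\<^sub>R (1, 0))) (at 0)"
      by (rule DERIV_D[OF test_function_partial_DERIV[OF tf plane_Basis(1), of z 0]])
    moreover have "filterlim (\<lambda>k. - (e k)\<^sup>2) (at 0) sequentially"
      using tendsto_minus[OF e2] e_pos by (intro filterlim_atI) (auto simp: less_imp_neq[symmetric])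
    ultimately have "(\<lambda>k. (\<phi> (z + (0 + - (e k)\<^sup>2) *\<^sub>R (1, 0)) - \<phi> (z + 0 *\<^sub>R (1, 0))) / (- (e k)\<^sup>2)) \<longlonglongrightarrow> ?\<phi>t (z + 0 *\<^sub>R (1, 0))"
      by (rule filterlim_compose)
    from tendsto_minus[OF this] show ?thesis by (simp add: scaleR_prod_def minus_prod_def plus_prod_def zero_prod_def)
  qed
  have xx_lim: "(\<lambda>k. ?\<phi>xx (z - ?c k)) \<longlonglongrightarrow> ?\<phi>xx z" for z
  proof -
    have "(\<lambda>k. z - ?c k) \<longlonglongrightarrow> z - (0, 0)" by (intro tendsto_intros e2)
    moreover have "isCont ?\<phi>xx z" using test_function_continuous[OF tfxx] by (cases z) (simp add: continuous_on_eq_continuous_at)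
    ultimately show ?thesis using isCont_tendsto_compose by (fastforce simp: zero_prod_def[symmetric])
  qed
  have step: "(LINT z|lborel. (pk k z + sgn (snd z - xk k (fst z))) * ((\<phi> (z - ?c k) - \<phi> z) / (e k)\<^sup>2)) = (LINT z|lborel. pk k z * ?\<phi>xx (z - ?c k))" for k
    using scheme_run.weak_form_step[OF run tf, of k] e_pos[of k] by simp
  have m1: "(\<lambda>z. pk k z + sgn (snd z - xk k (fst z))) \<in> borel_measurable borel" "pk k \<in> borel_measurable borel" for k
    by (intro borel_measurable_add scheme_run.pe_measurable[OF run] scheme_run.se_measurable[OF run])+
  have m2: "(\<lambda>z. sgn (snd z - X (fst z))) \<in> borel_measurable (borel :: (real \<times> real) measure)"
  proof -
    have "(\<lambda>z. sgn (snd z - X (fst z))) \<in> borel_measurable (borel \<Otimes>\<^sub>M borel)" by measurable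
    then show ?thesis by (simp add: borel_prod)
  qed
  have P_lim: "AE z in lborel. z \<in> ?K \<longrightarrow> (\<lambda>k. pk k z) \<longlonglongrightarrow> P z"
    using p_AE by eventually_elim (use subK in auto)
  have lim1: "(\<lambda>k. LINT z|lborel. (pk k z + sgn (snd z - xk k (fst z))) * ((\<phi> (z - ?c k) - \<phi> z) / (e k)\<^sup>2))
      \<longlonglongrightarrow> (LINT z|lborel. (P z + sgn (snd z - X (fst z))) * (- ?\<phi>t z))"
  proof (rule tendsto_integral_local[OF m1(1) _ _ _ coK _ quot_lim, where C = "C + 1" and D = D])
    show "AE z in lborel. z \<in> ?K \<longrightarrow> (\<lambda>k. pk k z + sgn (snd z - xk k (fst z))) \<longlonglongrightarrow> P z + sgn (snd z - X (fst z))"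
      using P_lim sgn_AE
    proof eventually_elim
      case (elim z)
      then show ?case using subK by (intro impI tendsto_add) (blast, blast)
    qed
    show "\<forall>\<^sub>F k in sequentially. AE z in lborel. z \<in> ?K \<longrightarrow> \<bar>pk k z + sgn (snd z - xk k (fst z))\<bar> \<le> C + 1"
      using C
    proof eventually_elim
      case (elim k)
      then show ?case
      proof eventually_elim
        case (elim z)
        have "\<bar>sgn (snd z - xk k (fst z))\<bar> \<le> 1" by (simp add: sgn_if)
        then show ?case using elim by linarith
      qed
    qed
    show "\<forall>\<^sub>F k in sequentially. \<forall>z. \<bar>(\<phi> (z - ?c k) - \<phi> z) / (e k)\<^sup>2\<bar> \<le> D \<and> (z \<notin> ?K \<longrightarrow> (\<phi> (z - ?c k) - \<phi> z) / (e k)\<^sup>2 = 0)"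
      using supp
    proof eventually_elim
      case (elim k)
      show ?case
      proof (intro allI conjI impI quot)
        fix z assume z: "z \<notin> ?K"
        have 12: "z - ?c k \<notin> ?S \<and> z \<notin> ?S" by (rule mp[OF spec[OF elim] z])
        note 1 = 12[THEN conjunct1] and 2 = 12[THEN conjunct2]
        show "(\<phi> (z - ?c k) - \<phi> z) / (e k)\<^sup>2 = 0" unfolding z0[OF 1] z0[OF 2] by simp
      qed
    qed
  qed (use m2 in measurable)
  have lim2: "(\<lambda>k. LINT z|lborel. pk k z * ?\<phi>xx (z - ?c k)) \<longlonglongrightarrow> (LINT z|lborel. P z * ?\<phi>xx z)"
  proof (rule tendsto_integral_local[OF m1(2) _ _ _ coK P_lim xx_lim C, where D = D'])
    show "\<forall>\<^sub>F k in sequentially. \<forall>z. \<bar>?\<phi>xx (z - ?c k)\<bar> \<le> D' \<and> (z \<notin> ?K \<longrightarrow> ?\<phi>xx (z - ?c k) = 0)"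
      using supp
    proof eventually_elim
      case (elim k)
      show ?case
      proof (intro allI conjI impI D')
        fix z assume z: "z \<notin> ?K"
        have 12: "z - ?c k \<notin> ?S \<and> z \<notin> ?S" by (rule mp[OF spec[OF elim] z])
        show "?\<phi>xx (z - ?c k) = 0" by (rule zxx[OF 12[THEN conjunct1]])
      qed
    qed
  qed measurable
  from LIMSEQ_unique[OF lim2 lim1[unfolded step]] show ?thesis by simp
qed

lemma iterated_integral_eq:
  assumes "integrable lborel G" "\<And>t x. G (t, x) = indicator {0..T} t * (g t x :: real)"
  shows "(LINT t:{0..T}|lborel. (LINT x|lborel. g t x)) = (LINT z|lborel. G z)"
proof -
  have "(LINT z|lborel. G z) = (LINT t|lborel. LINT x|lborel. G (t, x))"
    using lborel_pair.integral_fst'[of G] assms(1) unfolding lborel_prod by simp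
  then show ?thesis by (simp add: assms(2) set_lebesgue_integral_def)
qed

lemma P_locally_bounded:
  assumes "compact S" "S \<subseteq> strip" obtains C where "\<And>z. z \<in> S \<Longrightarrow> \<bar>P z\<bar> \<le> C"
proof -
  have "compact (p0 ` S)" using assms p_cont by (intro compact_continuous_image) (auto intro: continuous_on_subset)
  from compact_imp_bounded[OF this] obtain C where "\<forall>z\<in>S. \<bar>p0 z\<bar> \<le> C" unfolding bounded_iff by auto
  moreover have "P z = p0 z" if "z \<in> S" for z using that assms(2) by auto
  ultimately show thesis using that by metis
qed

lemma weak_form:
  assumes tf: "test_function ({0<..<T} \<times> UNIV) \<phi>"
  shows "(LINT t:{0..T}|lborel. (LINT x|lborel. p0 (t, x) * partial_deriv (0, 1) (partial_deriv (0, 1) \<phi>) (t, x)))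
    = - (LINT t:{0..T}|lborel. (LINT x|lborel. (p0 (t, x) + sgn (x - \<xi>0 t)) * partial_deriv (1, 0) \<phi> (t, x)))"
proof -
  let ?\<phi>x = "partial_deriv (0, 1) \<phi>"
  let ?\<phi>xx = "partial_deriv (0, 1) (partial_deriv (0, 1) \<phi>)"
  let ?\<phi>t = "partial_deriv (1, 0) \<phi>"
  note tfx = test_function_partial_deriv[OF tf plane_Basis(2)]
  note tfxx = test_function_partial_deriv[OF tfx plane_Basis(2)]
  note tft = test_function_partial_deriv[OF tf plane_Basis(1)]
  obtain \<delta> R where \<delta>: "\<delta> > 0" "R \<ge> 0" and z0: "\<And>z. z \<notin> {\<delta>..T - \<delta>} \<times> {-R..R} \<Longrightarrow> \<phi> z = 0"
    using strip_test_function_support[OF tf] by metis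
  let ?S = "{\<delta>..T - \<delta>} \<times> {-R..R}"
  have clS: "closed ?S" and coS: "compact ?S" by (auto intro!: closed_Times compact_Times)
  have zx: "?\<phi>x z = 0" if "z \<notin> ?S" for z by (rule partial_deriv_zero_outside[OF clS z0 that])
  have zxx: "?\<phi>xx z = 0" if "z \<notin> ?S" for z by (rule partial_deriv_zero_outside[OF clS zx that])
  have zt: "?\<phi>t z = 0" if "z \<notin> ?S" for z by (rule partial_deriv_zero_outside[OF clS z0 that])
  have subS: "?S \<subseteq> strip" using \<delta> by auto
  obtain C where C: "\<And>z. z \<in> ?S \<Longrightarrow> \<bar>P z\<bar> \<le> C" using P_locally_bounded[OF coS subS] by metis
  obtain D where D: "\<And>z. \<bar>?\<phi>t z\<bar> \<le> D" using test_function_bounded[OF tft] by metis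
  obtain D' where D': "\<And>z. \<bar>?\<phi>xx z\<bar> \<le> D'" using test_function_bounded[OF tfxx] by metis
  have \<phi>m [measurable]: "?\<phi>xx \<in> borel_measurable borel" "?\<phi>t \<in> borel_measurable borel"
    using tft tfxx by (auto intro: test_function_measurable)
  have m: "(\<lambda>z. P z + sgn (snd z - X (fst z))) \<in> borel_measurable borel"
  proof -
    have "(\<lambda>z. sgn (snd z - X (fst z))) \<in> borel_measurable (borel \<Otimes>\<^sub>M borel)" by measurable
    then show ?thesis using P_measurable by (simp add: borel_prod)
  qed
  have C1: "\<bar>P z + sgn (snd z - X (fst z))\<bar> \<le> C + 1" if "z \<in> ?S" for z
  proof -
    have "\<bar>sgn (snd z - X (fst z))\<bar> \<le> 1" by (simp add: sgn_if)
    then show ?thesis using C[OF that] by linarith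
  qed
  have "(LINT t:{0..T}|lborel. (LINT x|lborel. p0 (t, x) * ?\<phi>xx (t, x))) = (LINT z|lborel. P z * ?\<phi>xx z)"
    by (rule iterated_integral_eq[OF integrable_local_mult[OF P_measurable \<phi>m(1) coS C D' zxx]]) (auto split: split_indicator)
  moreover have "(LINT t:{0..T}|lborel. (LINT x|lborel. (p0 (t, x) + sgn (x - \<xi>0 t)) * ?\<phi>t (t, x)))
     = (LINT z|lborel. (P z + sgn (snd z - X (fst z))) * ?\<phi>t z)"
  proof (rule iterated_integral_eq[OF integrable_local_mult[OF m \<phi>m(2) coS C1 D zt]])
    fix t x
    have "?\<phi>t (t, x) = 0" if "t \<notin> {0..T}" by (rule zt) (use that \<delta> in auto)
    then show "(P (t, x) + sgn (snd (t, x) - X (fst (t, x)))) * ?\<phi>t (t, x) = indicator {0..T} t * ((p0 (t, x) + sgn (x - \<xi>0 t)) * ?\<phi>t (t, x))"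
      by (auto split: split_indicator)
  qed
  ultimately show ?thesis using weak_form_plane[OF tf] by simp
qed

section \<open>Bounds for the limit\<close>

lemma p_bounds_AE:
  "AE z in lborel. z \<in> strip \<longrightarrow> - 1 \<le> p0 z \<and> (snd z < \<xi>0 (fst z) \<longrightarrow> p0 z \<le> 1)"
proof -
  \<comment> \<open>The discrete lower bound is available off the discrete interfaces; these
    countably many graphs form a null set.\<close>
  have "AE z in lborel. \<forall>k. snd z \<noteq> xk k (fst z)"
    unfolding AE_all_countable by (intro allI AE_lborel_graph scheme_run.xe_measurable[OF run])
  with p_AE AE_lborel_fst[OF x_AE] show ?thesis
  proof eventually_elim
    case (elim z)
    show ?case
    proof (intro impI)
      assume z: "z \<in> strip"
      then have t: "fst z \<in> {0..T}" by auto
      have pl: "(\<lambda>k. pk k z) \<longlonglongrightarrow> p0 z" and xl: "(\<lambda>k. xk k (fst z)) \<longlonglongrightarrow> \<xi>0 (fst z)" using elim z t by blast+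
      have "- 1 \<le> pk k z" for k
        using scheme_run.ps_ge[OF run] elim(3) unfolding scheme_run.pe_eq[OF run] xi_eps_def by blast
      then have "- 1 \<le> p0 z" by (intro LIMSEQ_le_const[OF pl]) auto
      moreover have "p0 z \<le> 1" if "snd z < \<xi>0 (fst z)"
      proof -
        have "\<forall>\<^sub>F k in sequentially. snd z < xk k (fst z)" using order_tendstoD(1)[OF xl that] .
        then have "\<forall>\<^sub>F k in sequentially. pk k z \<le> 1"
        proof eventually_elim
          case (elim k)
          then show ?case using scheme_run.ps_le[OF run] unfolding scheme_run.pe_eq[OF run] xi_eps_def by blast
        qed
        then show ?thesis by (intro tendsto_upperbound[OF pl]) auto
      qed
      ultimately show "- 1 \<le> p0 z \<and> (snd z < \<xi>0 (fst z) \<longrightarrow> p0 z \<le> 1)" by blast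
    qed
  qed
qed

lemma strip_open_preimage:
  assumes "continuous_on strip h" "open A" obtains U where "open U" "U \<inter> strip = {z \<in> strip. h z \<in> A}"
  using assms by (auto simp: continuous_on_open_invariant vimage_def Collect_conj_eq Int_commute)

text \<open>A violation at one point would persist on a relatively open part of the strip by
  continuity, and such a part contains points at which the almost everywhere bound holds.\<close>

lemma p_ge: assumes "t \<in> {0..T}" shows "- 1 \<le> p0 (t, x)"
proof (rule ccontr)
  assume n: "\<not> - 1 \<le> p0 (t, x)"
  obtain U where U: "open U" "U \<inter> strip = {z \<in> strip. p0 z \<in> {..<-1}}"
    by (rule strip_open_preimage[OF p_cont open_lessThan])
  have "(t, x) \<in> U \<inter> strip" unfolding U using n assms by auto
  then have tU: "(t, x) \<in> U" by blast
  have "AE z in lborel. z \<in> strip \<longrightarrow> - 1 \<le> p0 z" using p_bounds_AE by eventually_elim blast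
  from strip_AE_dense[OF this T_pos assms U(1) tU] obtain z where "z \<in> U \<inter> strip" "- 1 \<le> p0 z" by blast
  then show False unfolding U by auto
qed

lemma p_le_left: assumes "t \<in> {0..T}" "x < \<xi>0 t" shows "p0 (t, x) \<le> 1"
proof (rule ccontr)
  assume n: "\<not> p0 (t, x) \<le> 1"
  \<comment> \<open>The minimum is positive exactly where both p0 > 1 and x lies left of the
    interface, so a single open preimage captures the violation.\<close>
  have c: "continuous_on strip (\<lambda>z. min (p0 z - 1) (\<xi>0 (fst z) - snd z))"
    by (intro continuous_intros p_cont continuous_on_compose2[OF \<xi>_cont]) auto
  obtain U where U: "open U" "U \<inter> strip = {z \<in> strip. min (p0 z - 1) (\<xi>0 (fst z) - snd z) \<in> {0<..}}"
    by (rule strip_open_preimage[OF c open_greaterThan])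
  have "(t, x) \<in> U \<inter> strip" unfolding U using n assms by auto
  then have tU: "(t, x) \<in> U" by blast
  have "AE z in lborel. z \<in> strip \<longrightarrow> (snd z < \<xi>0 (fst z) \<longrightarrow> p0 z \<le> 1)" using p_bounds_AE by eventually_elim blast
  from strip_AE_dense[OF this T_pos assms(1) U(1) tU] obtain z where "z \<in> U \<inter> strip" "snd z < \<xi>0 (fst z) \<longrightarrow> p0 z \<le> 1" by blast
  then show False unfolding U by auto
qed

lemma p_le: assumes "t \<in> {0..T}" "x \<le> \<xi>0 t" shows "p0 (t, x) \<le> 1"
proof (cases "x = \<xi>0 t")
  case True
  have "continuous_on UNIV (\<lambda>y. p0 (t, y))"
    by (rule continuous_on_compose2[OF p_cont]) (use assms in \<open>auto intro!: continuous_intros\<close>)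
  then have "((\<lambda>y. p0 (t, y)) \<longlongrightarrow> p0 (t, x)) (at_left x)"
    by (auto simp: continuous_on_def intro: filterlim_mono at_le)
  moreover have "\<forall>\<^sub>F y in at_left x. p0 (t, y) \<le> 1"
    unfolding eventually_at_filter using p_le_left[OF assms(1)] True by (intro always_eventually) auto
  ultimately show ?thesis by (rule tendsto_upperbound) simp
qed (use p_le_left assms in auto)

end

subsection \<open>Weak derivatives of monotone functions\<close>

text \<open>The classical smooth function exp(-1 / y), extended by 0, together with powers of 1 / y.
  The family is closed under differentiation up to linear combinations, which settles all orders of
  smoothness at once.\<close>

definition flat_exp :: "nat \<Rightarrow> real \<Rightarrow> real" where
  "flat_exp m y = (if 0 < y then (1 / y) ^ m * exp (- (1 / y)) else 0)"

lemma flat_exp_DERIV: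
  "(flat_exp m has_real_derivative flat_exp (m + 2) y - real m * flat_exp (m + 1) y) (at y)"
proof -
  consider "y > 0" | "y < 0" | "y = 0" by linarith
  then show ?thesis
  proof cases
    case 1
    have "((\<lambda>y. (1 / y) ^ m * exp (- (1 / y))) has_real_derivative
        (1 / y) ^ m * (exp (- (1 / y)) * (1 / y ^ 2)) + (real m * (1 / y) ^ (m - 1) * (- (1 / y ^ 2))) * exp (- (1 / y))) (at y)"
      using 1 by (auto intro!: derivative_eq_intros simp: power2_eq_square)
    moreover have "real m * (1 / y) ^ (m - 1) * (1 / y ^ 2) = real m * (1 / y) ^ (m + 1)"
      by (cases m) (auto simp: power2_eq_square power_divide)
    ultimately have "((\<lambda>y. (1 / y) ^ m * exp (- (1 / y))) has_real_derivative flat_exp (m + 2) y - real m * flat_exp (m + 1) y) (at y)"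
      using 1 by (cases m) (simp_all add: flat_exp_def power_divide power2_eq_square algebra_simps)
    then show ?thesis
      by (rule has_field_derivative_transform_within_open[of _ _ _ "{0<..}"]) (use 1 in \<open>auto simp: flat_exp_def\<close>)
  next
    case 2
    have "((\<lambda>_. 0) has_real_derivative flat_exp (m + 2) y - real m * flat_exp (m + 1) y) (at y)"
      using 2 by (simp add: flat_exp_def)
    then show ?thesis
      by (rule has_field_derivative_transform_within_open[of _ _ _ "{..<0}"]) (use 2 in \<open>auto simp: flat_exp_def\<close>)
  next
    case 3
    \<comment> \<open>With x = 1 / h the difference quotient at 0 from the right is x^(m+1) / exp
      x.\<close>
    have "((\<lambda>x::real. x ^ (m + 1) / exp x) \<longlongrightarrow> 0) at_top" by (rule tendsto_power_div_exp_0)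
    then have "((\<lambda>h. inverse h ^ (m + 1) / exp (inverse h)) \<longlongrightarrow> 0) (at_right (0::real))"
      by (rule filterlim_compose[OF _ filterlim_inverse_at_top_right])
    moreover have "\<forall>\<^sub>F h in at_right (0::real). inverse h ^ (m + 1) / exp (inverse h) = (flat_exp m (0 + h) - flat_exp m 0) / h"
      by (auto simp: eventually_at_filter flat_exp_def exp_minus field_simps)
    ultimately have r: "((\<lambda>h. (flat_exp m (0 + h) - flat_exp m 0) / h) \<longlongrightarrow> 0) (at_right 0)"
      by (rule Lim_transform_eventually)
    have l: "((\<lambda>h. (flat_exp m (0 + h) - flat_exp m 0) / h) \<longlongrightarrow> 0) (at_left 0)"
      by (rule Lim_transform_eventually[OF tendsto_const]) (auto simp: eventually_at_filter flat_exp_def)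
    from l r have "((\<lambda>h. (flat_exp m (0 + h) - flat_exp m 0) / h) \<longlongrightarrow> 0) (at 0)"
      by (simp add: filterlim_at_split)
    then have "(flat_exp m has_real_derivative 0) (at 0)" by (simp add: DERIV_def)
    then show ?thesis using 3 by (simp add: flat_exp_def)
  qed
qed

text \<open>For polynomial w this set is closed under differentiation; \<open>Ck k\<close> then
  follows by induction on k for all its members simultaneously.\<close>

inductive_set flat_span :: "(real \<Rightarrow> real) \<Rightarrow> (real \<Rightarrow> real) set" for w where
  base: "real_polynomial_function p \<Longrightarrow> (\<lambda>x. p x * flat_exp m (w x)) \<in> flat_span w"
| add: "f \<in> flat_span w \<Longrightarrow> g \<in> flat_span w \<Longrightarrow> (\<lambda>x. f x + g x) \<in> flat_span w"

lemma flat_span_DERIV: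
  assumes w: "real_polynomial_function w" and "f \<in> flat_span w"
  shows "\<exists>f'\<in>flat_span w. \<forall>x. (f has_real_derivative f' x) (at x)"
  using assms(2)
proof induction
  case (base p m)
  from has_real_derivative_polynomial_function[OF w] obtain w' where w': "real_polynomial_function w'" "\<And>x. (w has_real_derivative w' x) (at x)" by metis
  from has_real_derivative_polynomial_function[OF base] obtain p' where p': "real_polynomial_function p'" "\<And>x. (p has_real_derivative p' x) (at x)" by metis
  let ?f' = "\<lambda>x. p' x * flat_exp m (w x) + (p x * w' x * flat_exp (m + 2) (w x) + (- real m * (p x * w' x)) * flat_exp (m + 1) (w x))"
  have "?f' \<in> flat_span w"
    by (intro flat_span.intros real_polynomial_function.intros p' w' base)
  moreover have "((\<lambda>x. p x * flat_exp m (w x)) has_real_derivative ?f' x) (at x)" for x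
    using DERIV_mult[OF p'(2)[of x] DERIV_chain2[OF flat_exp_DERIV[of m] w'(2)[of x]]] by (simp add: algebra_simps)
  ultimately show ?case by (intro bexI[of _ ?f'] allI)
next
  case (add f g)
  then obtain f' g' where "f' \<in> flat_span w" "\<And>x. (f has_real_derivative f' x) (at x)" "g' \<in> flat_span w" "\<And>x. (g has_real_derivative g' x) (at x)" by blast
  then show ?case by (intro bexI[of _ "\<lambda>x. f' x + g' x"] allI DERIV_add flat_span.add)
qed

lemma partial_deriv_real: "(f has_real_derivative D) (at x) \<Longrightarrow> partial_deriv 1 f x = D"
  using DERIV_shift[of f D 0 x] by (auto simp: partial_deriv_def add.commute intro: DERIV_imp_deriv)

lemma flat_span_Ck:
  assumes w: "real_polynomial_function w" shows "f \<in> flat_span w \<Longrightarrow> Ck k f"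
proof (induction k arbitrary: f)
  case 0
  then show ?case using flat_span_DERIV[OF w 0] by (auto intro: DERIV_isCont continuous_at_imp_continuous_on)
next
  case (Suc k)
  obtain f' where f': "f' \<in> flat_span w" "\<And>x. (f has_real_derivative f' x) (at x)" using flat_span_DERIV[OF w Suc.prems] by blast
  have "partial_deriv 1 f = f'" using partial_deriv_real[OF f'(2)] by blast
  moreover have "(\<lambda>s. f (x + s *\<^sub>R 1)) field_differentiable at 0" for x
    using DERIV_shift[of f "f' x" 0 x] f'(2)[of x] by (auto simp: field_differentiable_def add.commute)
  moreover have "continuous_on UNIV f" using f'(2) by (auto intro: DERIV_isCont continuous_at_imp_continuous_on)
  ultimately show ?case using Suc.IH[OF f'(1)] by simp
qed

lemma borel_measurable_lebesgueI: "f \<in> borel_measurable borel \<Longrightarrow> f \<in> borel_measurable lebesgue"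
  by (simp add: measurable_completion)

text \<open>For c < c' the product (t - c)(c' - t) is positive exactly between c and c', so one
  composition cuts off at both ends.\<close>

definition bump :: "real \<Rightarrow> real \<Rightarrow> real \<Rightarrow> real" where
  "bump c c' t = flat_exp 0 ((t - c) * (c' - t))"

lemma bump_nonneg: "0 \<le> bump c c' t" and bump_le_1: "bump c c' t \<le> 1"
  by (auto simp: bump_def flat_exp_def)

lemma bump_pos: "c < t \<Longrightarrow> t < c' \<Longrightarrow> 0 < bump c c' t"
  by (simp add: bump_def flat_exp_def)

lemma bump_zero: assumes "c < c'" "t \<notin> {c<..<c'}" shows "bump c c' t = 0"
proof -
  have "(t - c) * (c' - t) \<le> 0"
    using assms by (cases "t \<le> c") (auto intro: mult_nonpos_nonneg mult_nonneg_nonpos)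
  then show ?thesis by (simp add: bump_def flat_exp_def)
qed

lemma test_function_bump:
  assumes p: "real_polynomial_function p" and "a < c" "c < c'" "c' < b"
  shows "test_function {a<..<b} (\<lambda>t. (p t)\<^sup>2 * bump c c' t)"
proof -
  have w: "real_polynomial_function (\<lambda>t. (t - c) * (c' - t))"
    by (intro real_polynomial_function.intros real_polynomial_function_diff bounded_linear_ident)
  have "(\<lambda>t. (p t)\<^sup>2 * bump c c' t) \<in> flat_span (\<lambda>t. (t - c) * (c' - t))"
    unfolding bump_def power2_eq_square by (intro flat_span.base real_polynomial_function.intros p)
  then have Ck: "\<forall>k. Ck k (\<lambda>t. (p t)\<^sup>2 * bump c c' t)" using flat_span_Ck[OF w] by blast
  have "{t. (p t)\<^sup>2 * bump c c' t \<noteq> 0} \<subseteq> {c..c'}"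
  proof (rule subsetI, rule ccontr)
    fix t assume t: "t \<in> {t. (p t)\<^sup>2 * bump c c' t \<noteq> 0}" "t \<notin> {c..c'}"
    then have "bump c c' t = 0" by (intro bump_zero[OF assms(3)]) auto
    then show False using t by simp
  qed
  then have "closure {t. (p t)\<^sup>2 * bump c c' t \<noteq> 0} \<subseteq> {c..c'}" by (intro closure_minimal) auto
  moreover from this have "compact (closure {t. (p t)\<^sup>2 * bump c c' t \<noteq> 0})"
    using compact_Int_closed[of "{c..c'}" "closure {t. (p t)\<^sup>2 * bump c c' t \<noteq> 0}"] by (simp add: Int_absorb1)
  ultimately show ?thesis unfolding test_function_def using Ck assms by auto
qed

lemma bump_measurable [measurable]: "bump c c' \<in> borel_measurable borel"
proof -
  have "flat_exp 0 \<in> borel_measurable borel"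
    using flat_exp_DERIV by (intro borel_measurable_continuous_onI) (auto intro: DERIV_isCont continuous_at_imp_continuous_on)
  then show ?thesis unfolding bump_def[abs_def] by measurable
qed

text \<open>Testing with squares of polynomials times a bump suffices: squares of polynomials are
  uniformly dense in the nonnegative continuous functions, and these approximate the indicator
  of the set where \<^term>\<open>d\<close> is positive.\<close>

lemma nonpos_of_test_functions:
  assumes d: "L1_loc {a<..<b} d" and "a < c" "c < c'" "c' < b"
    and test: "\<And>p. real_polynomial_function p \<Longrightarrow> (LINT t|lebesgue_on {a<..<b}. d t * ((p t)\<^sup>2 * bump c c' t)) \<le> 0"
  shows "AE t in lborel. t \<in> {c<..<c'} \<longrightarrow> d t \<le> 0"
proof -
  have K: "compact {c..c'}" "{c..c'} \<subseteq> {a<..<b}" using assms by auto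
  \<comment> \<open>The bump and the cut-off are absorbed into the integrand, which leaves an
    integrable D tested by squares of polynomials alone. Inside (c, c') it has the sign of
    d.\<close>
  define D where "D t = indicator {c..c'} t * d t * bump c c' t" for t
  have "integrable (lebesgue_on {c..c'}) d" using d K by (auto simp: L1_loc_def)
  then have dK: "integrable lebesgue (\<lambda>t. indicator {c..c'} t * d t)"
    by (subst (asm) integrable_restrict_space) auto
  have bm: "bump c c' \<in> borel_measurable lebesgue" by (rule borel_measurable_lebesgueI[OF bump_measurable])
  have D: "integrable lebesgue D"
  proof (rule Bochner_Integration.integrable_bound[OF dK])
    show "D \<in> borel_measurable lebesgue" unfolding D_def[abs_def] using borel_measurable_integrable[OF dK] bm by measurable
    have "norm (D t) \<le> norm (indicator {c..c'} t * d t)" for t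
      using mult_left_mono[OF bump_le_1[of c c' t], of "\<bar>indicator {c..c'} t * d t\<bar>"] bump_nonneg[of c c' t] by (simp add: D_def abs_mult)
    then show "AE t in lebesgue. norm (D t) \<le> norm (indicator {c..c'} t * d t)" by simp
  qed
  have D_test: "(LINT t|lebesgue. D t * (p t)\<^sup>2) \<le> 0" if "real_polynomial_function p" for p
  proof -
    have "(LINT t|lebesgue_on {a<..<b}. d t * ((p t)\<^sup>2 * bump c c' t)) = (LINT t|lebesgue. D t * (p t)\<^sup>2)"
    proof (subst integral_restrict_space)
      show "(LINT t|lebesgue. indicator {a<..<b} t *\<^sub>R (d t * ((p t)\<^sup>2 * bump c c' t))) = (LINT t|lebesgue. D t * (p t)\<^sup>2)"
      proof (rule Bochner_Integration.integral_cong[OF refl])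
        fix t
        show "indicator {a<..<b} t *\<^sub>R (d t * ((p t)\<^sup>2 * bump c c' t)) = D t * (p t)\<^sup>2"
          using bump_zero[OF assms(3), of t] K(2) unfolding D_def by (cases "t \<in> {c..c'}") (auto split: split_indicator)
      qed
    qed auto
    then show ?thesis using test[OF that] by simp
  qed
  have dom: "(\<lambda>n. LINT t|lebesgue. D t * s n t) \<longlonglongrightarrow> (LINT t|lebesgue. D t * s' t)"
    if s: "\<And>n. s n \<in> borel_measurable lebesgue" "s' \<in> borel_measurable lebesgue"
      "AE t in lebesgue. t \<in> {c..c'} \<longrightarrow> (\<lambda>n. s n t) \<longlonglongrightarrow> s' t" "\<And>n t. t \<in> {c..c'} \<Longrightarrow> \<bar>s n t\<bar> \<le> B" for s s' B
  proof (rule integral_dominated_convergence)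
    show "integrable lebesgue (\<lambda>t. \<bar>D t\<bar> * B)" using D by simp
    show "AE t in lebesgue. (\<lambda>n. D t * s n t) \<longlonglongrightarrow> D t * s' t"
      using s(3) by eventually_elim (auto simp: D_def intro: tendsto_intros split: split_indicator)
    fix n
    have "norm (D t * s n t) \<le> \<bar>D t\<bar> * B" for t
    proof (cases "t \<in> {c..c'}")
      case True
      then show ?thesis unfolding real_norm_def abs_mult by (intro mult_left_mono s(4)) auto
    next
      case False
      then show ?thesis by (simp add: D_def)
    qed
    then show "AE t in lebesgue. norm (D t * s n t) \<le> \<bar>D t\<bar> * B" by simp
  qed (use s D in measurable)
  have D_cont: "(LINT t|lebesgue. D t * \<psi> t) \<le> 0" if \<psi>: "continuous_on UNIV \<psi>" "\<And>t. 0 \<le> \<psi> t" "\<And>t. \<psi> t \<le> 1" for \<psi>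
  proof -
    \<comment> \<open>It is the root of \<psi> that is approximated, so that the squares of the
      polynomials approach \<psi>. The bound 4 below stems from sqrt \<psi> <= 1 and an error of at
      most 1.\<close>
    have "\<exists>g. real_polynomial_function g \<and> (\<forall>t\<in>{c..c'}. \<bar>sqrt (\<psi> t) - g t\<bar> < inverse (real (Suc n)))" for n
      using Stone_Weierstrass_real_polynomial_function[of "{c..c'}" "\<lambda>t. sqrt (\<psi> t)" "inverse (real (Suc n))"]
        continuous_on_subset[OF continuous_on_real_sqrt[OF \<psi>(1)], of "{c..c'}"] by (metis K(1) inverse_positive_iff_positive of_nat_0_less_iff subset_UNIV zero_less_Suc)
    then obtain g where g: "\<And>n. real_polynomial_function (g n)" "\<And>n t. t \<in> {c..c'} \<Longrightarrow> \<bar>sqrt (\<psi> t) - g n t\<bar> < inverse (real (Suc n))"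
      by metis
    have gm: "g n \<in> borel_measurable lebesgue" for n
      by (rule borel_measurable_lebesgueI, rule borel_measurable_continuous_onI, rule continuous_on_polymonial_function)
         (use g(1) in \<open>simp add: real_polynomial_function_eq\<close>)
    have "(\<lambda>n. LINT t|lebesgue. D t * (g n t)\<^sup>2) \<longlonglongrightarrow> (LINT t|lebesgue. D t * \<psi> t)"
    proof (rule dom[where B = 4])
      show "\<psi> \<in> borel_measurable lebesgue" by (rule borel_measurable_lebesgueI[OF borel_measurable_continuous_onI[OF \<psi>(1)]])
      show "AE t in lebesgue. t \<in> {c..c'} \<longrightarrow> (\<lambda>n. (g n t)\<^sup>2) \<longlonglongrightarrow> \<psi> t"
      proof (intro AE_I2 impI)
        fix t assume t: "t \<in> {c..c'}"
        have "(\<lambda>n. sqrt (\<psi> t) - g n t) \<longlonglongrightarrow> 0"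
          by (rule Lim_null_comparison[OF _ LIMSEQ_inverse_real_of_nat]) (use g(2)[OF t] in \<open>auto intro!: always_eventually less_imp_le\<close>)
        then have "(\<lambda>n. (sqrt (\<psi> t) - (sqrt (\<psi> t) - g n t))\<^sup>2) \<longlonglongrightarrow> (sqrt (\<psi> t) - 0)\<^sup>2" by (intro tendsto_intros)
        then show "(\<lambda>n. (g n t)\<^sup>2) \<longlonglongrightarrow> \<psi> t" using \<psi>(2)[of t] by simp
      qed
      fix n t assume t: "t \<in> {c..c'}"
      have "inverse (real (Suc n)) \<le> 1" by (simp add: inverse_le_1_iff)
      moreover have "sqrt (\<psi> t) \<le> 1" "0 \<le> sqrt (\<psi> t)" using \<psi> by auto
      ultimately have "\<bar>g n t\<bar> \<le> 2" using g(2)[OF t, of n] by linarith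
      then have "\<bar>g n t\<bar> ^ 2 \<le> 2 ^ 2" by (intro power_mono) auto
      then show "\<bar>(g n t)\<^sup>2\<bar> \<le> 4" by simp
    qed (use gm in measurable)
    then show ?thesis by (rule LIMSEQ_le_const2) (use D_test[OF g(1)] in auto)
  qed
  \<comment> \<open>Testing with the indicator of this set leaves the integral of the positive part
    of D, which must then vanish.\<close>
  define A where "A = {t. 0 < D t}"
  have Am: "A \<in> sets lebesgue"
  proof -
    have [measurable]: "D \<in> borel_measurable lebesgue" using D by simp
    have "{t \<in> space lebesgue. 0 < D t} \<in> sets lebesgue" by measurable
    then show ?thesis by (simp add: A_def)
  qed
  \<comment> \<open>Provides continuous functions converging to the indicator off a null set; they
    are clipped to [0, 1] to meet the conditions of \<open>D_cont\<close>.\<close>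
  have "indicat_real A measurable_on UNIV"
    by (rule simple_function_measurable_on_UNIV) (use Am in \<open>auto intro: simple_function_indicator\<close>)
  then obtain N g where N: "negligible N" and g: "\<And>n. continuous_on UNIV (g n)" "\<And>x. x \<notin> N \<Longrightarrow> (\<lambda>n. g n x) \<longlonglongrightarrow> indicat_real A x"
    unfolding measurable_on_def by auto
  have "(\<lambda>n. LINT t|lebesgue. D t * min 1 (max 0 (g n t))) \<longlonglongrightarrow> (LINT t|lebesgue. D t * indicator A t)"
  proof (rule dom[where B = 1])
    show "(\<lambda>t. min 1 (max 0 (g n t))) \<in> borel_measurable lebesgue" for n
      by (rule borel_measurable_lebesgueI[OF borel_measurable_continuous_onI]) (intro continuous_intros g)
    show "indicat_real A \<in> borel_measurable lebesgue" using Am by measurable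
    have "AE t in lebesgue. t \<notin> N" using N by (intro AE_not_in) (simp add: negligible_iff_null_sets)
    then show "AE t in lebesgue. t \<in> {c..c'} \<longrightarrow> (\<lambda>n. min 1 (max 0 (g n t))) \<longlonglongrightarrow> indicator A t"
    proof eventually_elim
      case (elim t)
      have "(\<lambda>n. min 1 (max 0 (g n t))) \<longlonglongrightarrow> min 1 (max 0 (indicat_real A t))"
        by (intro tendsto_intros g(2) elim)
      also have "min 1 (max 0 (indicat_real A t)) = indicator A t" by (auto split: split_indicator)
      finally show ?case by simp
    qed
  qed auto
  then have le: "(LINT t|lebesgue. D t * indicator A t) \<le> 0"
    by (rule LIMSEQ_le_const2) (auto intro!: exI[of _ 0] D_cont continuous_intros g)
  have DA: "integrable lebesgue (\<lambda>t. D t * indicator A t)" using integrable_mult_indicator[OF Am D] by (simp add: mult.commute)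
  have nn: "0 \<le> D t * indicator A t" for t by (auto simp: A_def split: split_indicator)
  have "(LINT t|lebesgue. D t * indicator A t) = 0" using le integral_nonneg_AE[of "\<lambda>t. D t * indicator A t" lebesgue] nn by (simp add: antisym)
  then have "AE t in lebesgue. D t * indicator A t = 0"
    using integral_nonneg_eq_0_iff_AE[OF DA] nn by simp
  then have "AE t in lborel. D t * indicator A t = 0" by (simp add: AE_completion_iff)
  then show ?thesis
  proof eventually_elim
    case (elim t)
    show ?case
    proof (rule impI, rule ccontr)
      assume t: "t \<in> {c<..<c'}" "\<not> d t \<le> 0"
      then have "0 < D t" using bump_pos[of c t c'] by (simp add: D_def)
      then show False using elim by (simp add: A_def)
    qed
  qed
qed

text \<open>Shifting the variable turns the forward difference quotient of \<phi> against Z into the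
  integral of (Z(t - h) - Z(t)) \<phi>(t) / h, which is nonnegative. Monotonicity is assumed only on
  a subinterval, so that the lemma also serves where the interface is locally constant.\<close>

lemma antimono_weak_deriv_test:
  fixes Z :: "real \<Rightarrow> real"
  assumes Z: "continuous_on {\<alpha><..<\<beta>} Z" and anti: "\<And>s t. \<alpha> < s \<Longrightarrow> s \<le> t \<Longrightarrow> t < \<beta> \<Longrightarrow> Z t \<le> Z s"
    and sub: "a \<le> \<alpha>" "\<beta> \<le> b" and c: "\<alpha> < c" "c < c'" "c' < \<beta>"
    and tf: "test_function {a<..<b} \<phi>" and nn: "\<And>t. 0 \<le> \<phi> t" and supp: "\<And>t. t \<notin> {c..c'} \<Longrightarrow> \<phi> t = 0"
  shows "0 \<le> (LINT t|lebesgue_on {a<..<b}. Z t * partial_deriv 1 \<phi> t)"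
proof -
  \<comment> \<open>Half the smaller distance from [c, c'] to the ends of the interval: shifting
    back by h <= \<delta> from [c, c'] stays inside \<open>?S\<close>, where Z is bounded and
    monotone.\<close>
  define \<delta> where "\<delta> = min (c - \<alpha>) (\<beta> - c') / 2"
  have \<delta>: "\<delta> > 0" "\<alpha> < c - \<delta>" "c' + \<delta> < \<beta>" using c by (auto simp: \<delta>_def min_def field_simps)
  let ?S = "{c - \<delta>..c' + \<delta>}"
  have coS: "compact ?S" and subS: "?S \<subseteq> {\<alpha><..<\<beta>}" using \<delta> by auto
  let ?Z = "\<lambda>t. indicator ?S t * Z t"
  have Zm [measurable]: "?Z \<in> borel_measurable borel"
    using borel_measurable_continuous_on_indicator[of ?S Z] continuous_on_subset[OF Z subS] by simp
  have "compact (Z ` ?S)" using continuous_on_subset[OF Z subS] by (intro compact_continuous_image coS)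
  from compact_imp_bounded[OF this] obtain C where C: "\<forall>t\<in>?S. \<bar>Z t\<bar> \<le> C" unfolding bounded_iff by auto
  define h where "h k = \<delta> * inverse (real (Suc k))" for k
  have h: "0 < h k" "h k \<le> \<delta>" for k
  proof -
    show "0 < h k" using \<delta> by (simp add: h_def)
    have "inverse (real (Suc k)) \<le> 1" by (simp add: inverse_le_1_iff)
    then show "h k \<le> \<delta>" using mult_left_mono[of "inverse (real (Suc k))" 1 \<delta>] \<delta> by (simp add: h_def)
  qed
  have h0: "h \<longlonglongrightarrow> 0" using tendsto_mult[OF tendsto_const[of \<delta>] LIMSEQ_inverse_real_of_nat] by (simp add: h_def[abs_def])
  have B1: "(1::real) \<in> Basis" by simp
  have tfd: "test_function {a<..<b} (partial_deriv 1 \<phi>)" by (rule test_function_partial_deriv[OF tf B1])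
  have der: "(\<phi> has_real_derivative partial_deriv 1 \<phi> t) (at t)" for t
    using test_function_partial_DERIV[OF tf B1, of 0 t] by simp
  obtain D where D: "\<And>t. \<bar>partial_deriv 1 \<phi> t\<bar> \<le> D" using test_function_bounded[OF tfd] by metis
  obtain D' where D': "\<And>t. \<bar>\<phi> t\<bar> \<le> D'" using test_function_bounded[OF tf] by metis
  have \<phi>m [measurable]: "\<phi> \<in> borel_measurable borel" "partial_deriv 1 \<phi> \<in> borel_measurable borel"
    using tf tfd by (auto intro: test_function_measurable)
  have d0: "partial_deriv 1 \<phi> t = 0" if "t \<notin> {c..c'}" for t
    by (rule partial_deriv_zero_outside[of "{c..c'}"]) (use supp that in auto)
  have lim: "(\<lambda>k. LINT t|lborel. ?Z t * ((\<phi> (t + h k) - \<phi> t) / h k)) \<longlonglongrightarrow> (LINT t|lborel. ?Z t * partial_deriv 1 \<phi> t)"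
  proof (rule tendsto_integral_local[OF _ _ _ _ coS, where C = C and D = D])
    show "(\<lambda>k. (\<phi> (t + h k) - \<phi> t) / h k) \<longlonglongrightarrow> partial_deriv 1 \<phi> t" for t
    proof (rule filterlim_compose[OF DERIV_D[OF der]])
      show "filterlim h (at 0) sequentially" using h0 h(1) by (intro filterlim_atI) (auto simp: less_imp_neq[symmetric])
    qed
    have "\<bar>(\<phi> (t + h k) - \<phi> t) / h k\<bar> \<le> D" for k t
    proof -
      obtain s where "\<phi> (t + h k) - \<phi> t = (t + h k - t) * partial_deriv 1 \<phi> s"
        using MVT2[of t "t + h k" \<phi> "partial_deriv 1 \<phi>"] der h(1)[of k] by auto
      then have "(\<phi> (t + h k) - \<phi> t) / h k = partial_deriv 1 \<phi> s" using h(1)[of k] by simp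
      then show ?thesis using D by simp
    qed
    moreover have "(\<phi> (t + h k) - \<phi> t) / h k = 0" if "t \<notin> ?S" for k t
      using supp[of t] supp[of "t + h k"] that h[of k] by auto
    ultimately show "\<forall>\<^sub>F k in sequentially. \<forall>t. \<bar>(\<phi> (t + h k) - \<phi> t) / h k\<bar> \<le> D \<and> (t \<notin> ?S \<longrightarrow> (\<phi> (t + h k) - \<phi> t) / h k = 0)"
      by auto
    show "\<forall>\<^sub>F k in sequentially. AE t in lborel. t \<in> ?S \<longrightarrow> \<bar>?Z t\<bar> \<le> C" using C by auto
  qed auto
  have "0 \<le> (LINT t|lborel. ?Z t * ((\<phi> (t + h k) - \<phi> t) / h k))" for k
  proof -
    have Zb: "\<bar>?Z t\<bar> \<le> \<bar>C\<bar>" for t using C by (cases "t \<in> ?S") force+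
    have sup0: "\<phi> t = 0" if "t \<notin> ?S" for t by (rule supp) (use that \<delta> in auto)
    have iZ: "integrable lborel (\<lambda>t. ?Z (t - h k) * \<phi> t)"
    proof (rule integrable_local_mult[OF _ \<phi>m(1) coS _ D' sup0])
      show "(\<lambda>t. ?Z (t - h k)) \<in> borel_measurable borel" by measurable
      show "\<bar>?Z (t - h k)\<bar> \<le> \<bar>C\<bar>" for t by (rule Zb)
    qed
    have iZ': "integrable lborel (\<lambda>t. ?Z t * \<phi> t)"
    proof (rule integrable_local_mult[OF _ \<phi>m(1) coS _ D' sup0])
      show "(\<lambda>t. ?Z t) \<in> borel_measurable borel" by measurable
      show "\<bar>?Z t\<bar> \<le> \<bar>C\<bar>" for t by (rule Zb)
    qed
    have iZ'': "integrable lborel (\<lambda>t. ?Z t * \<phi> (t + h k))"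
      using lborel_integrable_translate[OF iZ, of "h k"] by (simp add: add.commute)
    have "0 \<le> (LINT t|lborel. ?Z (t - h k) * \<phi> t - ?Z t * \<phi> t)"
    proof (rule integral_nonneg_AE, rule AE_I2)
      fix t
      show "0 \<le> ?Z (t - h k) * \<phi> t - ?Z t * \<phi> t"
      proof (cases "t \<in> {c..c'}")
        case True
        then have "t \<in> ?S" "t - h k \<in> ?S" using h[of k] \<delta> by auto
        then have "?Z t \<le> ?Z (t - h k)" using anti[of "t - h k" t] \<delta> h[of k] by auto
        from mult_right_mono[OF this nn[of t]] show ?thesis by simp
      qed (use supp in simp)
    qed
    also have "\<dots> = (LINT t|lborel. ?Z (t - h k) * \<phi> t) - (LINT t|lborel. ?Z t * \<phi> t)"
      by (rule Bochner_Integration.integral_diff[OF iZ iZ'])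
    also have "(LINT t|lborel. ?Z (t - h k) * \<phi> t) = (LINT t|lborel. ?Z t * \<phi> (t + h k))"
      using lborel_integral_shift[of "\<lambda>t. ?Z (t - h k) * \<phi> t" "h k"] by (simp add: add.commute)
    also have "(LINT t|lborel. ?Z t * \<phi> (t + h k)) - (LINT t|lborel. ?Z t * \<phi> t) = (LINT t|lborel. ?Z t * \<phi> (t + h k) - ?Z t * \<phi> t)"
      by (rule Bochner_Integration.integral_diff[OF iZ'' iZ', symmetric])
    finally have "0 \<le> (LINT t|lborel. ?Z t * \<phi> (t + h k) - ?Z t * \<phi> t) / h k" using h(1)[of k] by simp
    also have "\<dots> = (LINT t|lborel. ?Z t * ((\<phi> (t + h k) - \<phi> t) / h k))"
      by (subst integral_divide_zero[symmetric]) (simp add: right_diff_distrib diff_divide_distrib)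
    finally show ?thesis .
  qed
  then have "0 \<le> (LINT t|lborel. ?Z t * partial_deriv 1 \<phi> t)" by (intro LIMSEQ_le_const[OF lim]) auto
  moreover have eq: "indicator {a<..<b} t * (Z t * partial_deriv 1 \<phi> t) = ?Z t * partial_deriv 1 \<phi> t" for t
    using d0[of t] subS sub \<delta> c by (cases "t \<in> {c..c'}") (auto split: split_indicator)
  ultimately show ?thesis
    by (subst integral_lebesgue_on_borel) (auto simp: eq)
qed

lemma antimono_weak_deriv_nonpos:
  fixes Z d :: "real \<Rightarrow> real"
  assumes wd: "has_weak_deriv 1 {a<..<b} Z d" and Z: "continuous_on {\<alpha><..<\<beta>} Z"
    and anti: "\<And>s t. \<alpha> < s \<Longrightarrow> s \<le> t \<Longrightarrow> t < \<beta> \<Longrightarrow> Z t \<le> Z s" and sub: "a \<le> \<alpha>" "\<beta> \<le> b"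
  shows "AE t in lborel. t \<in> {\<alpha><..<\<beta>} \<longrightarrow> d t \<le> 0"
proof -
  have "AE t in lborel. t \<in> {\<alpha> + inverse (real (Suc m))<..<\<beta> - inverse (real (Suc m))} \<longrightarrow> d t \<le> 0" for m
  proof (cases "\<alpha> + inverse (real (Suc m)) < \<beta> - inverse (real (Suc m))")
    case True
    let ?c = "\<alpha> + inverse (real (Suc m))" and ?c' = "\<beta> - inverse (real (Suc m))"
    have pos: "0 < inverse (real (Suc m))" by simp
    show ?thesis
    proof (rule nonpos_of_test_functions)
      show "L1_loc {a<..<b} d" using wd by (simp add: has_weak_deriv_def)
      show "a < ?c" "?c < ?c'" "?c' < b" using True sub pos by (linarith | simp)+
      fix p :: "real \<Rightarrow> real" assume p: "real_polynomial_function p"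
      let ?\<phi> = "\<lambda>t. (p t)\<^sup>2 * bump ?c ?c' t"
      have tf: "test_function {a<..<b} ?\<phi>"
        by (rule test_function_bump[OF p]) (use True sub pos in linarith)+
      have "0 \<le> (LINT t|lebesgue_on {a<..<b}. Z t * partial_deriv 1 ?\<phi> t)"
        by (rule antimono_weak_deriv_test[OF Z anti sub _ True _ tf])
           (use pos bump_nonneg bump_zero[OF True] in auto)
      also have "\<dots> = - (LINT t|lebesgue_on {a<..<b}. d t * ?\<phi> t)" using wd tf by (simp add: has_weak_deriv_def)
      finally show "(LINT t|lebesgue_on {a<..<b}. d t * ?\<phi> t) \<le> 0" by simp
    qed
  qed simp
  then have "AE t in lborel. \<forall>m. t \<in> {\<alpha> + inverse (real (Suc m))<..<\<beta> - inverse (real (Suc m))} \<longrightarrow> d t \<le> 0"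
    by (simp only: AE_all_countable) simp
  then show ?thesis
  proof eventually_elim
    case (elim t)
    show ?case
    proof
      assume t: "t \<in> {\<alpha><..<\<beta>}"
      then have "0 < min (t - \<alpha>) (\<beta> - t)" by simp
      then obtain m where "inverse (real (Suc m)) < min (t - \<alpha>) (\<beta> - t)" using reals_Archimedean by blast
      then have "t \<in> {\<alpha> + inverse (real (Suc m))<..<\<beta> - inverse (real (Suc m))}" by auto
      then show "d t \<le> 0" using elim by blast
    qed
  qed
qed

lemma has_weak_deriv_uminus:
  assumes "has_weak_deriv b \<Omega> Z d" shows "has_weak_deriv b \<Omega> (\<lambda>t. - Z t) (\<lambda>t. - d t)"
  using assms unfolding has_weak_deriv_def L1_loc_def by simp

text \<open>Convergence points are dense near s and near t, and continuity keeps the values at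
  nearby points separated; the monotonicity of the F k at two such points gives a
  contradiction.\<close>

lemma antimono_of_AE_limit:
  fixes Z :: "real \<Rightarrow> real"
  assumes lim: "AE t in lborel. t \<in> {\<alpha><..<\<beta>} \<longrightarrow> (\<lambda>k. F k t) \<longlonglongrightarrow> Z t" and Z: "continuous_on {\<alpha><..<\<beta>} Z"
    and anti: "\<forall>\<^sub>F k in sequentially. \<forall>s t. \<alpha> < s \<longrightarrow> s \<le> t \<longrightarrow> t < \<beta> \<longrightarrow> F k t \<le> F k s"
    and st: "\<alpha> < s" "s \<le> t" "t < \<beta>"
  shows "Z t \<le> Z s"
proof (rule ccontr)
  assume n: "\<not> Z t \<le> Z s"
  then have "s < t" using st(2) by (cases "s = t") auto
  \<comment> \<open>\<theta> separates the two values and \<mu> the two times, so that the nearby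
    points keep both orders.\<close>
  define \<theta> where "\<theta> = (Z s + Z t) / 2"
  have \<theta>: "Z s < \<theta>" "\<theta> < Z t" using n by (auto simp: \<theta>_def)
  define \<mu> where "\<mu> = (s + t) / 2"
  have "\<exists>s'. s' \<in> {\<alpha><..<\<mu>} \<and> Z s' < \<theta> \<and> (\<lambda>k. F k s') \<longlonglongrightarrow> Z s'"
  proof -
    have opn: "open ({\<alpha><..<\<mu>} \<inter> Z -` {..<\<theta>})"
      by (intro continuous_open_preimage[OF continuous_on_subset[OF Z]]) (use \<open>s < t\<close> st in \<open>auto simp: \<mu>_def\<close>)
    have "AE x in lborel. x \<in> {\<alpha><..<\<mu>} \<inter> Z -` {..<\<theta>} \<longrightarrow> (\<lambda>k. F k x) \<longlonglongrightarrow> Z x"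
      using lim by eventually_elim (use \<open>s < t\<close> st in \<open>auto simp: \<mu>_def\<close>)
    moreover have "s \<in> {\<alpha><..<\<mu>} \<inter> Z -` {..<\<theta>}" using \<theta> \<open>s < t\<close> st by (simp add: \<mu>_def)
    ultimately show ?thesis using AE_open_dense[OF _ opn] by fast
  qed
  then obtain s' where s': "s' \<in> {\<alpha><..<\<mu>}" "Z s' < \<theta>" "(\<lambda>k. F k s') \<longlonglongrightarrow> Z s'" by blast
  have "\<exists>t'. t' \<in> {\<mu><..<\<beta>} \<and> \<theta> < Z t' \<and> (\<lambda>k. F k t') \<longlonglongrightarrow> Z t'"
  proof -
    have opn: "open ({\<mu><..<\<beta>} \<inter> Z -` {\<theta><..})"
      by (intro continuous_open_preimage[OF continuous_on_subset[OF Z]]) (use \<open>s < t\<close> st in \<open>auto simp: \<mu>_def\<close>)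
    have "AE x in lborel. x \<in> {\<mu><..<\<beta>} \<inter> Z -` {\<theta><..} \<longrightarrow> (\<lambda>k. F k x) \<longlonglongrightarrow> Z x"
      using lim by eventually_elim (use \<open>s < t\<close> st in \<open>auto simp: \<mu>_def\<close>)
    moreover have "t \<in> {\<mu><..<\<beta>} \<inter> Z -` {\<theta><..}" using \<theta> \<open>s < t\<close> st by (simp add: \<mu>_def)
    ultimately show ?thesis using AE_open_dense[OF _ opn] by fast
  qed
  then obtain t' where t': "t' \<in> {\<mu><..<\<beta>}" "\<theta> < Z t'" "(\<lambda>k. F k t') \<longlonglongrightarrow> Z t'" by blast
  have "\<forall>\<^sub>F k in sequentially. F k t' \<le> F k s'" using anti by eventually_elim (use s' t' in auto)
  then have "Z t' \<le> Z s'" by (rule tendsto_le[OF trivial_limit_sequentially s'(3) t'(3)])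
  with s' t' show False by linarith
qed

subsection \<open>The flow rule\<close>

lemma time_index_eqI:
  assumes "\<epsilon> > 0" "real n * \<epsilon>\<^sup>2 < t" "t < real (Suc n) * \<epsilon>\<^sup>2" shows "time_index \<epsilon> t = n"
proof -
  have "\<lfloor>t / \<epsilon>\<^sup>2\<rfloor> = int n" by (rule floor_unique) (use assms in \<open>auto simp: field_simps\<close>)
  then show ?thesis by (simp add: time_index_def)
qed

lemma time_index_bounds:
  assumes "\<epsilon> > 0" "t \<ge> 0" shows "real (time_index \<epsilon> t) * \<epsilon>\<^sup>2 \<le> t" "t < real (Suc (time_index \<epsilon> t)) * \<epsilon>\<^sup>2"
proof -
  have f: "real (time_index \<epsilon> t) = of_int \<lfloor>t / \<epsilon>\<^sup>2\<rfloor>" using assms by (simp add: time_index_def)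
  have "real (time_index \<epsilon> t) \<le> t / \<epsilon>\<^sup>2" "t / \<epsilon>\<^sup>2 < real (Suc (time_index \<epsilon> t))"
    unfolding of_nat_Suc f by linarith+
  then show "real (time_index \<epsilon> t) * \<epsilon>\<^sup>2 \<le> t" "t < real (Suc (time_index \<epsilon> t)) * \<epsilon>\<^sup>2"
    using assms(1) by (simp_all add: pos_le_divide_eq pos_divide_less_eq)
qed

context sharp_limit
begin

lemma xk_antimono: "s \<le> t \<Longrightarrow> xk k t \<le> xk k s"
  unfolding xi_eps_def time_index_def
  by (intro scheme_run.xs_antimono[OF run] nat_mono floor_mono divide_right_mono) auto

lemma \<xi>_cont_open: "0 \<le> \<alpha> \<Longrightarrow> \<beta> \<le> T \<Longrightarrow> continuous_on {\<alpha><..<\<beta>} \<xi>0"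
  by (rule continuous_on_subset[OF \<xi>_cont]) auto

lemma x_AE_open: "0 \<le> \<alpha> \<Longrightarrow> \<beta> \<le> T \<Longrightarrow> AE t in lborel. t \<in> {\<alpha><..<\<beta>} \<longrightarrow> (\<lambda>k. xk k t) \<longlonglongrightarrow> \<xi>0 t"
  using x_AE by eventually_elim auto

lemma \<xi>_deriv_nonpos:
  assumes "has_weak_deriv 1 {0<..<T} \<xi>0 d"
  shows "AE t in lborel. t \<in> {0<..<T} \<longrightarrow> d t \<le> 0"
proof (rule antimono_weak_deriv_nonpos[OF assms \<xi>_cont_open])
  show "\<xi>0 t \<le> \<xi>0 s" if "0 < s" "s \<le> t" "t < T" for s t
    by (rule antimono_of_AE_limit[OF x_AE_open \<xi>_cont_open _ that]) (simp_all add: xk_antimono)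
qed auto

text \<open>Right after a step that moves the interface, the discrete \<open>p\<close> has the value \<open>1\<close> at the
  interface, because the convolved sign function vanishes there. Hence the interface cannot
  move where \<^term>\<open>p0\<close> is below \<open>1\<close>. Since the discrete \<open>p\<close> converges only almost everywhere, its
  continuity in \<open>x\<close> and its constancy in \<open>t\<close> between two steps are used to evaluate it at a point.\<close>

lemma xk_constant:
  assumes \<eta>: "\<eta> > 0" and \<sigma>: "\<sigma> > 0" and \<rho>: "0 < t0 - \<rho>" "t0 + \<rho> < T"
    and p: "\<And>z. z \<in> {t0 - \<rho>..t0 + \<rho>} \<times> {x0 - \<sigma>..x0 + \<sigma>} \<Longrightarrow> p0 z < 1 - 2 * \<eta>"
    and near: "\<And>t. t \<in> {t0 - \<rho><..<t0 + \<rho>} \<Longrightarrow> \<bar>\<xi>0 t - x0\<bar> < \<sigma> / 2"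
    and pk: "AE z in lborel. z \<in> {t0 - \<rho>..t0 + \<rho>} \<times> {x0 - \<sigma>..x0 + \<sigma>} \<longrightarrow> \<bar>pk k z - p0 z\<bar> \<le> \<eta>"
    and xk: "AE t in lborel. t \<in> {0..T} \<longrightarrow> \<bar>xk k t - \<xi>0 t\<bar> \<le> \<sigma> / 4"
    and st: "t0 - \<rho> < s" "s \<le> t" "t < t0 + \<rho>"
  shows "xk k s = xk k t"
proof -
  let ?xs = "xi_seq (e k) u_ini \<xi>_ini" and ?ps = "p_seq (e k) u_ini \<xi>_ini"
  let ?n = "time_index (e k)"
  have pos: "0 < (e k)\<^sup>2" using e_pos[of k] by simp
  have st0: "0 \<le> s" "0 \<le> t" using st \<rho> by auto
  have "?n s \<le> ?n t" unfolding time_index_def using st by (intro nat_mono floor_mono divide_right_mono) auto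
  have step: "?xs (Suc j) = ?xs j" if j: "?n s \<le> j" "j < ?n t" for j
  proof (rule ccontr)
    assume "?xs (Suc j) \<noteq> ?xs j"
    then have one: "?ps (Suc j) (?xs (Suc j)) = 1" by (rule scheme_run.ps_at_moved_interface[OF run])
    \<comment> \<open>The time at which the index becomes j + 1; the interval from a to b lies
      within that step and inside the time window.\<close>
    define a where "a = real (Suc j) * (e k)\<^sup>2"
    have "s < a"
    proof -
      have "s < real (Suc (?n s)) * (e k)\<^sup>2" by (rule time_index_bounds[OF e_pos st0(1)])
      also have "\<dots> \<le> a" unfolding a_def using j pos by (intro mult_right_mono) auto
      finally show ?thesis .
    qed
    have "a \<le> t"
    proof -
      have "a \<le> real (?n t) * (e k)\<^sup>2" unfolding a_def using j pos by (intro mult_right_mono) auto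
      also have "\<dots> \<le> t" by (rule time_index_bounds[OF e_pos st0(2)])
      finally show ?thesis .
    qed
    define b where "b = min (a + (e k)\<^sup>2) (t0 + \<rho>)"
    have ab: "a < b" using pos \<open>a \<le> t\<close> st by (simp add: b_def)
    have idx: "?n t' = Suc j" if "t' \<in> {a<..<b}" for t'
    proof (rule time_index_eqI[OF e_pos])
      show "real (Suc j) * (e k)\<^sup>2 < t'" using that by (simp add: a_def)
      have "t' < a + (e k)\<^sup>2" using that by (simp add: b_def)
      then show "t' < real (Suc (Suc j)) * (e k)\<^sup>2" by (simp add: a_def algebra_simps)
    qed
    have sub: "t' \<in> {t0 - \<rho><..<t0 + \<rho>}" if "t' \<in> {a<..<b}" for t'
      using that \<open>s < a\<close> st by (auto simp: b_def)
    \<comment> \<open>One time with error at most \<sigma>/4 is enough, as \<open>xk k\<close> is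
      constant on this interval. Together with the \<sigma>/2 from \<open>near\<close> it places the
      new interface within \<sigma> of x0.\<close>
    have "AE t' in lborel. t' \<in> {a<..<b} \<longrightarrow> \<bar>xk k t' - \<xi>0 t'\<bar> \<le> \<sigma> / 4"
      using xk by eventually_elim (use sub \<rho> in force)
    from AE_open_dense[OF this] obtain t' where t': "t' \<in> {a<..<b}" "\<bar>xk k t' - \<xi>0 t'\<bar> \<le> \<sigma> / 4"
      using ab by auto
    have "xk k t' = ?xs (Suc j)" by (simp add: xi_eps_def idx[OF t'(1)])
    then have close: "?xs (Suc j) \<in> {x0 - \<sigma><..<x0 + \<sigma>}"
      using t'(2) near[OF sub[OF t'(1)]] \<sigma> by (auto simp: abs_if split: if_splits)
    \<comment> \<open>By continuity in x, the value 1 at the new interface keeps the discrete p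
      above 1 - \<eta> nearby, whereas p0 < 1 - 2\<eta> and the distance \<eta> keep it below 1 -
      \<eta> almost everywhere in the box.\<close>
    let ?B = "{x0 - \<sigma><..<x0 + \<sigma>} \<inter> ?ps (Suc j) -` {1 - \<eta><..}"
    have "open ?B"
      by (intro continuous_open_preimage continuous_on_subset[OF scheme_run.continuous_ps[OF run]]) auto
    then have op: "open ({a<..<b} \<times> ?B)" by (intro open_Times) auto
    have ne: "{a<..<b} \<times> ?B \<noteq> {}" using ab close one \<eta> by auto
    have "AE z in lborel. z \<in> {a<..<b} \<times> ?B \<longrightarrow> pk k z < 1 - \<eta>"
      using pk
    proof eventually_elim
      case (elim z)
      show ?case
      proof
        assume z: "z \<in> {a<..<b} \<times> ?B"
        then have "z \<in> {t0 - \<rho>..t0 + \<rho>} \<times> {x0 - \<sigma>..x0 + \<sigma>}" using sub[of "fst z"] by auto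
        then show "pk k z < 1 - \<eta>" using elim p[of z] by (auto simp: abs_if split: if_splits)
      qed
    qed
    from AE_open_dense[OF this op ne] obtain z where z: "z \<in> {a<..<b} \<times> ?B" "pk k z < 1 - \<eta>" by blast
    have "pk k z = ?ps (Suc j) (snd z)"
      unfolding scheme_run.pe_eq[OF run] using z(1) by (auto simp: idx)
    then show False using z by auto
  qed
  have "j \<le> ?n t \<longrightarrow> ?xs j = ?xs (?n s)" if "?n s \<le> j" for j
    using that by (induction j rule: dec_induct) (auto simp: step)
  from this[OF \<open>?n s \<le> ?n t\<close>] show ?thesis by (simp add: xi_eps_def)
qed

lemma \<xi>_locally_constant:
  assumes t0: "t0 \<in> {0<..<T}" and lt: "p0 (t0, \<xi>0 t0) < 1"
  shows "\<exists>\<rho>>0. 0 < t0 - \<rho> \<and> t0 + \<rho> < T \<and> (\<forall>s t. t0 - \<rho> < s \<longrightarrow> s \<le> t \<longrightarrow> t < t0 + \<rho> \<longrightarrow> \<xi>0 s = \<xi>0 t)"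
proof -
  define x0 where "x0 = \<xi>0 t0"
  \<comment> \<open>A third of the gap: p0 equals 1 - 3\<eta> at the centre, so it stays below 1 -
    2\<eta> nearby and its approximations below 1 - \<eta>.\<close>
  define \<eta> where "\<eta> = (1 - p0 (t0, x0)) / 3"
  have \<eta>: "\<eta> > 0" using lt by (simp add: \<eta>_def x0_def)
  obtain U where U: "open U" "U \<inter> strip = {z \<in> strip. p0 z \<in> {..<1 - 2 * \<eta>}}"
    by (rule strip_open_preimage[OF p_cont open_lessThan])
  have "p0 (t0, x0) < 1 - 2 * \<eta>" using \<eta> by (simp add: \<eta>_def field_simps)
  then have "(t0, x0) \<in> U \<inter> strip" unfolding U using t0 by auto
  then have "(t0, x0) \<in> U" by blast
  then obtain A B where AB: "open A" "open B" "t0 \<in> A" "x0 \<in> B" "A \<times> B \<subseteq> U"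
    using U(1) by (metis mem_Sigma_iff open_prod_elim)
  obtain r1 where r1: "r1 > 0" "ball t0 r1 \<subseteq> A" using AB(1,3) by (meson openE)
  obtain r2 where r2: "r2 > 0" "ball x0 r2 \<subseteq> B" using AB(2,4) by (meson openE)
  define \<sigma> where "\<sigma> = r2 / 2"
  have \<sigma>: "\<sigma> > 0" using r2 by (simp add: \<sigma>_def)
  have "isCont \<xi>0 t0" using \<xi>_cont_open[of 0 T] t0 by (auto simp: continuous_on_eq_continuous_at)
  then obtain r3 where r3: "r3 > 0" "\<And>t. \<bar>t - t0\<bar> < r3 \<Longrightarrow> \<bar>\<xi>0 t - x0\<bar> < \<sigma> / 2"
    using \<sigma> unfolding continuous_at_eps_delta x0_def dist_real_def by (metis half_gt_zero)
  define \<rho> where "\<rho> = Min {r1, r3, t0, T - t0} / 2"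
  have "\<rho> > 0" "\<rho> < r1" "\<rho> < r3" "\<rho> < t0" "\<rho> < T - t0"
    using r1(1) r3(1) t0 by (auto simp: \<rho>_def min_def field_simps)
  then have \<rho>: "\<rho> > 0" "\<rho> < r1" "\<rho> < r3" "0 < t0 - \<rho>" "t0 + \<rho> < T" by auto
  let ?K = "{t0 - \<rho>..t0 + \<rho>} \<times> {x0 - \<sigma>..x0 + \<sigma>}"
  have coK: "compact ?K" and subK: "?K \<subseteq> strip" using \<rho> by (auto intro!: compact_Times)
  have p: "p0 z < 1 - 2 * \<eta>" if z: "z \<in> ?K" for z
  proof -
    have "fst z \<in> ball t0 r1" "snd z \<in> ball x0 r2" using z \<rho> r2 by (auto simp: dist_real_def \<sigma>_def)
    then have "z \<in> U" using AB(5) r1(2) r2(2) by (metis mem_Sigma_iff prod.collapse subsetD)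
    then have "z \<in> U \<inter> strip" using z subK by blast
    then show ?thesis unfolding U by auto
  qed
  have near: "\<bar>\<xi>0 t - x0\<bar> < \<sigma> / 2" if "t \<in> {t0 - \<rho><..<t0 + \<rho>}" for t
    by (rule r3(2)) (use that \<rho> in \<open>auto simp: abs_if\<close>)
  have ev1: "\<forall>\<^sub>F k in sequentially. AE z in lborel. z \<in> ?K \<longrightarrow> \<bar>pk k z - p0 z\<bar> \<le> \<eta>"
    using Linf_tendsto_bound[OF p_lim[OF coK subK] \<eta>]
    by (subst (asm) AE_lebesgue_on_iff) (use coK in \<open>auto intro: borel_closed compact_imp_closed\<close>)
  have "0 < \<sigma> / 4" using \<sigma> by simp
  from Linf_tendsto_bound[OF \<xi>_lim this]
  have ev2: "\<forall>\<^sub>F k in sequentially. AE t in lborel. t \<in> {0..T} \<longrightarrow> \<bar>xk k t - \<xi>0 t\<bar> \<le> \<sigma> / 4"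
    by (subst (asm) AE_lebesgue_on_iff) auto
  from ev1 ev2 have const: "\<forall>\<^sub>F k in sequentially. \<forall>s t. t0 - \<rho> < s \<longrightarrow> s \<le> t \<longrightarrow> t < t0 + \<rho> \<longrightarrow> xk k s = xk k t"
  proof eventually_elim
    case (elim k)
    show ?case using xk_constant[OF \<eta> \<sigma> \<rho>(4,5) p near elim] by blast
  qed
  have lim: "AE t in lborel. t \<in> {t0 - \<rho><..<t0 + \<rho>} \<longrightarrow> (\<lambda>k. xk k t) \<longlonglongrightarrow> \<xi>0 t" by (rule x_AE_open) (use \<rho> in auto)
  then have lim': "AE t in lborel. t \<in> {t0 - \<rho><..<t0 + \<rho>} \<longrightarrow> (\<lambda>k. - xk k t) \<longlonglongrightarrow> - \<xi>0 t"
    by eventually_elim (auto intro: tendsto_minus)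
  have cont: "continuous_on {t0 - \<rho><..<t0 + \<rho>} \<xi>0" by (rule \<xi>_cont_open) (use \<rho> in auto)
  \<comment> \<open>Constancy passes to the limit as monotonicity of both \<open>xk k\<close> and
    its negative.\<close>
  have "\<xi>0 s = \<xi>0 t" if st: "t0 - \<rho> < s" "s \<le> t" "t < t0 + \<rho>" for s t
  proof (rule antisym)
    have "- \<xi>0 t \<le> - \<xi>0 s"
      by (rule antimono_of_AE_limit[OF lim' continuous_on_minus[OF cont] _ st]) (use const in \<open>eventually_elim, auto\<close>)
    then show "\<xi>0 s \<le> \<xi>0 t" by simp
    show "\<xi>0 t \<le> \<xi>0 s"
      by (rule antimono_of_AE_limit[OF lim cont _ st]) (use const in \<open>eventually_elim, auto\<close>)
  qed
  then show ?thesis using \<rho> by blast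
qed

text \<open>Local constancy makes the weak derivative both nonpositive and nonnegative on an
  interval, up to a null set that depends on the interval. Rational end points leave countably many
  intervals, which still cover all interior times with p0 < 1 at the interface.\<close>

lemma \<xi>_deriv_zero:
  assumes wd: "has_weak_deriv 1 {0<..<T} \<xi>0 d"
  shows "AE t in lborel. t \<in> {0<..<T} \<longrightarrow> p0 (t, \<xi>0 t) < 1 \<longrightarrow> d t = 0"
proof -
  let ?C = "\<lambda>\<alpha> \<beta>. 0 \<le> \<alpha> \<and> \<beta> \<le> T \<and> (\<forall>s t. \<alpha> < s \<longrightarrow> s \<le> t \<longrightarrow> t < \<beta> \<longrightarrow> \<xi>0 s = \<xi>0 t)"
  have "AE t in lborel. ?C \<alpha> \<beta> \<longrightarrow> t \<in> {\<alpha><..<\<beta>} \<longrightarrow> d t = 0" for \<alpha> \<beta>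
  proof (cases "?C \<alpha> \<beta>")
    case True
    then have sub: "0 \<le> \<alpha>" "\<beta> \<le> T" and eq: "\<And>s t. \<alpha> < s \<Longrightarrow> s \<le> t \<Longrightarrow> t < \<beta> \<Longrightarrow> \<xi>0 s = \<xi>0 t" by blast+
    have 1: "AE t in lborel. t \<in> {\<alpha><..<\<beta>} \<longrightarrow> d t \<le> 0"
      by (rule antimono_weak_deriv_nonpos[OF wd \<xi>_cont_open[OF sub] _ sub]) (simp add: eq)
    have 2: "AE t in lborel. t \<in> {\<alpha><..<\<beta>} \<longrightarrow> - d t \<le> 0"
      by (rule antimono_weak_deriv_nonpos[OF has_weak_deriv_uminus[OF wd] continuous_on_minus[OF \<xi>_cont_open[OF sub]] _ sub]) (simp add: eq)
    from 1 2 show ?thesis by eventually_elim auto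
  qed auto
  then have "AE t in lborel. \<forall>(a::rat) (b::rat). ?C (of_rat a) (of_rat b) \<longrightarrow> t \<in> {of_rat a<..<of_rat b} \<longrightarrow> d t = 0"
    by (simp only: AE_all_countable) blast
  then show ?thesis
  proof eventually_elim
    case (elim t)
    show ?case
    proof (intro impI)
      assume "t \<in> {0<..<T}" "p0 (t, \<xi>0 t) < 1"
      from \<xi>_locally_constant[OF this] obtain \<rho> where \<rho>: "\<rho> > 0" "0 < t - \<rho>" "t + \<rho> < T"
        and eq: "\<And>s s'. t - \<rho> < s \<Longrightarrow> s \<le> s' \<Longrightarrow> s' < t + \<rho> \<Longrightarrow> \<xi>0 s = \<xi>0 s'" by blast
      obtain a where a: "t - \<rho> < of_rat a" "of_rat a < t" using of_rat_dense[of "t - \<rho>" t] \<rho> by auto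
      obtain b where b: "t < of_rat b" "of_rat b < t + \<rho>" using of_rat_dense[of t "t + \<rho>"] \<rho> by auto
      have "?C (of_rat a) (of_rat b)"
      proof (intro conjI allI impI)
        show "0 \<le> (of_rat a :: real)" "of_rat b \<le> T" using a b \<rho> by linarith+
        show "\<xi>0 s = \<xi>0 s'" if "of_rat a < s" "s \<le> s'" "s' < of_rat b" for s s'
          by (rule eq) (use a b that in linarith)+
      qed
      then show "d t = 0" using elim a b by auto
    qed
  qed
qed

lemma flow_rule:
  assumes wd: "has_weak_deriv 1 {0<..<T} \<xi>0 d"
  shows "(AE t in lebesgue_on {0..T}. d t \<le> 0) \<and> (AE t in lebesgue_on {0..T}. p0 (t, \<xi>0 t) < 1 \<longrightarrow> d t = 0)"
proof -
  have "AE t in lborel. t \<noteq> 0 \<and> t \<noteq> T" using AE_lborel_singleton[of 0] AE_lborel_singleton[of T] by eventually_elim simp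
  then have "AE t in lborel. t \<in> {0..T} \<longrightarrow> t \<in> {0<..<T}" by eventually_elim auto
  then have "AE t in lborel. t \<in> {0..T} \<longrightarrow> d t \<le> 0" "AE t in lborel. t \<in> {0..T} \<longrightarrow> p0 (t, \<xi>0 t) < 1 \<longrightarrow> d t = 0"
    using \<xi>_deriv_nonpos[OF wd] \<xi>_deriv_zero[OF wd] by (eventually_elim, blast)+
  then show ?thesis by (simp add: AE_lebesgue_on_iff)
qed

end

subsection \<open>Weak limits in \<open>L\<^sup>2\<close>\<close>

lemma L2_mult:
  fixes a b :: "'a \<Rightarrow> real"
  assumes "a \<in> borel_measurable M" "b \<in> borel_measurable M" "integrable M (\<lambda>x. (a x)\<^sup>2)" "integrable M (\<lambda>x. (b x)\<^sup>2)"
  shows "integrable M (\<lambda>x. a x * b x)"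
proof (rule Bochner_Integration.integrable_bound)
  show "integrable M (\<lambda>x. (a x)\<^sup>2 + (b x)\<^sup>2)" using assms by simp
  have "\<bar>a x * b x\<bar> \<le> (a x)\<^sup>2 + (b x)\<^sup>2" for x
  proof -
    have "0 \<le> (\<bar>a x\<bar> - \<bar>b x\<bar>)\<^sup>2" "0 \<le> \<bar>a x\<bar> * \<bar>b x\<bar>" by simp_all
    then have "2 * (\<bar>a x\<bar> * \<bar>b x\<bar>) \<le> (a x)\<^sup>2 + (b x)\<^sup>2" "0 \<le> \<bar>a x\<bar> * \<bar>b x\<bar>" by (simp_all add: power2_diff mult.assoc)
    then have "\<bar>a x\<bar> * \<bar>b x\<bar> \<le> (a x)\<^sup>2 + (b x)\<^sup>2" by linarith
    then show ?thesis by (simp add: abs_mult)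
  qed
  then show "AE x in M. norm (a x * b x) \<le> norm ((a x)\<^sup>2 + (b x)\<^sup>2)" by (auto intro: order_trans[OF _ abs_ge_self])
qed (use assms in measurable)

lemma L2_lin_comb:
  fixes a b :: "'a \<Rightarrow> real"
  assumes m: "a \<in> borel_measurable M" "b \<in> borel_measurable M" and i: "integrable M (\<lambda>x. (a x)\<^sup>2)" "integrable M (\<lambda>x. (b x)\<^sup>2)"
  shows "integrable M (\<lambda>x. (s * a x + t * b x)\<^sup>2)"
    and "(LINT x|M. (s * a x + t * b x)\<^sup>2) = s\<^sup>2 * (LINT x|M. (a x)\<^sup>2) + 2 * s * t * (LINT x|M. a x * b x) + t\<^sup>2 * (LINT x|M. (b x)\<^sup>2)"
proof -
  have e: "(s * a x + t * b x)\<^sup>2 = s\<^sup>2 * (a x)\<^sup>2 + 2 * s * t * (a x * b x) + t\<^sup>2 * (b x)\<^sup>2" for x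
    by (simp add: power2_eq_square algebra_simps)
  note ab = L2_mult[OF m i]
  show "integrable M (\<lambda>x. (s * a x + t * b x)\<^sup>2)" unfolding e using i ab by simp
  show "(LINT x|M. (s * a x + t * b x)\<^sup>2) = s\<^sup>2 * (LINT x|M. (a x)\<^sup>2) + 2 * s * t * (LINT x|M. a x * b x) + t\<^sup>2 * (LINT x|M. (b x)\<^sup>2)"
    unfolding e using i ab by simp
qed

text \<open>Only midpoints enter the parallelogram law, so closure under midpoints replaces the
  convex hull and keeps every induction to two terms.\<close>

inductive_set midpoint_hull :: "(nat \<Rightarrow> 'a \<Rightarrow> real) \<Rightarrow> nat \<Rightarrow> ('a \<Rightarrow> real) set" for V k where
  base: "k \<le> j \<Longrightarrow> V j \<in> midpoint_hull V k"
| mid: "a \<in> midpoint_hull V k \<Longrightarrow> b \<in> midpoint_hull V k \<Longrightarrow> (\<lambda>x. (1/2) * a x + (1/2) * b x) \<in> midpoint_hull V k"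

lemma midpoint_hull_mono: "k \<le> k' \<Longrightarrow> c \<in> midpoint_hull V k' \<Longrightarrow> c \<in> midpoint_hull V k"
  by (erule midpoint_hull.induct, rule midpoint_hull.base, erule (1) order_trans, rule midpoint_hull.mid)

lemma midpoint_hull_bounds:
  assumes V: "\<And>k. V k \<in> borel_measurable M" "\<And>k. integrable M (\<lambda>x. (V k x)\<^sup>2)" "\<And>k. (LINT x|M. (V k x)\<^sup>2) \<le> C"
    and "c \<in> midpoint_hull V k"
  shows "c \<in> borel_measurable M \<and> integrable M (\<lambda>x. (c x)\<^sup>2) \<and> (LINT x|M. (c x)\<^sup>2) \<le> C"
  using assms(4)
proof induction
  case (mid a b)
  then have m: "a \<in> borel_measurable M" "b \<in> borel_measurable M" and i: "integrable M (\<lambda>x. (a x)\<^sup>2)" "integrable M (\<lambda>x. (b x)\<^sup>2)"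
    and C: "(LINT x|M. (a x)\<^sup>2) \<le> C" "(LINT x|M. (b x)\<^sup>2) \<le> C" by auto
  have "0 \<le> (LINT x|M. (1 * a x + (- 1) * b x)\<^sup>2)" by simp
  then have "2 * (LINT x|M. a x * b x) \<le> (LINT x|M. (a x)\<^sup>2) + (LINT x|M. (b x)\<^sup>2)"
    unfolding L2_lin_comb(2)[OF m i] by simp
  then have "(LINT x|M. ((1/2) * a x + (1/2) * b x)\<^sup>2) \<le> C"
    unfolding L2_lin_comb(2)[OF m i] using C by (simp add: power2_eq_square)
  moreover have "(\<lambda>x. (1/2) * a x + (1/2) * b x) \<in> borel_measurable M" using m by measurable
  ultimately show ?case using L2_lin_comb(1)[OF m i, of "1/2" "1/2"] by (intro conjI)
qed (use V in auto)

text \<open>The pairing is linear and an interval around L is convex, so averaging cannot leave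
  it.\<close>

lemma midpoint_hull_functional:
  assumes V: "\<And>k. V k \<in> borel_measurable M" "\<And>k. integrable M (\<lambda>x. (V k x)\<^sup>2)" "\<And>k. (LINT x|M. (V k x)\<^sup>2) \<le> C"
    and \<phi>: "\<phi> \<in> borel_measurable M" "integrable M (\<lambda>x. (\<phi> x)\<^sup>2)"
    and near: "\<And>j. k \<le> j \<Longrightarrow> \<bar>(LINT x|M. V j x * \<phi> x) - L\<bar> \<le> r" and "c \<in> midpoint_hull V k"
  shows "\<bar>(LINT x|M. c x * \<phi> x) - L\<bar> \<le> r"
  using assms(7)
proof induction
  case (mid a b)
  have i: "integrable M (\<lambda>x. c x * \<phi> x)" if "c \<in> midpoint_hull V k" for c
    using midpoint_hull_bounds[OF V that] by (intro L2_mult \<phi>) auto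
  have "(LINT x|M. ((1/2) * a x + (1/2) * b x) * \<phi> x) = (LINT x|M. (1/2) * (a x * \<phi> x) + (1/2) * (b x * \<phi> x))"
    by (intro Bochner_Integration.integral_cong) (auto simp: algebra_simps)
  also have "\<dots> = (1/2) * (LINT x|M. a x * \<phi> x) + (1/2) * (LINT x|M. b x * \<phi> x)"
    using i[OF mid(1)] i[OF mid(2)] by simp
  finally show ?case using mid.IH by (simp add: abs_if split: if_splits)
qed (use near in auto)

text \<open>Weak sequential compactness of bounded sets in \<open>L\<^sup>2\<close>, in the form in which it is
  needed: elements of almost minimal norm in the convex hulls of the tails form a Cauchy
  sequence by the parallelogram law.\<close>

lemma L2_weak_limit:
  fixes V :: "nat \<Rightarrow> 'a \<Rightarrow> real"
  assumes V: "\<And>k. V k \<in> borel_measurable M" "\<And>k. integrable M (\<lambda>x. (V k x)\<^sup>2)" "\<And>k. (LINT x|M. (V k x)\<^sup>2) \<le> C"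
  obtains d where "d \<in> borel_measurable M" "integrable M (\<lambda>x. (d x)\<^sup>2)"
    "\<And>\<phi> L. \<phi> \<in> borel_measurable M \<Longrightarrow> integrable M (\<lambda>x. (\<phi> x)\<^sup>2) \<Longrightarrow> (\<lambda>k. LINT x|M. V k x * \<phi> x) \<longlonglongrightarrow> L \<Longrightarrow> (LINT x|M. d x * \<phi> x) = L"
proof -
  let ?H = "midpoint_hull V" and ?N = "\<lambda>c. LINT x|M. (c x)\<^sup>2"
  note hull = midpoint_hull_bounds[OF V]
  \<comment> \<open>Smaller hulls have larger infima, so m increases; the bound C makes it
    converge.\<close>
  define m where "m k = (INF c\<in>?H k. ?N c)" for k
  have ne: "?H k \<noteq> {}" for k using midpoint_hull.base[of k k V] by blast
  have bd: "bdd_below (?N ` ?H k)" for k by (intro bdd_belowI[of _ 0]) auto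
  have m_le: "m k \<le> ?N c" if "c \<in> ?H k" for k c unfolding m_def by (rule cINF_lower[OF bd that])
  have m_C: "m k \<le> C" for k using m_le[OF midpoint_hull.base[of k k]] V(3)[of k] by simp
  have m_mono: "m k \<le> m k'" if "k \<le> k'" for k k'
    unfolding m_def by (rule cINF_superset_mono[OF ne bd]) (use midpoint_hull_mono[OF that] in auto)
  have "incseq m" using m_mono by (simp add: incseq_def)
  then obtain l where l: "m \<longlonglongrightarrow> l" "\<And>k. m k \<le> l" using incseq_convergent[of m C] m_C by metis
  have "\<exists>c\<in>?H k. ?N c < m k + inverse (real (Suc k))" for k
    using cINF_less_iff[OF ne bd, of k "m k + inverse (real (Suc k))"] unfolding m_def[symmetric] by simp
  then obtain c where c: "\<And>k. c k \<in> ?H k" "\<And>k. ?N (c k) < m k + inverse (real (Suc k))" by metis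
  have cm: "c k \<in> borel_measurable M" "integrable M (\<lambda>x. (c k x)\<^sup>2)" for k using hull[OF c(1)] by auto
  \<comment> \<open>From the parallelogram law: twice both squared norms minus four times that of
    the midpoint, which is at least \<open>m k\<close>. The norms exceed \<open>m j\<close> and
    \<open>m k\<close> by at most 1 / (k + 1), and \<open>m j\<close> is at most l.\<close>
  define \<beta> where "\<beta> k = 2 * (l - m k) + 4 * inverse (real (Suc k))" for k
  have dist: "?N (\<lambda>x. c j x - c k x) \<le> \<beta> k" and dist_int: "integrable M (\<lambda>x. (c j x - c k x)\<^sup>2)" if "k \<le> j" for j k
  proof -
    note lc = L2_lin_comb[OF cm(1) cm(1) cm(2) cm(2), of _ j _ k]
    have "(\<lambda>x. (1/2) * c j x + (1/2) * c k x) \<in> ?H k"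
      by (intro midpoint_hull.mid c midpoint_hull_mono[OF that])
    from m_le[OF this] have e1: "m k \<le> (1/4) * ?N (c j) + (1/2) * (LINT x|M. c j x * c k x) + (1/4) * ?N (c k)"
      unfolding lc(2) by (simp add: power2_eq_square)
    have e2: "?N (\<lambda>x. c j x - c k x) = ?N (c j) - 2 * (LINT x|M. c j x * c k x) + ?N (c k)"
      using lc(2)[of 1 "- 1"] by simp
    have e3: "inverse (real (Suc j)) \<le> inverse (real (Suc k))" using that by simp
    show "?N (\<lambda>x. c j x - c k x) \<le> \<beta> k"
    proof -
      have arith: "n \<le> 2 * (l - mk) + 4 * b"
        if "mk \<le> 1/4 * x + 1/2 * i + 1/4 * y" "n = x - 2 * i + y" "a \<le> b" "x < mj + a" "y < mk + b" "mj \<le> l"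
        for n mk b x i y a mj :: real
        using that by argo
      show ?thesis unfolding \<beta>_def by (rule arith[OF e1 e2 e3 c(2) c(2) l(2)])
    qed
    show "integrable M (\<lambda>x. (c j x - c k x)\<^sup>2)" using lc(1)[of 1 "- 1"] by simp
  qed
  have \<beta>_lim: "\<beta> \<longlonglongrightarrow> 0"
  proof -
    have "\<beta> \<longlonglongrightarrow> 2 * (l - l) + 4 * 0"
      unfolding \<beta>_def[abs_def] by (intro tendsto_intros l LIMSEQ_inverse_real_of_nat)
    then show ?thesis by simp
  qed
  have \<beta>_anti: "\<beta> k' \<le> \<beta> k" if "k \<le> k'" for k k'
  proof -
    have "inverse (real (Suc k')) \<le> inverse (real (Suc k))" using that by simp
    then show ?thesis unfolding \<beta>_def by (intro add_mono mult_left_mono diff_left_mono m_mono that) auto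
  qed
  have "\<exists>K. \<beta> K < (1/8) ^ i" for i
    using order_tendstoD(2)[OF \<beta>_lim, of "(1/8) ^ i"] by (auto simp: eventually_sequentially)
  then obtain K where K: "\<And>i. \<beta> (K i) < (1/8) ^ i" by metis
  \<comment> \<open>The sum makes the index nondecreasing and at least \<open>K i\<close>; the
    summand i makes it at least i, so that \<open>u i\<close> belongs to the hull of every tail up
    to i.\<close>
  define r where "r i = (\<Sum>j\<le>i. K j) + i" for i
  have r: "K i \<le> r i" "i \<le> r i" for i
    using member_le_sum[of i "{..i}" K] by (auto simp: r_def)
  have r_mono: "r i \<le> r j" if "i \<le> j" for i j
    unfolding r_def by (intro add_mono sum_mono2 that) (use that in auto)
  have \<beta>r: "\<beta> (r i) < (1/8) ^ i" for i using \<beta>_anti[OF r(1)] K[of i] by (rule le_less_trans)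
  define u where "u i = c (r i)" for i
  have um [measurable]: "u i \<in> borel_measurable M" for i unfolding u_def by (rule cm)
  have u_dist: "?N (\<lambda>x. u j x - u i x) \<le> \<beta> (r i)" "integrable M (\<lambda>x. (u j x - u i x)\<^sup>2)" if "i \<le> j" for i j
    unfolding u_def using dist[OF r_mono[OF that]] dist_int[OF r_mono[OF that]] by auto
  have nn: "(\<integral>\<^sup>+x. ennreal ((u j x - u i x)\<^sup>2) \<partial>M) \<le> ennreal (\<beta> (r i))" if "i \<le> j" for i j
    using nn_integral_eq_integral[OF u_dist(2)[OF that]] u_dist(1)[OF that] by (simp add: ennreal_leI)
  have conv: "AE x in M. convergent (\<lambda>i. u i x)"
  proof -
    \<comment> \<open>The weights 2^i still leave the summable bound (1/4)^i. Almost everywhere the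
      series is finite, so the increments are O(2^(-i/2)) and the sequence converges.\<close>
    let ?g = "\<lambda>i x. ennreal (2 ^ i * (u (Suc i) x - u i x)\<^sup>2)"
    have "(\<integral>\<^sup>+x. (\<Sum>i. ?g i x) \<partial>M) = (\<Sum>i. \<integral>\<^sup>+x. ?g i x \<partial>M)"
      by (rule nn_integral_suminf) measurable
    also have "\<dots> \<le> (\<Sum>i. ennreal ((1/4) ^ i))"
    proof (intro suminf_le summableI)
      fix i
      have "(\<integral>\<^sup>+x. ?g i x \<partial>M) = ennreal (2 ^ i) * (\<integral>\<^sup>+x. ennreal ((u (Suc i) x - u i x)\<^sup>2) \<partial>M)"
        by (subst nn_integral_cmult[symmetric]) (auto simp: ennreal_mult)
      also have "\<dots> \<le> ennreal (2 ^ i) * ennreal ((1/8) ^ i)"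
        by (intro mult_left_mono order_trans[OF nn] ennreal_leI less_imp_le[OF \<beta>r]) auto
      also have "\<dots> = ennreal ((1/4) ^ i)" by (simp add: ennreal_mult[symmetric] power_mult_distrib[symmetric])
      finally show "(\<integral>\<^sup>+x. ?g i x \<partial>M) \<le> ennreal ((1/4) ^ i)" .
    qed
    also have "\<dots> = ennreal (\<Sum>i. (1/4) ^ i)" by (rule suminf_ennreal2) (auto intro: summable_geometric)
    also have "\<dots> < \<infinity>" by simp
    finally have "AE x in M. (\<Sum>i. ?g i x) \<noteq> \<infinity>"
      by (intro nn_integral_noteq_infinite) auto
    then show ?thesis
    proof eventually_elim
      case (elim x)
      have "\<exists>B\<ge>0. s = ennreal B" if "s \<noteq> \<infinity>" for s :: ennreal using that by (cases s) auto
      from this[OF elim] obtain B where "(\<Sum>i. ?g i x) = ennreal B" "B \<ge> 0" by (elim exE conjE)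
      then have "(\<Sum>i. ?g i x) < ennreal (B + 1)" by (simp add: ennreal_less_iff)
      then have lt: "?g i x < ennreal (B + 1)" for i by (rule ennreal_suminf_lessD)
      have bd: "2 ^ i * (u (Suc i) x - u i x)\<^sup>2 \<le> B + 1" for i
        by (rule less_imp_le, rule iffD1[OF ennreal_less_iff lt]) simp
      have le: "norm (u (Suc i) x - u i x) \<le> sqrt (B + 1) * (1 / sqrt 2) ^ i" for i
      proof -
        have "(u (Suc i) x - u i x)\<^sup>2 \<le> (B + 1) / 2 ^ i" using bd[of i] by (simp add: field_simps)
        also have "\<dots> = (sqrt (B + 1) * (1 / sqrt 2) ^ i)\<^sup>2"
          using \<open>B \<ge> 0\<close> by (simp add: power_mult_distrib power_divide power_mult[symmetric] mult.commute[of i] power_mult)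
        finally have "sqrt ((u (Suc i) x - u i x)\<^sup>2) \<le> sqrt ((sqrt (B + 1) * (1 / sqrt 2) ^ i)\<^sup>2)" by (rule real_sqrt_le_mono)
        then show ?thesis using \<open>B \<ge> 0\<close> by simp
      qed
      have "summable (\<lambda>i. sqrt (B + 1) * (1 / sqrt 2) ^ i)"
        by (intro summable_mult summable_geometric) (simp add: real_sqrt_gt_1_iff)
      then have "summable (\<lambda>i. u (Suc i) x - u i x)" by (rule summable_comparison_test'[where N = 0]) (rule le)
      then have "convergent (\<lambda>n. \<Sum>i<n. u (Suc i) x - u i x)" by (rule summable_iff_convergent[THEN iffD1])
      then have "convergent (\<lambda>n. u n x - u 0 x)" unfolding sum_lessThan_telescope[of "\<lambda>n. u n x"] .
      then show ?case by (simp add: convergent_diff_const_right_iff)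
    qed
  qed
  define d where "d x = lim (\<lambda>i. u i x)" for x
  have dm [measurable]: "d \<in> borel_measurable M" unfolding d_def[abs_def] by measurable
  have d_lim: "AE x in M. (\<lambda>i. u i x) \<longlonglongrightarrow> d x"
    using conv by eventually_elim (simp add: d_def convergent_LIMSEQ_iff)
  \<comment> \<open>Fatou's lemma transfers the Cauchy estimate to the limit function.\<close>
  have d_nn: "(\<integral>\<^sup>+x. ennreal ((d x - u i x)\<^sup>2) \<partial>M) \<le> ennreal (\<beta> (r i))" for i
  proof -
    have "(\<integral>\<^sup>+x. ennreal ((d x - u i x)\<^sup>2) \<partial>M) = (\<integral>\<^sup>+x. liminf (\<lambda>j. ennreal ((u j x - u i x)\<^sup>2)) \<partial>M)"
    proof (rule nn_integral_cong_AE)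
      show "AE x in M. ennreal ((d x - u i x)\<^sup>2) = liminf (\<lambda>j. ennreal ((u j x - u i x)\<^sup>2))"
        using d_lim
      proof eventually_elim
        case (elim x)
        have "(\<lambda>j. ennreal ((u j x - u i x)\<^sup>2)) \<longlonglongrightarrow> ennreal ((d x - u i x)\<^sup>2)" by (intro tendsto_intros elim)
        then show ?case by (rule lim_imp_Liminf[OF trivial_limit_sequentially, symmetric])
      qed
    qed
    also have "\<dots> \<le> liminf (\<lambda>j. \<integral>\<^sup>+x. ennreal ((u j x - u i x)\<^sup>2) \<partial>M)" by (rule nn_integral_liminf) measurable
    also have "\<dots> \<le> ennreal (\<beta> (r i))"
      by (rule Liminf_le) (auto simp: eventually_sequentially intro!: exI[of _ i] nn)
    finally show ?thesis .
  qed
  have \<beta>0: "0 \<le> \<beta> k" for k using l(2)[of k] by (simp add: \<beta>_def)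
  have d_int: "integrable M (\<lambda>x. (d x - u i x)\<^sup>2)" for i
    by (rule integrableI_bounded) (use d_nn[of i] in \<open>auto intro: le_less_trans\<close>)
  have d_N: "(LINT x|M. (d x - u i x)\<^sup>2) \<le> \<beta> (r i)" for i
    using d_nn[of i] nn_integral_eq_integral[OF d_int[of i]] \<beta>0 by (simp add: ennreal_le_iff)
  have u2: "integrable M (\<lambda>x. (u i x)\<^sup>2)" for i unfolding u_def by (rule cm)
  have d2: "integrable M (\<lambda>x. (d x)\<^sup>2)"
    using L2_lin_comb(1)[OF _ um[of 0] d_int[of 0] u2[of 0], of 1 1] by simp
  have "(LINT x|M. d x * \<phi> x) = L"
    if \<phi>: "\<phi> \<in> borel_measurable M" "integrable M (\<lambda>x. (\<phi> x)\<^sup>2)" and lim: "(\<lambda>k. LINT x|M. V k x * \<phi> x) \<longlonglongrightarrow> L" for \<phi> L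
  proof -
    have uL: "(\<lambda>i. LINT x|M. u i x * \<phi> x) \<longlonglongrightarrow> L"
    proof (rule LIMSEQ_I)
      fix \<rho> :: real assume "0 < \<rho>"
      then have "0 < \<rho> / 2" by simp
      from LIMSEQ_D[OF lim this] obtain k where k: "\<And>j. k \<le> j \<Longrightarrow> \<bar>(LINT x|M. V j x * \<phi> x) - L\<bar> \<le> \<rho> / 2" by (auto intro: less_imp_le)
      have "\<bar>(LINT x|M. u i x * \<phi> x) - L\<bar> < \<rho>" if "k \<le> i" for i
      proof -
        have "u i \<in> ?H k" unfolding u_def by (rule midpoint_hull_mono[OF _ c(1)]) (use that r(2)[of i] in linarith)
        from midpoint_hull_functional[OF V \<phi> k this] show ?thesis using \<open>0 < \<rho>\<close> by linarith
      qed
      then show "\<exists>no. \<forall>n\<ge>no. norm ((LINT x|M. u n x * \<phi> x) - L) < \<rho>" by auto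
    qed
    have "(\<lambda>i. LINT x|M. u i x * \<phi> x) \<longlonglongrightarrow> (LINT x|M. d x * \<phi> x)"
    proof -
      let ?\<Phi> = "LINT x|M. (\<phi> x)\<^sup>2"
      have est: "\<bar>(LINT x|M. u i x * \<phi> x) - (LINT x|M. d x * \<phi> x)\<bar> \<le> sqrt (\<beta> (r i)) * sqrt ?\<Phi>" for i
      proof -
        let ?w = "\<lambda>x. d x - u i x"
        have wm: "?w \<in> borel_measurable M" by measurable
        have w: "integrable M (\<lambda>x. ?w x * \<phi> x)" by (rule L2_mult[OF wm \<phi>(1) d_int \<phi>(2)])
        have eq: "(LINT x|M. ?w x * \<phi> x) = (LINT x|M. d x * \<phi> x) - (LINT x|M. u i x * \<phi> x)"
          using L2_mult[OF dm \<phi>(1) d2 \<phi>(2)] L2_mult[OF um \<phi>(1) u2 \<phi>(2), of i] by (simp add: left_diff_distrib)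
        let ?W = "LINT x|M. (?w x)\<^sup>2" and ?I = "LINT x|M. ?w x * \<phi> x"
        have "?I\<^sup>2 \<le> ?W * ?\<Phi>"
        proof -
          \<comment> \<open>The Cauchy-Schwarz inequality: the integral of this square is
            \<open>?\<Phi>\<close> times \<open>?W * ?\<Phi> - ?I\<^sup>2\<close>, which settles the
            case of nonzero \<open>?\<Phi>\<close>.\<close>
          have "0 \<le> (LINT x|M. (?\<Phi> * ?w x + (- ?I) * \<phi> x)\<^sup>2)" by simp
          then have q: "0 \<le> ?\<Phi> * (?W * ?\<Phi> - ?I\<^sup>2)"
            unfolding L2_lin_comb(2)[OF wm \<phi>(1) d_int \<phi>(2)] by (simp add: power2_eq_square algebra_simps)
          show ?thesis
          proof (cases "?\<Phi> = 0")
            case True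
            then have "AE x in M. (\<phi> x)\<^sup>2 = 0" using integral_nonneg_eq_0_iff_AE[OF \<phi>(2)] by simp
            then have "?I = 0" by (intro integral_eq_zero_AE) auto
            then show ?thesis by simp
          next
            case False
            moreover have "0 \<le> ?\<Phi>" by (rule Bochner_Integration.integral_nonneg) simp
            ultimately have "0 < ?\<Phi>" by linarith
            with q show ?thesis by (simp add: zero_le_mult_iff)
          qed
        qed
        also have "\<dots> \<le> \<beta> (r i) * ?\<Phi>" by (intro mult_right_mono d_N) auto
        finally have "\<bar>?I\<bar> \<le> sqrt (\<beta> (r i) * ?\<Phi>)" by (metis real_sqrt_abs real_sqrt_le_mono)
        then show ?thesis using eq by (simp add: real_sqrt_mult)
      qed
      have "(\<lambda>i. \<beta> (r i)) \<longlonglongrightarrow> 0"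
        by (rule tendsto_sandwich[OF _ _ tendsto_const \<beta>_lim]) (use \<beta>0 \<beta>_anti[OF r(2)] in auto)
      then have "(\<lambda>i. sqrt (\<beta> (r i)) * sqrt ?\<Phi>) \<longlonglongrightarrow> sqrt 0 * sqrt ?\<Phi>" by (intro tendsto_intros)
      then have s0: "(\<lambda>i. sqrt (\<beta> (r i)) * sqrt ?\<Phi>) \<longlonglongrightarrow> 0" by simp
      have "(\<lambda>i. (LINT x|M. u i x * \<phi> x) - (LINT x|M. d x * \<phi> x)) \<longlonglongrightarrow> 0"
        by (rule Lim_null_comparison[OF _ s0]) (simp add: est)
      then show ?thesis by (rule Lim_null[THEN iffD2])
    qed
    from LIMSEQ_unique[OF this uL] show ?thesis .
  qed
  then show thesis using that[OF dm d2] by blast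
qed

subsection \<open>The spatial derivative of the fluctuations\<close>

context scheme_run
begin

lemma fe_locally_bounded:
  assumes "compact S" obtains C where "\<And>z. z \<in> S \<Longrightarrow> \<bar>fe z\<bar> \<le> C"
proof -
  from compact_imp_bounded[OF assms] obtain b where b: "\<And>z. z \<in> S \<Longrightarrow> norm z \<le> b" unfolding bounded_iff by blast
  have "\<exists>A\<ge>0. \<forall>x. \<bar>fs n x\<bar> \<le> A" for n using L1_boundedE[OF L1_bounded_fs[of n]] by metis
  then obtain A where A: "\<And>n. A n \<ge> 0" "\<And>n x. \<bar>fs n x\<bar> \<le> A n" by metis
  have "\<bar>fe z\<bar> \<le> (\<Sum>n\<le>time_index \<epsilon> b. A n)" if "z \<in> S" for z
  proof -
    have n: "\<bar>fst z\<bar> \<le> b" using b[OF that] norm_fst_le[of "fst z" "snd z"] by auto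
    then have "time_index \<epsilon> (fst z) \<le> time_index \<epsilon> b"
      unfolding time_index_def using eps by (intro nat_mono floor_mono divide_right_mono) auto
    then have "A (time_index \<epsilon> (fst z)) \<le> (\<Sum>n\<le>time_index \<epsilon> b. A n)"
      using A(1) by (intro member_le_sum) auto
    then show ?thesis unfolding fe_eq by (rule order_trans[OF A(2)])
  qed
  then show thesis by (rule that)
qed

definition dfe :: "real \<times> real \<Rightarrow> real" where
  "dfe z = dfs (time_index \<epsilon> (fst z)) (snd z)"

lemma dfe_measurable [measurable]: "dfe \<in> borel_measurable borel"
  unfolding dfe_def[abs_def] by (rule time_indexed_measurable) (rule dfs_measurable)

text \<open>The cut-off at \<^term>\<open>T - \<epsilon>\<^sup>2\<close> discards the last time interval, which may meet \<open>{0..T}\<close> in a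
  null set only, so that convergence almost everywhere gives no information on it.\<close>

lemma dfe_square_nn_integral:
  assumes T: "\<epsilon>\<^sup>2 \<le> T" and N: "Suc N = time_index \<epsilon> T"
    and M: "\<And>n x. n < N \<Longrightarrow> xs (Suc n) \<le> x \<Longrightarrow> x \<le> xs n \<Longrightarrow> fs n x \<le> M"
  shows "(\<integral>\<^sup>+z. ennreal ((indicator ({0..T - \<epsilon>\<^sup>2} \<times> UNIV) z * dfe z)\<^sup>2) \<partial>lborel) \<le> ennreal (2 * (M + 1) * (xs 0 - xs N))"
proof -
  let ?E = "\<lambda>n. LINT x|lborel. (dfs n x)\<^sup>2"
  let ?I = "\<lambda>n. {real n * \<epsilon>\<^sup>2..<real (Suc n) * \<epsilon>\<^sup>2}"
  have [measurable]: "(\<lambda>z. (indicator ({0..T - \<epsilon>\<^sup>2} \<times> UNIV) z * dfe z)\<^sup>2) \<in> borel_measurable borel"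
  proof -
    have "{0..T - \<epsilon>\<^sup>2} \<times> (UNIV :: real set) \<in> sets borel" by (intro borel_closed closed_Times) auto
    then show ?thesis by measurable
  qed
  have "(\<integral>\<^sup>+z. ennreal ((indicator ({0..T - \<epsilon>\<^sup>2} \<times> UNIV) z * dfe z)\<^sup>2) \<partial>lborel)
      = (\<integral>\<^sup>+t. \<integral>\<^sup>+x. ennreal ((indicator ({0..T - \<epsilon>\<^sup>2} \<times> UNIV) (t, x) * dfe (t, x))\<^sup>2) \<partial>lborel \<partial>lborel)"
    unfolding lborel_prod[symmetric] by (rule lborel.nn_integral_fst[symmetric]) (simp add: lborel_prod)
  also have "\<dots> \<le> (\<integral>\<^sup>+t. (\<Sum>n\<le>N. ennreal (?E n) * indicator (?I n) t) \<partial>lborel)"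
  proof (rule nn_integral_mono)
    fix t :: real
    show "(\<integral>\<^sup>+x. ennreal ((indicator ({0..T - \<epsilon>\<^sup>2} \<times> UNIV) (t, x) * dfe (t, x))\<^sup>2) \<partial>lborel) \<le> (\<Sum>n\<le>N. ennreal (?E n) * indicator (?I n) t)"
    proof (cases "t \<in> {0..T - \<epsilon>\<^sup>2}")
      case True
      let ?n = "time_index \<epsilon> t"
      \<comment> \<open>The cut-off gives t + \<epsilon>^2 <= T, so the index of t is at most N, one
        below that of T.\<close>
      have "time_index \<epsilon> (t + \<epsilon>\<^sup>2) \<le> time_index \<epsilon> T"
        unfolding time_index_def using True by (intro nat_mono floor_mono divide_right_mono) auto
      then have n: "?n \<le> N" using time_index_step[OF eps, of t] True N by simp
      have t: "t \<in> ?I ?n" using time_index_bounds[OF eps, of t] True by auto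
      have "(\<integral>\<^sup>+x. ennreal ((indicator ({0..T - \<epsilon>\<^sup>2} \<times> UNIV) (t, x) * dfe (t, x))\<^sup>2) \<partial>lborel) = (\<integral>\<^sup>+x. ennreal ((dfs ?n x)\<^sup>2) \<partial>lborel)"
        using True by (simp add: dfe_def)
      also have "\<dots> = ennreal (?E ?n)" by (rule nn_integral_eq_integral[OF integrable_dfs_square]) auto
      also have "\<dots> = ennreal (?E ?n) * indicator (?I ?n) t" using t by simp
      also have "\<dots> \<le> (\<Sum>n\<le>N. ennreal (?E n) * indicator (?I n) t)" using n by (intro member_le_sum) auto
      finally show ?thesis .
    qed simp
  qed
  also have "\<dots> = (\<Sum>n\<le>N. ennreal (?E n) * emeasure lborel (?I n))"
    by (subst nn_integral_sum) (auto simp: nn_integral_cmult_indicator)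
  also have "\<dots> = (\<Sum>n\<le>N. ennreal (\<epsilon>\<^sup>2 * ?E n))"
  proof (intro sum.cong refl)
    fix n
    have "real n * \<epsilon>\<^sup>2 \<le> real (Suc n) * \<epsilon>\<^sup>2" by (intro mult_right_mono) auto
    then have "emeasure lborel (?I n) = ennreal (\<epsilon>\<^sup>2)" by (simp add: algebra_simps)
    then show "ennreal (?E n) * emeasure lborel (?I n) = ennreal (\<epsilon>\<^sup>2 * ?E n)"
      by (simp add: ennreal_mult mult.commute)
  qed
  also have "\<dots> = ennreal (\<Sum>n\<le>N. \<epsilon>\<^sup>2 * ?E n)" by (rule sum_ennreal) auto
  \<comment> \<open>The term n = 0 vanishes because \<open>dfs 0\<close> is 0, which aligns the sum
    with \<open>dfs_energy\<close>.\<close>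
  also have "(\<Sum>n\<le>N. \<epsilon>\<^sup>2 * ?E n) = (\<Sum>n<N. \<epsilon>\<^sup>2 * ?E (Suc n))"
    unfolding lessThan_Suc_atMost[symmetric] by (subst sum.lessThan_Suc_shift) (simp add: dfs_def)
  also have "ennreal \<dots> \<le> ennreal (2 * (M + 1) * (xs 0 - xs N))"
    by (intro ennreal_leI dfs_energy M)
  finally show ?thesis .
qed

text \<open>The test function lives in [\<delta>, T - \<delta>], where the cut-off is invisible as
  soon as \<epsilon>^2 <= \<delta>; slice by slice this is \<open>dfs_weak_deriv\<close>.\<close>

lemma dfe_weak_deriv:
  assumes tf: "test_function ({0<..<T} \<times> UNIV) \<phi>" and z0: "\<And>z. z \<notin> {\<delta>..T - \<delta>} \<times> {-R..R} \<Longrightarrow> \<phi> z = 0"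
    and \<delta>: "\<delta> > 0" "\<epsilon>\<^sup>2 \<le> \<delta>"
    and sq: "integrable lborel (\<lambda>z. (indicator ({0..T - \<epsilon>\<^sup>2} \<times> UNIV) z * dfe z)\<^sup>2)"
  shows "(LINT z|lborel. (indicator ({0..T - \<epsilon>\<^sup>2} \<times> UNIV) z * dfe z) * \<phi> z) = - (LINT z|lborel. fe z * partial_deriv (0, 1) \<phi> z)"
proof -
  let ?V = "\<lambda>z. indicator ({0..T - \<epsilon>\<^sup>2} \<times> UNIV) z * dfe z"
  let ?\<phi>x = "partial_deriv (0, 1) \<phi>"
  let ?S = "{\<delta>..T - \<delta>} \<times> {-R..R}"
  note tfx = test_function_partial_deriv[OF tf plane_Basis(2)]
  have clS: "closed ?S" and coS: "compact ?S" by (auto intro!: closed_Times compact_Times)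
  have zx: "?\<phi>x z = 0" if "z \<notin> ?S" for z by (rule partial_deriv_zero_outside[OF clS z0 that])
  have \<phi>m: "\<phi> \<in> borel_measurable borel" "?\<phi>x \<in> borel_measurable borel" using tf tfx by (auto intro: test_function_measurable)
  obtain D where D: "\<And>z. \<bar>\<phi> z\<bar> \<le> D" using test_function_bounded[OF tf] by metis
  obtain D' where D': "\<And>z. \<bar>?\<phi>x z\<bar> \<le> D'" using test_function_bounded[OF tfx] by metis
  obtain C where C: "\<And>z. z \<in> ?S \<Longrightarrow> \<bar>fe z\<bar> \<le> C" using fe_locally_bounded[OF coS] by metis
  have "{0..T - \<epsilon>\<^sup>2} \<times> (UNIV :: real set) \<in> sets borel" by (intro borel_closed closed_Times) auto
  then have Vm: "?V \<in> borel_measurable borel" by measurable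
  have "integrable lborel (\<lambda>z. \<phi> z * \<phi> z)"
    by (rule integrable_local_mult[OF \<phi>m(1) \<phi>m(1) coS D D z0])
  then have \<phi>2: "integrable lborel (\<lambda>z. (\<phi> z)\<^sup>2)" by (simp add: power2_eq_square)
  have i1: "integrable lborel (\<lambda>z. ?V z * \<phi> z)" by (rule L2_mult[OF _ _ sq \<phi>2]) (use Vm \<phi>m in auto)
  have i2: "integrable lborel (\<lambda>z. fe z * ?\<phi>x z)" by (rule integrable_local_mult[OF fe_measurable \<phi>m(2) coS C D' zx])
  have slice: "(LINT x|lborel. ?V (t, x) * \<phi> (t, x)) = - (LINT x|lborel. fe (t, x) * ?\<phi>x (t, x))" for t
  proof (cases "t \<in> {\<delta>..T - \<delta>}")
    case True
    then have t: "t \<in> {0..T - \<epsilon>\<^sup>2}" using \<delta> by auto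
    have cs: "cont_supp R (\<lambda>x. \<phi> (t, x))" "cont_supp R (\<lambda>x. ?\<phi>x (t, x))"
      using test_function_cont_supp[OF tf z0] test_function_cont_supp[OF tfx zx] by auto
    show ?thesis
      using dfs_weak_deriv[OF test_function_DERIV_x[OF tf] cs, of "time_index \<epsilon> t"] t by (simp add: dfe_def fe_eq)
  next
    case False
    then have "(t, x) \<notin> ?S" for x by blast
    then have "\<phi> (t, x) = 0" "?\<phi>x (t, x) = 0" for x using z0 zx by blast+
    then show ?thesis by simp
  qed
  have "(LINT z|lborel. ?V z * \<phi> z) = (LINT t|lborel. LINT x|lborel. ?V (t, x) * \<phi> (t, x))"
    using lborel_pair.integral_fst'[of "\<lambda>z. ?V z * \<phi> z"] i1 unfolding lborel_prod by simp
  also have "\<dots> = - (LINT t|lborel. LINT x|lborel. fe (t, x) * ?\<phi>x (t, x))"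
    unfolding slice by simp
  also have "(LINT t|lborel. LINT x|lborel. fe (t, x) * ?\<phi>x (t, x)) = (LINT z|lborel. fe z * ?\<phi>x z)"
    using lborel_pair.integral_fst'[of "\<lambda>z. fe z * ?\<phi>x z"] i2 unfolding lborel_prod by simp
  finally show ?thesis .
qed

end

lemma L1_loc_borel:
  fixes f :: "'a::euclidean_space \<Rightarrow> real"
  assumes "\<And>K. compact K \<Longrightarrow> K \<subseteq> S \<Longrightarrow> integrable lborel (\<lambda>z. indicator K z * f z)"
  shows "L1_loc S f"
  unfolding L1_loc_def
proof (intro allI impI)
  fix K assume K: "compact K \<and> K \<subseteq> S"
  then have i: "integrable lborel (\<lambda>z. indicator K z * f z)" using assms by blast
  have b: "K \<in> sets borel" using K by (auto intro: borel_closed compact_imp_closed)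
  show "integrable (lebesgue_on K) f"
    using i borel_measurable_integrable[OF i] by (subst integrable_lebesgue_on_borel[OF b]) auto
qed

section \<open>Uniform energy bound and weak limit\<close>

context sharp_limit
begin

lemma strip_L1_loc:
  assumes "continuous_on strip h" "S \<subseteq> strip" shows "L1_loc S h"
proof (rule L1_loc_borel)
  fix K assume "compact K" "K \<subseteq> S"
  then have "integrable lborel (\<lambda>z. indicator K z *\<^sub>R h z)"
    using assms by (intro borel_integrable_compact) (auto intro: continuous_on_subset)
  then show "integrable lborel (\<lambda>z. indicator K z * h z)" by simp
qed

lemma weak_deriv_plane:
  fixes d :: "real \<times> real \<Rightarrow> real"
  assumes h: "continuous_on strip h" and d: "d \<in> borel_measurable borel" "L1_loc ({0<..<T} \<times> UNIV) d"
    and eq: "\<And>\<phi>. test_function ({0<..<T} \<times> UNIV) \<phi> \<Longrightarrow>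
      (LINT z|lborel. (indicator strip z * h z) * partial_deriv (0, 1) \<phi> z) = - (LINT z|lborel. d z * \<phi> z)"
  shows "has_weak_deriv (0, 1) ({0<..<T} \<times> UNIV) h d"
  unfolding has_weak_deriv_def
proof (intro conjI allI impI)
  let ?\<Omega> = "{0<..<T} \<times> (UNIV :: real set)"
  have sub: "?\<Omega> \<subseteq> strip" by auto
  have b\<Omega>: "?\<Omega> \<in> sets borel" by (intro borel_open open_Times) auto
  show "L1_loc ?\<Omega> h" by (rule strip_L1_loc[OF h sub])
  show "L1_loc ?\<Omega> d" by fact
  fix \<phi> assume tf: "test_function ?\<Omega> \<phi>"
  note tfx = test_function_partial_deriv[OF tf plane_Basis(2)]
  have out: "\<psi> z = 0" if "test_function ?\<Omega> \<psi>" "z \<notin> ?\<Omega>" for \<psi> z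
    by (rule test_function_zero[OF that(1)]) (use that in \<open>auto simp: test_function_def\<close>)
  have e1: "(\<lambda>z. indicator ?\<Omega> z * (h z * partial_deriv (0, 1) \<phi> z)) = (\<lambda>z. (indicator strip z * h z) * partial_deriv (0, 1) \<phi> z)"
  proof
    fix z
    show "indicator ?\<Omega> z * (h z * partial_deriv (0, 1) \<phi> z) = (indicator strip z * h z) * partial_deriv (0, 1) \<phi> z"
    proof (cases "z \<in> ?\<Omega>")
      case True
      then have "z \<in> strip" using sub by blast
      with True show ?thesis by simp
    qed (simp add: out[OF tfx])
  qed
  have e2: "(\<lambda>z. indicator ?\<Omega> z * (d z * \<phi> z)) = (\<lambda>z. d z * \<phi> z)"
    using out[OF tf] by (auto simp: fun_eq_iff split: split_indicator)
  have m: "(\<lambda>z. (indicator strip z * h z) * partial_deriv (0, 1) \<phi> z) \<in> borel_measurable borel" "(\<lambda>z. d z * \<phi> z) \<in> borel_measurable borel"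
    using strip_measurable[OF h] d(1) test_function_measurable[OF tf] test_function_measurable[OF tfx] by auto
  show "(LINT z|lebesgue_on ?\<Omega>. h z * partial_deriv (0, 1) \<phi> z) = - (LINT z|lebesgue_on ?\<Omega>. d z * \<phi> z)"
    using eq[OF tf] m by (simp add: integral_lebesgue_on_borel[OF b\<Omega>] e1 e2)
qed

text \<open>Two things have to be uniform in k: the total displacement and an upper bound for f on
  the swept region. The first follows from convergence of the interface, the second from uniform
  convergence of f on a box; bounds valid almost everywhere reach each iterate through its time
  interval.\<close>

lemma f0_energy_bound:
  obtains C where "\<forall>\<^sub>F k in sequentially. (\<integral>\<^sup>+z. ennreal ((indicator ({0..T - (e k)\<^sup>2} \<times> UNIV) z * scheme_run.dfe (e k) u_ini \<xi>_ini z)\<^sup>2) \<partial>lborel) \<le> ennreal C"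
proof -
  have "compact (\<xi>0 ` {0..T})" by (intro compact_continuous_image \<xi>_cont) auto
  from compact_imp_bounded[OF this] obtain B0 where B0: "\<forall>t\<in>{0..T}. \<bar>\<xi>0 t\<bar> \<le> B0" unfolding bounded_iff by auto
  \<comment> \<open>Bounds all relevant interface positions: above by the initial position, below by
    the limit up to an error 1. The box is wider by 1 so that it contains a neighbourhood of every
    swept point.\<close>
  define \<Xi> where "\<Xi> = max B0 \<bar>\<xi>_ini\<bar> + 1"
  let ?K = "{0..T} \<times> {- \<Xi> - 1..\<Xi> + 1}"
  have coK: "compact ?K" and subK: "?K \<subseteq> strip" by (auto intro!: compact_Times)
  have f_lim': "compact K \<Longrightarrow> K \<subseteq> strip \<Longrightarrow> Linf_tendsto K fk f0" for K by (rule f_lim)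
  obtain M where M: "\<forall>\<^sub>F k in sequentially. AE z in lborel. z \<in> ?K \<longrightarrow> \<bar>fk k z\<bar> \<le> M"
    using locally_AE_bounded[OF f_lim' f_cont coK subK] by metis
  have ev2: "\<forall>\<^sub>F k in sequentially. AE t in lborel. t \<in> {0..T} \<longrightarrow> \<bar>xk k t - \<xi>0 t\<bar> \<le> 1"
    using Linf_tendsto_bound[OF \<xi>_lim zero_less_one] by (subst (asm) AE_lebesgue_on_iff) auto
  have M0: "M \<ge> 0"
  proof -
    obtain k where "AE z in lborel. z \<in> ?K \<longrightarrow> \<bar>fk k z\<bar> \<le> M" using M by (auto simp: eventually_sequentially)
    then have A: "AE z in lborel. z \<in> {0<..<T} \<times> {0<..<1} \<longrightarrow> \<bar>fk k z\<bar> \<le> M"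
      by eventually_elim (auto simp: \<Xi>_def)
    have "open ({0<..<T} \<times> {0<..<1::real})" "{0<..<T} \<times> {0<..<1::real} \<noteq> {}" using T_pos by (auto intro: open_Times)
    from AE_open_dense[OF A this] show ?thesis by (auto intro: order_trans[OF abs_ge_zero])
  qed
  from M ev2 have "\<forall>\<^sub>F k in sequentially. (\<integral>\<^sup>+z. ennreal ((indicator ({0..T - (e k)\<^sup>2} \<times> UNIV) z * scheme_run.dfe (e k) u_ini \<xi>_ini z)\<^sup>2) \<partial>lborel) \<le> ennreal (2 * (M + 1) * (2 * \<Xi>))"
  proof eventually_elim
    case (elim k)
    let ?xs = "xi_seq (e k) u_ini \<xi>_ini" and ?fs = "f_seq (e k) u_ini \<xi>_ini"
    let ?a = "\<lambda>n. real n * (e k)\<^sup>2"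
    have pos: "0 < (e k)\<^sup>2" using e_pos[of k] by simp
    have "1 \<le> time_index (e k) T"
    proof -
      have "1 \<le> T / (e k)\<^sup>2" using e_le[of k] pos by simp
      then have "1 \<le> \<lfloor>T / (e k)\<^sup>2\<rfloor>" by simp
      then show ?thesis unfolding time_index_def by linarith
    qed
    then obtain N where N: "Suc N = time_index (e k) T" by (metis Suc_le_D One_nat_def)
    have interval: "{?a n<..<?a (Suc n)} \<subseteq> {0<..<T}" "{?a n<..<?a (Suc n)} \<noteq> {}" if "n \<le> N" for n
    proof -
      have "?a (Suc n) \<le> ?a (Suc N)" using that by (intro mult_right_mono) auto
      also have "\<dots> \<le> T" unfolding N using time_index_bounds(1)[OF e_pos, of T k] T_pos by simp
      finally have le: "?a (Suc n) \<le> T" .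
      show "{?a n<..<?a (Suc n)} \<subseteq> {0<..<T}"
      proof (intro subsetI)
        fix t assume "t \<in> {?a n<..<?a (Suc n)}"
        then have t: "?a n < t" "t < ?a (Suc n)" by (simp_all only: greaterThanLessThan_iff)
        have "0 \<le> ?a n" by (rule mult_nonneg_nonneg) simp_all
        then have "0 < t" using t(1) by (rule le_less_trans)
        moreover have "t < T" using t(2) le by (rule less_le_trans)
        ultimately show "t \<in> {0<..<T}" by simp
      qed
      have "?a n < ?a (Suc n)" using pos by (simp add: algebra_simps)
      then show "{?a n<..<?a (Suc n)} \<noteq> {}" by simp
    qed
    have idx: "time_index (e k) t = n" if "t \<in> {?a n<..<?a (Suc n)}" for t n
      by (rule time_index_eqI[OF e_pos]) (use that in auto)
    have xs_ge: "- \<Xi> \<le> ?xs n" if "n \<le> N" for n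
    proof -
      \<comment> \<open>The time interval of index N lies entirely inside (0, T), so some time in it
        satisfies the bound; monotonicity covers the earlier indices.\<close>
      have "AE t in lborel. t \<in> {?a N<..<?a (Suc N)} \<longrightarrow> \<bar>xk k t - \<xi>0 t\<bar> \<le> 1"
        using elim(2) by eventually_elim (use interval(1)[of N] in force)
      from AE_open_dense[OF this _ interval(2)] obtain t where t: "t \<in> {?a N<..<?a (Suc N)}" "\<bar>xk k t - \<xi>0 t\<bar> \<le> 1" by auto
      have "t \<in> {0..T}" using t(1) interval(1)[of N] by auto
      then have "\<bar>\<xi>0 t\<bar> \<le> B0" using B0 by blast
      moreover have "xk k t = ?xs N" by (simp add: xi_eps_def idx[OF t(1)])
      ultimately have "- \<Xi> \<le> ?xs N" using t(2) unfolding \<Xi>_def by linarith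
      also have "?xs N \<le> ?xs n" by (rule scheme_run.xs_antimono[OF run that])
      finally show ?thesis .
    qed
    have xs0: "?xs 0 = \<xi>_ini" by (simp add: xi_seq_def scheme_def)
    have xs_le: "?xs n \<le> \<Xi>" for n
      using scheme_run.xs_antimono[OF run, of 0 n k] unfolding xs0 \<Xi>_def by linarith
    have fM: "?fs n x \<le> M" if n: "n < N" and x: "?xs (Suc n) \<le> x" "x \<le> ?xs n" for n x
    proof (rule ccontr)
      assume "\<not> ?fs n x \<le> M"
      have x\<Xi>: "x \<in> {- \<Xi> - 1<..<\<Xi> + 1}" using x xs_ge[of "Suc n"] xs_le[of n] n by auto
      \<comment> \<open>A violation at one x would persist on an open set by continuity of
        \<open>?fs n\<close> and, over the time interval, fill an open part of the box.\<close>
      let ?B = "{- \<Xi> - 1<..<\<Xi> + 1} \<inter> ?fs n -` {M<..}"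
      have "open ?B" by (intro continuous_open_preimage continuous_on_subset[OF scheme_run.continuous_fs[OF run]]) auto
      then have op: "open ({?a n<..<?a (Suc n)} \<times> ?B)" by (intro open_Times) auto
      have ne: "{?a n<..<?a (Suc n)} \<times> ?B \<noteq> {}" using interval(2)[of n] n x\<Xi> \<open>\<not> ?fs n x \<le> M\<close> by auto
      have "AE z in lborel. z \<in> {?a n<..<?a (Suc n)} \<times> ?B \<longrightarrow> \<bar>fk k z\<bar> \<le> M"
        using elim(1)
      proof eventually_elim
        case (elim z)
        show ?case
        proof
          assume "z \<in> {?a n<..<?a (Suc n)} \<times> ?B"
          then have "z \<in> ?K" using interval(1)[of n] n by (cases z) force
          then show "\<bar>fk k z\<bar> \<le> M" using elim by blast
        qed
      qed
      from AE_open_dense[OF this op ne] obtain z where z: "z \<in> {?a n<..<?a (Suc n)} \<times> ?B" "\<bar>fk k z\<bar> \<le> M" by blast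
      have "fk k z = ?fs n (snd z)"
        unfolding scheme_run.fe_eq[OF run] using z(1) idx[of "fst z" n] by auto
      then show False using z by auto
    qed
    have "2 * (M + 1) * (?xs 0 - ?xs N) \<le> 2 * (M + 1) * (2 * \<Xi>)"
      using xs_ge[of N] xs_le[of 0] M0 by (intro mult_left_mono) auto
    then show ?case
      using scheme_run.dfe_square_nn_integral[OF run e_le N fM] by (meson ennreal_leI order_trans)
  qed
  then show thesis by (rule that)
qed

lemma L2_L1_loc:
  fixes d :: "real \<times> real \<Rightarrow> real"
  assumes "d \<in> borel_measurable borel" "integrable lborel (\<lambda>z. (d z)\<^sup>2)" shows "L1_loc S d"
proof (rule L1_loc_borel)
  fix K :: "(real \<times> real) set" assume K: "compact K"
  then have b: "K \<in> sets borel" by (auto intro: borel_closed compact_imp_closed)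
  have "(\<lambda>z. (indicat_real K z)\<^sup>2) = indicator K" by (auto split: split_indicator)
  then have "integrable lborel (\<lambda>z. (indicat_real K z)\<^sup>2)" using b emeasure_compact_finite[OF K] by simp
  then show "integrable lborel (\<lambda>z. indicator K z * d z)"
    using assms b by (intro L2_mult) auto
qed

text \<open>Pairings with a test function converge along the whole sequence, since f converges and
  the weak formula holds for late k. This is the convergence from which \<open>L2_weak_limit\<close>
  yields the pairings of d.\<close>

lemma f0_weak_deriv:
  obtains d where "d \<in> borel_measurable borel" "integrable lborel (\<lambda>z. (d z)\<^sup>2)"
    "\<And>\<phi>. test_function ({0<..<T} \<times> UNIV) \<phi> \<Longrightarrow>
      (LINT z|lborel. (indicator strip z * f0 z) * partial_deriv (0, 1) \<phi> z) = - (LINT z|lborel. d z * \<phi> z)"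
proof -
  let ?V = "\<lambda>k z. indicator ({0..T - (e k)\<^sup>2} \<times> UNIV) z * scheme_run.dfe (e k) u_ini \<xi>_ini z"
  obtain C where "\<forall>\<^sub>F k in sequentially. (\<integral>\<^sup>+z. ennreal ((?V k z)\<^sup>2) \<partial>lborel) \<le> ennreal C" by (rule f0_energy_bound)
  then obtain k0 where k0: "\<And>k. k \<ge> k0 \<Longrightarrow> (\<integral>\<^sup>+z. ennreal ((?V k z)\<^sup>2) \<partial>lborel) \<le> ennreal C"
    unfolding eventually_sequentially by blast
  have "{0..T - (e k)\<^sup>2} \<times> (UNIV :: real set) \<in> sets borel" for k by (intro borel_closed closed_Times) auto
  then have Vm [measurable]: "?V k \<in> borel_measurable borel" for k using scheme_run.dfe_measurable[OF run, of k] by measurable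
  have Vi: "integrable lborel (\<lambda>z. (?V k z)\<^sup>2)" if "k \<ge> k0" for k
    by (rule integrableI_bounded) (use k0[OF that] Vm[of k] in \<open>auto intro: le_less_trans\<close>)
  have Vb: "(LINT z|lborel. (?V k z)\<^sup>2) \<le> max C 0" if "k \<ge> k0" for k
  proof -
    have "ennreal (LINT z|lborel. (?V k z)\<^sup>2) \<le> ennreal C"
      using nn_integral_eq_integral[OF Vi[OF that]] k0[OF that] by simp
    also have "\<dots> \<le> ennreal (max C 0)" by (rule ennreal_leI) simp
    finally show ?thesis by (simp add: ennreal_le_iff)
  qed
  obtain d where d: "d \<in> borel_measurable lborel" "integrable lborel (\<lambda>z. (d z)\<^sup>2)"
    and lim: "\<And>\<phi> L. \<phi> \<in> borel_measurable lborel \<Longrightarrow> integrable lborel (\<lambda>x. (\<phi> x)\<^sup>2) \<Longrightarrow> (\<lambda>k. LINT x|lborel. ?V (k + k0) x * \<phi> x) \<longlonglongrightarrow> L \<Longrightarrow> (LINT x|lborel. d x * \<phi> x) = L"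
    by (rule L2_weak_limit[of "\<lambda>k. ?V (k + k0)" lborel "max C 0"]) (use Vi Vb Vm in auto)
  have dm: "d \<in> borel_measurable borel" using d(1) by simp
  have f_lim': "compact K \<Longrightarrow> K \<subseteq> strip \<Longrightarrow> Linf_tendsto K fk f0" for K by (rule f_lim)
  have f_AE: "AE z in lborel. z \<in> strip \<longrightarrow> (\<lambda>k. fk k z) \<longlonglongrightarrow> f0 z" by (rule locally_AE_tendsto[OF f_lim'])
  have "(LINT z|lborel. (indicator strip z * f0 z) * partial_deriv (0, 1) \<phi> z) = - (LINT z|lborel. d z * \<phi> z)"
    if tf: "test_function ({0<..<T} \<times> UNIV) \<phi>" for \<phi>
  proof -
    let ?\<phi>x = "partial_deriv (0, 1) \<phi>"
    note tfx = test_function_partial_deriv[OF tf plane_Basis(2)]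
    obtain \<delta> R where \<delta>: "\<delta> > 0" "R \<ge> 0" and z0: "\<And>z. z \<notin> {\<delta>..T - \<delta>} \<times> {-R..R} \<Longrightarrow> \<phi> z = 0"
      using strip_test_function_support[OF tf] by metis
    let ?S = "{\<delta>..T - \<delta>} \<times> {-R..R}"
    have clS: "closed ?S" and coS: "compact ?S" by (auto intro!: closed_Times compact_Times)
    have subS: "?S \<subseteq> strip" using \<delta> by auto
    have zx: "?\<phi>x z = 0" if "z \<notin> ?S" for z by (rule partial_deriv_zero_outside[OF clS z0 that])
    have \<phi>m: "\<phi> \<in> borel_measurable borel" "?\<phi>x \<in> borel_measurable borel" using tf tfx by (auto intro: test_function_measurable)
    obtain D where D: "\<And>z. \<bar>\<phi> z\<bar> \<le> D" using test_function_bounded[OF tf] by metis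
    obtain D' where D': "\<And>z. \<bar>?\<phi>x z\<bar> \<le> D'" using test_function_bounded[OF tfx] by metis
    have "integrable lborel (\<lambda>z. \<phi> z * \<phi> z)" by (rule integrable_local_mult[OF \<phi>m(1) \<phi>m(1) coS D D z0])
    then have \<phi>2: "integrable lborel (\<lambda>z. (\<phi> z)\<^sup>2)" by (simp add: power2_eq_square)
    obtain C' where C': "\<forall>\<^sub>F k in sequentially. AE z in lborel. z \<in> ?S \<longrightarrow> \<bar>fk k z\<bar> \<le> C'"
      using locally_AE_bounded[OF f_lim' f_cont coS subS] by metis
    have flim: "(\<lambda>k. LINT z|lborel. fk k z * ?\<phi>x z) \<longlonglongrightarrow> (LINT z|lborel. (indicator strip z * f0 z) * ?\<phi>x z)"
    proof (rule tendsto_integral_local[OF scheme_run.fe_measurable[OF run] strip_measurable[OF f_cont] \<phi>m(2) \<phi>m(2) coS _ tendsto_const C', where D = D'])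
      show "AE z in lborel. z \<in> ?S \<longrightarrow> (\<lambda>k. fk k z) \<longlonglongrightarrow> indicator strip z * f0 z"
        using f_AE
      proof eventually_elim
        case (elim z)
        then show ?case using subS by (cases "z \<in> strip") auto
      qed
      have "\<bar>?\<phi>x z\<bar> \<le> D' \<and> (z \<notin> ?S \<longrightarrow> ?\<phi>x z = 0)" for z using D'[of z] zx[of z] by (intro conjI impI)
      then show "\<forall>\<^sub>F k in sequentially. \<forall>z. \<bar>?\<phi>x z\<bar> \<le> D' \<and> (z \<notin> ?S \<longrightarrow> ?\<phi>x z = 0)" by (intro always_eventually allI)
    qed
    have e2: "(\<lambda>k. (e k)\<^sup>2) \<longlonglongrightarrow> 0" using tendsto_power[OF e_lim, of 2] by simp
    have "\<forall>\<^sub>F k in sequentially. (LINT z|lborel. ?V k z * \<phi> z) = - (LINT z|lborel. fk k z * ?\<phi>x z)"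
      using order_tendstoD(2)[OF e2 \<delta>(1)] eventually_ge_at_top[of k0]
    proof eventually_elim
      case (elim k)
      show ?case by (rule scheme_run.dfe_weak_deriv[OF run tf z0 \<delta>(1) less_imp_le[OF elim(1)] Vi[OF elim(2)]])
    qed
    then have lim': "(\<lambda>k. LINT z|lborel. ?V k z * \<phi> z) \<longlonglongrightarrow> - (LINT z|lborel. (indicator strip z * f0 z) * ?\<phi>x z)"
      by (intro Lim_transform_eventually[OF tendsto_minus[OF flim]]) (erule eventually_mono, simp)
    have "(LINT z|lborel. d z * \<phi> z) = - (LINT z|lborel. (indicator strip z * f0 z) * ?\<phi>x z)"
      by (rule lim[OF _ \<phi>2 LIMSEQ_ignore_initial_segment[OF lim']]) (simp add: \<phi>m(1))
    then show ?thesis by simp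
  qed
  then show thesis using that[OF dm d(2)] by blast
qed

end

subsection \<open>The spatial derivative of the regular part\<close>

lemma heat_kernel_normal_density: "t > 0 \<Longrightarrow> heat_kernel t = normal_density 0 (sqrt (2 * t))"
  by (rule ext) (simp add: heat_kernel_def normal_density_def algebra_simps)

lemma heat_kernel_nonneg: "t > 0 \<Longrightarrow> 0 \<le> heat_kernel t x"
  by (simp add: heat_kernel_def)

lemma heat_kernel_weighted:
  assumes "t > 0"
  shows "integrable lborel (\<lambda>z. heat_kernel t z * (1 + \<bar>z\<bar>))"
    and "(LINT z|lborel. heat_kernel t z * (1 + \<bar>z\<bar>)) \<le> 1 + sqrt (2 * t)"
proof -
  have m: "has_bochner_integral lborel (\<lambda>z. normal_density 0 (sqrt (2 * t)) z * \<bar>z\<bar>) (sqrt (2 * t) * sqrt (2 / pi))"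
    using normal_moment_abs_odd[of "sqrt (2 * t)" 0 0] assms by simp
  have e: "(\<lambda>z. heat_kernel t z * (1 + \<bar>z\<bar>)) = (\<lambda>z. normal_density 0 (sqrt (2 * t)) z + normal_density 0 (sqrt (2 * t)) z * \<bar>z\<bar>)"
    by (simp add: heat_kernel_normal_density[OF assms] distrib_left)
  have i: "integrable lborel (normal_density 0 (sqrt (2 * t)))" "(LINT z|lborel. normal_density 0 (sqrt (2 * t)) z) = 1"
    using assms by simp_all
  show "integrable lborel (\<lambda>z. heat_kernel t z * (1 + \<bar>z\<bar>))"
    unfolding e using m i by (auto simp: has_bochner_integral_iff)
  have "(LINT z|lborel. heat_kernel t z * (1 + \<bar>z\<bar>)) = 1 + sqrt (2 * t) * sqrt (2 / pi)"
    unfolding e using m i by (simp add: has_bochner_integral_iff)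
  moreover have "sqrt (2 / pi) \<le> 1" using pi_ge_two by simp
  then have "sqrt (2 * t) * sqrt (2 / pi) \<le> sqrt (2 * t) * 1" using assms by (intro mult_left_mono) auto
  ultimately show "(LINT z|lborel. heat_kernel t z * (1 + \<bar>z\<bar>)) \<le> 1 + sqrt (2 * t)" by simp
qed

lemma heat_kernel_DERIV:
  assumes "t > 0" shows "(heat_kernel t has_real_derivative - (w / (2 * t)) * heat_kernel t w) (at w)"
proof -
  have "((\<lambda>x. - x\<^sup>2 / (4 * t)) has_real_derivative - (w / (2 * t))) (at w)"
    using assms by (auto intro!: derivative_eq_intros simp: field_simps)
  from DERIV_cmult[OF DERIV_fun_exp[OF this], of "1 / sqrt (4 * pi * t)"]
  show ?thesis by (simp add: heat_kernel_def[abs_def] mult.commute mult.left_commute)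
qed

text \<open>Enlarging the time to 4t makes the Gaussian wide enough to dominate uniformly in w
  within sqrt t of z, as the mean value theorem requires. The factor |w| / sqrt t costs half of the
  Gaussian exponent; passing from w to z halves it again and costs exp(1/8) <= 2. The prefactor of
  the wider kernel gives the other 2 in the constant 4.\<close>

lemma heat_kernel_deriv_bound:
  assumes t: "t > 0" and w: "\<bar>w - z\<bar> \<le> sqrt t"
  shows "\<bar>- (w / (2 * t)) * heat_kernel t w\<bar> \<le> 4 / sqrt t * heat_kernel (4 * t) z"
proof -
  define y where "y = \<bar>w\<bar> / (2 * sqrt t)"
  have st: "sqrt t > 0" "sqrt t * sqrt t = t" using t by auto
  have y2: "y\<^sup>2 = w\<^sup>2 / (4 * t)" using t by (simp add: y_def power_divide power_mult_distrib)
  have "0 \<le> (y - 1)\<^sup>2" by simp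
  then have "y \<le> 1 + y\<^sup>2 / 2" by (simp add: power2_diff)
  also have "\<dots> \<le> exp (y\<^sup>2 / 2)" by (rule exp_ge_add_one_self)
  finally have y: "y \<le> exp (w\<^sup>2 / (8 * t))" unfolding y2 by simp
  have yw: "\<bar>w\<bar> / (2 * t) = y / sqrt t" using st by (simp add: y_def field_simps)
  have "z\<^sup>2 \<le> 2 * w\<^sup>2 + 2 * (w - z)\<^sup>2"
  proof -
    have "0 \<le> (2 * w - z)\<^sup>2" by simp
    then show ?thesis by (simp add: power2_eq_square algebra_simps)
  qed
  moreover have "(w - z)\<^sup>2 \<le> t" using w t by (metis real_sqrt_abs real_sqrt_le_iff)
  ultimately have "z\<^sup>2 - 2 * t \<le> 2 * w\<^sup>2" by linarith
  then have "- w\<^sup>2 / (8 * t) \<le> - z\<^sup>2 / (4 * (4 * t)) + 1 / 8" using t by (simp add: field_simps)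
  then have "exp (- w\<^sup>2 / (8 * t)) \<le> exp (- z\<^sup>2 / (4 * (4 * t))) * exp (1 / 8)" by (simp add: mult_exp_exp)
  also have "\<dots> \<le> exp (- z\<^sup>2 / (4 * (4 * t))) * 2"
  proof (rule mult_left_mono)
    have "exp (1 / 8) \<le> exp (1 / 2 :: real)" by simp
    then show "exp (1 / 8) \<le> (2::real)" using exp_half_le2 by linarith
  qed simp
  finally have ez: "exp (- w\<^sup>2 / (8 * t)) \<le> 2 * exp (- z\<^sup>2 / (4 * (4 * t)))" by simp
  have ee: "exp (w\<^sup>2 / (8 * t)) * exp (- w\<^sup>2 / (4 * t)) = exp (- w\<^sup>2 / (8 * t))"
    using t by (simp add: mult_exp_exp field_simps)
  let ?c = "1 / sqrt (4 * pi * t)"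
  have c: "0 \<le> ?c" using t by simp
  have "sqrt (4 * pi * (4 * t)) = 2 * sqrt (4 * pi * t)"
    using real_sqrt_mult[of 4 "4 * pi * t"] by (simp add: ac_simps)
  then have k4: "heat_kernel (4 * t) z = ?c / 2 * exp (- z\<^sup>2 / (4 * (4 * t)))" by (simp add: heat_kernel_def)
  have "\<bar>- (w / (2 * t)) * heat_kernel t w\<bar> = \<bar>w\<bar> / (2 * t) * heat_kernel t w"
    using t heat_kernel_nonneg[OF t, of w] by (simp add: abs_mult)
  also have "\<dots> = y / sqrt t * (?c * exp (- w\<^sup>2 / (4 * t)))"
    unfolding yw by (simp add: heat_kernel_def)
  also have "\<dots> \<le> exp (w\<^sup>2 / (8 * t)) / sqrt t * (?c * exp (- w\<^sup>2 / (4 * t)))"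
    using c st by (intro mult_right_mono divide_right_mono y) auto
  also have "\<dots> = ?c / sqrt t * (exp (w\<^sup>2 / (8 * t)) * exp (- w\<^sup>2 / (4 * t)))" by simp
  also have "\<dots> \<le> ?c / sqrt t * (2 * exp (- z\<^sup>2 / (4 * (4 * t))))"
    unfolding ee using c st by (intro mult_left_mono ez) auto
  also have "\<dots> = 4 / sqrt t * heat_kernel (4 * t) z" unfolding k4 by simp
  finally show ?thesis .
qed

lemma heat_kernel_diff_bound:
  assumes t: "t > 0" and s: "\<bar>s\<bar> \<le> sqrt t"
  shows "\<bar>heat_kernel t (z + s) - heat_kernel t z\<bar> \<le> 4 / sqrt t * heat_kernel (4 * t) z * \<bar>s\<bar>"
proof -
  have "norm (heat_kernel t (z + s) - heat_kernel t z) \<le> 4 / sqrt t * heat_kernel (4 * t) z * norm (z + s - z)"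
  proof (rule field_differentiable_bound)
    show "convex {z - \<bar>s\<bar>..z + \<bar>s\<bar>}" by simp
    show "(heat_kernel t has_field_derivative - (w / (2 * t)) * heat_kernel t w) (at w within {z - \<bar>s\<bar>..z + \<bar>s\<bar>})" for w
      using heat_kernel_DERIV[OF t] by (rule has_field_derivative_at_within)
    show "norm (- (w / (2 * t)) * heat_kernel t w) \<le> 4 / sqrt t * heat_kernel (4 * t) z" if "w \<in> {z - \<bar>s\<bar>..z + \<bar>s\<bar>}" for w
      unfolding real_norm_def by (rule heat_kernel_deriv_bound[OF t]) (use that s in auto)
  qed auto
  then show ?thesis by simp
qed

lemma heat_conv_integrable:
  assumes t: "t > 0" and h: "h \<in> borel_measurable borel" "\<And>y. \<bar>h y\<bar> \<le> A * (1 + \<bar>y\<bar>)" and A: "A \<ge> 0"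
  shows "integrable lborel (\<lambda>y. heat_kernel t (x - y) * h y)"
    and "integrable lborel (\<lambda>y. heat_kernel t (x - y) * \<bar>h y\<bar>)"
    and "(LINT y|lborel. heat_kernel t (x - y) * \<bar>h y\<bar>) \<le> A * (1 + \<bar>x\<bar>) * (1 + sqrt (2 * t))"
proof -
  have [measurable]: "heat_kernel t \<in> borel_measurable borel" unfolding heat_kernel_def[abs_def] by measurable
  note w = heat_kernel_weighted[OF t]
  have iw: "integrable lborel (\<lambda>y. A * (1 + \<bar>x\<bar>) * (heat_kernel t (x - y) * (1 + \<bar>x - y\<bar>)))"
    using w(1) lborel_integrable_reflect[of "\<lambda>z. heat_kernel t z * (1 + \<bar>z\<bar>)" x] by (intro integrable_mult_right) simp
  have bd: "heat_kernel t (x - y) * \<bar>h y\<bar> \<le> A * (1 + \<bar>x\<bar>) * (heat_kernel t (x - y) * (1 + \<bar>x - y\<bar>))" for y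
  proof -
    have "\<bar>h y\<bar> \<le> A * ((1 + \<bar>x\<bar>) * (1 + \<bar>x - y\<bar>))"
      using h(2)[of y] mult_left_mono[OF weight_submult[of y x] A] by linarith
    from mult_left_mono[OF this heat_kernel_nonneg[OF t, of "x - y"]] show ?thesis by (simp add: ac_simps)
  qed
  show i: "integrable lborel (\<lambda>y. heat_kernel t (x - y) * \<bar>h y\<bar>)"
  proof (rule Bochner_Integration.integrable_bound[OF iw])
    show "AE y in lborel. norm (heat_kernel t (x - y) * \<bar>h y\<bar>) \<le> norm (A * (1 + \<bar>x\<bar>) * (heat_kernel t (x - y) * (1 + \<bar>x - y\<bar>)))"
      using order_trans[OF bd abs_ge_self] heat_kernel_nonneg[OF t] by (simp add: abs_mult)
  qed (use h(1) in measurable)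
  show "integrable lborel (\<lambda>y. heat_kernel t (x - y) * h y)"
    by (rule Bochner_Integration.integrable_bound[OF i]) (use h(1) in \<open>auto simp: abs_mult\<close>)
  have "(LINT y|lborel. heat_kernel t (x - y) * \<bar>h y\<bar>) \<le> (LINT y|lborel. A * (1 + \<bar>x\<bar>) * (heat_kernel t (x - y) * (1 + \<bar>x - y\<bar>)))"
    by (rule integral_mono[OF i iw bd])
  also have "\<dots> = A * (1 + \<bar>x\<bar>) * (LINT z|lborel. heat_kernel t z * (1 + \<bar>z\<bar>))"
    using lborel_integral_reflect[of "\<lambda>z. heat_kernel t z * (1 + \<bar>z\<bar>)" x] by simp
  also have "\<dots> \<le> A * (1 + \<bar>x\<bar>) * (1 + sqrt (2 * t))" using A w(2) by (intro mult_left_mono) auto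
  finally show "(LINT y|lborel. heat_kernel t (x - y) * \<bar>h y\<bar>) \<le> A * (1 + \<bar>x\<bar>) * (1 + sqrt (2 * t))" .
qed

text \<open>The Lipschitz constant is of order (1 + |x|) / sqrt t for bounded t. Its integrability
  in t near 0 is what makes the derivative of \<open>q0\<close> locally integrable up to the initial
  time.\<close>

lemma heat_conv_diff_bound:
  assumes t: "t > 0" and h: "h \<in> borel_measurable borel" "\<And>y. \<bar>h y\<bar> \<le> A * (1 + \<bar>y\<bar>)" and A: "A \<ge> 0"
    and s: "\<bar>s\<bar> \<le> sqrt t"
  shows "\<bar>conv (heat_kernel t) h (x + s) - conv (heat_kernel t) h x\<bar> \<le> 4 * A * (1 + sqrt (8 * t)) * (1 + \<bar>x\<bar>) / sqrt t * \<bar>s\<bar>"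
proof -
  have t4: "4 * t > 0" using t by simp
  note i4 = heat_conv_integrable[OF t4 h A]
  have "\<bar>conv (heat_kernel t) h (x + s) - conv (heat_kernel t) h x\<bar>
      = \<bar>LINT y|lborel. heat_kernel t (x + s - y) * h y - heat_kernel t (x - y) * h y\<bar>"
    using heat_conv_integrable(1)[OF t h A] by (simp add: conv_def)
  also have "\<dots> \<le> (LINT y|lborel. \<bar>heat_kernel t (x + s - y) * h y - heat_kernel t (x - y) * h y\<bar>)"
    by (rule integral_abs_bound)
  also have "\<dots> \<le> (LINT y|lborel. 4 / sqrt t * \<bar>s\<bar> * (heat_kernel (4 * t) (x - y) * \<bar>h y\<bar>))"
  proof (rule integral_mono)
    show "integrable lborel (\<lambda>y. \<bar>heat_kernel t (x + s - y) * h y - heat_kernel t (x - y) * h y\<bar>)"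
      using heat_conv_integrable(1)[OF t h A] by simp
    show "integrable lborel (\<lambda>y. 4 / sqrt t * \<bar>s\<bar> * (heat_kernel (4 * t) (x - y) * \<bar>h y\<bar>))"
      by (intro integrable_mult_right i4)
    fix y
    have "\<bar>heat_kernel t (x - y + s) - heat_kernel t (x - y)\<bar> * \<bar>h y\<bar> \<le> (4 / sqrt t * heat_kernel (4 * t) (x - y) * \<bar>s\<bar>) * \<bar>h y\<bar>"
      by (intro mult_right_mono heat_kernel_diff_bound t s) auto
    moreover have "heat_kernel t (x + s - y) * h y - heat_kernel t (x - y) * h y = (heat_kernel t (x - y + s) - heat_kernel t (x - y)) * h y"
      by (simp add: left_diff_distrib add_diff_eq diff_add_eq)
    ultimately show "\<bar>heat_kernel t (x + s - y) * h y - heat_kernel t (x - y) * h y\<bar> \<le> 4 / sqrt t * \<bar>s\<bar> * (heat_kernel (4 * t) (x - y) * \<bar>h y\<bar>)"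
      by (simp only: abs_mult ac_simps)
  qed
  also have "\<dots> = 4 / sqrt t * \<bar>s\<bar> * (LINT y|lborel. heat_kernel (4 * t) (x - y) * \<bar>h y\<bar>)" by simp
  also have "\<dots> \<le> 4 / sqrt t * \<bar>s\<bar> * (A * (1 + \<bar>x\<bar>) * (1 + sqrt (2 * (4 * t))))"
    using t by (intro mult_left_mono i4) auto
  also have "\<dots> = 4 * A * (1 + sqrt (8 * t)) * (1 + \<bar>x\<bar>) / sqrt t * \<bar>s\<bar>" by simp
  finally show ?thesis .
qed

lemma integrable_inverse_sqrt:
  assumes "T > 0"
  shows "integrable lborel (\<lambda>t. indicator {0<..<T} t * (1 / sqrt t))"
proof -
  have "(\<lambda>t. t powr (- 1 / 2)) absolutely_integrable_on {0..T}"
    using assms by (intro nonnegative_absolutely_integrable_1 integrable_on_powr_from_0) auto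
  then have "integrable lebesgue (\<lambda>t. indicator {0..T} t * t powr (- 1 / 2))" by (simp add: set_integrable_def)
  then have "integrable lborel (\<lambda>t. indicator {0..T} t * t powr (- 1 / 2))"
    by (subst (asm) integrable_completion) auto
  then show ?thesis
  proof (rule Bochner_Integration.integrable_bound)
    have "norm (indicator {0<..<T} t * (1 / sqrt t)) \<le> norm (indicator {0..T} t * t powr (- 1 / 2))" for t
    proof (cases "t \<in> {0<..<T}")
      case True
      have "t powr (- 1 / 2) = 1 / sqrt t" using True by (simp add: powr_minus powr_half_sqrt field_simps flip: powr_half_sqrt)
      then show ?thesis using True by simp
    qed simp
    then show "AE t in lborel. norm (indicator {0<..<T} t * (1 / sqrt t)) \<le> norm (indicator {0..T} t * t powr (- 1 / 2))" by simp
  qed measurable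
qed

lemma integrable_plane_product:
  fixes a b :: "real \<Rightarrow> real"
  assumes "integrable lborel a" "integrable lborel b"
  shows "integrable lborel (\<lambda>z. a (fst z) * b (snd z))"
proof -
  have [measurable]: "a \<in> borel_measurable borel" "b \<in> borel_measurable borel" using assms by auto
  have "integrable (lborel \<Otimes>\<^sub>M lborel) (\<lambda>z. a (fst z) * b (snd z))"
  proof (rule lborel_pair.Fubini_integrable)
    show "integrable lborel (\<lambda>x. LINT y|lborel. norm (a (fst (x, y)) * b (snd (x, y))))"
      using assms by (simp add: abs_mult)
    show "AE x in lborel. integrable lborel (\<lambda>y. a (fst (x, y)) * b (snd (x, y)))"
      using assms by simp
  qed measurable
  then show ?thesis by (simp add: lborel_prod)
qed

section \<open>Difference quotients of the regular part\<close>

context sharp_limit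
begin

abbreviation "Q \<equiv> (\<lambda>z. indicator strip z * q0 z)"

lemma Q_measurable [measurable]: "Q \<in> borel_measurable borel"
  by (rule strip_measurable[OF q_cont])

lemma q0_diff_bound:
  obtains C where "C \<ge> 0"
    "\<And>t x s. 0 < t \<Longrightarrow> t \<le> T \<Longrightarrow> \<bar>s\<bar> \<le> sqrt t \<Longrightarrow> \<bar>q0 (t, x + s) - q0 (t, x)\<bar> \<le> C * (1 + \<bar>x\<bar>) / sqrt t * \<bar>s\<bar>"
proof -
  let ?h = "p_of u_ini \<xi>_ini"
  have lg: "lin_growth ?h" by (rule p_of_initial(2)[OF adm])
  obtain A where A: "A \<ge> 0" "\<And>y. \<bar>?h y\<bar> \<le> A * (1 + \<bar>y\<bar>)" using lin_growth_bound[OF lg] by metis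
  have q: "q0 (t, x) = conv (heat_kernel t) ?h x" if "0 < t" "t \<le> T" for t x
    using heat that unfolding heat_solution_def by auto
  have "\<bar>q0 (t, x + s) - q0 (t, x)\<bar> \<le> 4 * A * (1 + sqrt (8 * T)) * (1 + \<bar>x\<bar>) / sqrt t * \<bar>s\<bar>"
    if t: "0 < t" "t \<le> T" and s: "\<bar>s\<bar> \<le> sqrt t" for t x s
  proof -
    have "\<bar>q0 (t, x + s) - q0 (t, x)\<bar> \<le> 4 * A * (1 + sqrt (8 * t)) * (1 + \<bar>x\<bar>) / sqrt t * \<bar>s\<bar>"
      unfolding q[OF t] by (rule heat_conv_diff_bound[OF t(1) lin_growthD[OF lg] A(2,1) s])
    also have "\<dots> \<le> 4 * A * (1 + sqrt (8 * T)) * (1 + \<bar>x\<bar>) / sqrt t * \<bar>s\<bar>"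
      using t A(1) by (intro mult_right_mono divide_right_mono mult_left_mono add_left_mono) auto
    finally show ?thesis .
  qed
  moreover have "0 \<le> 4 * A * (1 + sqrt (8 * T))" using A(1) T_pos by simp
  ultimately show thesis using that by blast
qed

definition quot :: "nat \<Rightarrow> real \<times> real \<Rightarrow> real" where
  "quot n z = (Q (z + (0, inverse (real (Suc n)))) - Q z) / inverse (real (Suc n))"

text \<open>The spatial derivative of \<open>q0\<close> as a pointwise limit of quotients, which
  makes its measurability immediate; the differentiability contained in \<open>heat_solution\<close>
  guarantees convergence for 0 < t < T.\<close>

definition dq :: "real \<times> real \<Rightarrow> real" where
  "dq z = indicator ({0<..<T} \<times> UNIV) z * lim (\<lambda>n. quot n z)"

lemma quot_measurable [measurable]: "quot n \<in> borel_measurable borel"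
proof -
  have "(\<lambda>z. Q (z + (0, inverse (real (Suc n))))) \<in> borel_measurable borel" by measurable
  then show ?thesis unfolding quot_def[abs_def] by measurable
qed

lemma open_strip_borel: "{0<..<T} \<times> (UNIV :: real set) \<in> sets borel"
  by (intro borel_open open_Times) auto

lemma dq_measurable [measurable]: "dq \<in> borel_measurable borel"
  unfolding dq_def[abs_def] using open_strip_borel by measurable

lemma quot_eq: "0 \<le> t \<Longrightarrow> t \<le> T \<Longrightarrow> quot n (t, x) = (q0 (t, x + inverse (real (Suc n))) - q0 (t, x)) / inverse (real (Suc n))"
  by (simp add: quot_def)

lemma quot_tendsto:
  assumes t: "0 < t" "t < T" shows "(\<lambda>n. quot n (t, x)) \<longlonglongrightarrow> dq (t, x)"
proof -
  obtain q' where q': "\<And>y. ((\<lambda>z. q0 (t, z)) has_real_derivative q' y) (at y)"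
    using heat t unfolding heat_solution_def by (metis greaterThanLessThan_iff)
  have "filterlim (\<lambda>n. inverse (real (Suc n))) (at 0) sequentially"
    using LIMSEQ_inverse_real_of_nat by (intro filterlim_atI) auto
  from filterlim_compose[OF DERIV_D[OF q'] this]
  have "(\<lambda>n. (q0 (t, x + inverse (real (Suc n))) - q0 (t, x)) / inverse (real (Suc n))) \<longlonglongrightarrow> q' x" .
  then have l: "(\<lambda>n. quot n (t, x)) \<longlonglongrightarrow> q' x" using quot_eq[of t _ x] t by simp
  then have "dq (t, x) = q' x" using t by (simp add: dq_def limI)
  with l show ?thesis by simp
qed

lemma dq_bound:
  obtains C where "C \<ge> 0" "\<And>z. \<bar>dq z\<bar> \<le> C * (indicator {0<..<T} (fst z) * (1 / sqrt (fst z))) * (1 + \<bar>snd z\<bar>)"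
    "\<And>n t x. 0 < t \<Longrightarrow> t \<le> T \<Longrightarrow> inverse (real (Suc n)) \<le> sqrt t \<Longrightarrow> \<bar>quot n (t, x)\<bar> \<le> C * (1 + \<bar>x\<bar>) / sqrt t"
proof -
  obtain C where C: "C \<ge> 0"
    "\<And>t x s. 0 < t \<Longrightarrow> t \<le> T \<Longrightarrow> \<bar>s\<bar> \<le> sqrt t \<Longrightarrow> \<bar>q0 (t, x + s) - q0 (t, x)\<bar> \<le> C * (1 + \<bar>x\<bar>) / sqrt t * \<bar>s\<bar>"
    using q0_diff_bound by metis
  have qb: "\<bar>quot n (t, x)\<bar> \<le> C * (1 + \<bar>x\<bar>) / sqrt t" if "0 < t" "t \<le> T" "inverse (real (Suc n)) \<le> sqrt t" for n t x
  proof -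
    let ?s = "inverse (real (Suc n))"
    have s: "0 < ?s" by simp
    have "\<bar>q0 (t, x + ?s) - q0 (t, x)\<bar> \<le> C * (1 + \<bar>x\<bar>) / sqrt t * ?s"
      using C(2)[OF that(1,2), of ?s x] that(3) s by simp
    then have "\<bar>q0 (t, x + ?s) - q0 (t, x)\<bar> / ?s \<le> C * (1 + \<bar>x\<bar>) / sqrt t"
      by (subst pos_divide_le_eq[OF s])
    moreover have "\<bar>quot n (t, x)\<bar> = \<bar>q0 (t, x + ?s) - q0 (t, x)\<bar> / ?s"
      using quot_eq[of t n x] that s by (simp only: abs_divide abs_of_pos less_imp_le)
    ultimately show ?thesis by linarith
  qed
  have "\<bar>dq (t, x)\<bar> \<le> C * (indicator {0<..<T} t * (1 / sqrt t)) * (1 + \<bar>x\<bar>)" for t x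
  proof (cases "t \<in> {0<..<T}")
    case True
    then have t: "0 < t" "t < T" by auto
    have "\<forall>\<^sub>F n in sequentially. inverse (real (Suc n)) < sqrt t"
      by (rule order_tendstoD(2)[OF LIMSEQ_inverse_real_of_nat]) (use t in simp)
    then have "\<forall>\<^sub>F n in sequentially. \<bar>quot n (t, x)\<bar> \<le> C * (1 + \<bar>x\<bar>) / sqrt t"
      by eventually_elim (rule qb, use t in auto)
    then have "\<bar>dq (t, x)\<bar> \<le> C * (1 + \<bar>x\<bar>) / sqrt t"
      by (rule tendsto_upperbound[OF tendsto_rabs[OF quot_tendsto[OF t]]]) simp
    then show ?thesis using True by simp
  next
    case False
    then show ?thesis by (simp add: dq_def)
  qed
  then show thesis using that[of C] C(1) qb by (metis prod.collapse)
qed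

text \<open>The compact set may touch t = 0, where the bound is singular; the majorant is the
  product of the integrable t^(-1/2) and a bounded cut-off in x.\<close>

lemma dq_L1_loc: "S \<subseteq> strip \<Longrightarrow> L1_loc S dq"
proof (rule L1_loc_borel)
  fix K assume S: "S \<subseteq> strip" and K: "compact K" "K \<subseteq> S"
  then have b: "K \<in> sets borel" by (auto intro: borel_closed compact_imp_closed)
  from compact_imp_bounded[OF K(1)] obtain R where R: "\<And>z. z \<in> K \<Longrightarrow> norm z \<le> R" unfolding bounded_iff by blast
  obtain C where C: "C \<ge> 0" "\<And>z. \<bar>dq z\<bar> \<le> C * (indicator {0<..<T} (fst z) * (1 / sqrt (fst z))) * (1 + \<bar>snd z\<bar>)"
    using dq_bound by metis
  show "integrable lborel (\<lambda>z. indicator K z * dq z)"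
  proof (rule Bochner_Integration.integrable_bound)
    show "integrable lborel (\<lambda>z. (indicator {0<..<T} (fst z) * (1 / sqrt (fst z))) * (C * (1 + R) * indicator {-R..R} (snd z)))"
      by (rule integrable_plane_product[OF integrable_inverse_sqrt[OF T_pos]])
         (intro integrable_mult_right integrable_real_indicator, auto simp: emeasure_lborel_Icc_eq)
    have "norm (indicator K z * dq z) \<le> norm ((indicator {0<..<T} (fst z) * (1 / sqrt (fst z))) * (C * (1 + R) * indicator {-R..R} (snd z)))" for z
    proof (cases "z \<in> K")
      case True
      have r: "\<bar>snd z\<bar> \<le> R" using R[OF True] norm_snd_le[of "snd z" "fst z"] by simp
      have nn: "0 \<le> indicator {0<..<T} (fst z) * (1 / sqrt (fst z))" by (auto split: split_indicator)
      have "\<bar>dq z\<bar> \<le> C * (indicator {0<..<T} (fst z) * (1 / sqrt (fst z))) * (1 + \<bar>snd z\<bar>)" by (rule C)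
      also have "\<dots> \<le> C * (indicator {0<..<T} (fst z) * (1 / sqrt (fst z))) * (1 + R)"
        by (rule mult_left_mono[OF _ mult_nonneg_nonneg[OF C(1) nn]]) (use r in simp)
      also have "\<dots> = (indicator {0<..<T} (fst z) * (1 / sqrt (fst z))) * (C * (1 + R) * indicator {-R..R} (snd z))"
        using r by (simp add: abs_le_iff)
      finally have "\<bar>dq z\<bar> \<le> norm ((indicator {0<..<T} (fst z) * (1 / sqrt (fst z))) * (C * (1 + R) * indicator {-R..R} (snd z)))"
        unfolding real_norm_def by (rule order_trans[OF _ abs_ge_self])
      moreover have "norm (indicator K z * dq z) = \<bar>dq z\<bar>" using True by simp
      ultimately show ?thesis by (simp only:)
    qed simp
    then show "AE z in lborel. norm (indicator K z * dq z) \<le> norm ((indicator {0<..<T} (fst z) * (1 / sqrt (fst z))) * (C * (1 + R) * indicator {-R..R} (snd z)))" by simp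
  qed (use b in measurable)
qed

text \<open>Summation by parts at the level of quotients: a translation moves the forward quotient
  of \<open>Q\<close> to a backward quotient of \<phi>, and both sides have limits.\<close>

lemma q0_weak_deriv:
  assumes tf: "test_function ({0<..<T} \<times> UNIV) \<phi>"
  shows "(LINT z|lborel. Q z * partial_deriv (0, 1) \<phi> z) = - (LINT z|lborel. dq z * \<phi> z)"
proof -
  let ?\<phi>x = "partial_deriv (0, 1) \<phi>"
  let ?s = "\<lambda>n. inverse (real (Suc n))"
  let ?c = "\<lambda>n. (0::real, ?s n)"
  note tfx = test_function_partial_deriv[OF tf plane_Basis(2)]
  obtain \<delta> R where \<delta>: "\<delta> > 0" "R \<ge> 0" and z0: "\<And>z. z \<notin> {\<delta>..T - \<delta>} \<times> {-R..R} \<Longrightarrow> \<phi> z = 0"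
    using strip_test_function_support[OF tf] by metis
  \<comment> \<open>The second box is widened in x by 1, the largest step, to contain the shifted
    supports.\<close>
  let ?S = "{\<delta>..T - \<delta>} \<times> {-R..R}" and ?S' = "{\<delta>..T - \<delta>} \<times> {-R - 1..R + 1}"
  have coS: "compact ?S" and coS': "compact ?S'" by (auto intro!: compact_Times)
  have subS': "?S' \<subseteq> strip" using \<delta> by auto
  have \<phi>m [measurable]: "\<phi> \<in> borel_measurable borel" "?\<phi>x \<in> borel_measurable borel" using tf tfx by (auto intro: test_function_measurable)
  obtain D where D: "\<And>z. \<bar>\<phi> z\<bar> \<le> D" using test_function_bounded[OF tf] by metis
  obtain D' where D': "\<And>z. \<bar>?\<phi>x z\<bar> \<le> D'" using test_function_bounded[OF tfx] by metis
  obtain C where C: "C \<ge> 0" "\<And>n t x. 0 < t \<Longrightarrow> t \<le> T \<Longrightarrow> ?s n \<le> sqrt t \<Longrightarrow> \<bar>quot n (t, x)\<bar> \<le> C * (1 + \<bar>x\<bar>) / sqrt t"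
    using dq_bound by metis
  have s01: "0 < ?s n" "?s n \<le> 1" for n by (auto simp: inverse_le_1_iff)
  have lim1: "(\<lambda>n. LINT z|lborel. quot n z * \<phi> z) \<longlonglongrightarrow> (LINT z|lborel. dq z * \<phi> z)"
  proof (rule tendsto_integral_local[OF quot_measurable dq_measurable \<phi>m(1) \<phi>m(1) coS _ tendsto_const, where D = D and C = "C * (1 + R) / sqrt \<delta>"])
    show "AE z in lborel. z \<in> ?S \<longrightarrow> (\<lambda>n. quot n z) \<longlonglongrightarrow> dq z"
      by (rule AE_I2) (use \<delta> quot_tendsto in auto)
    have "\<forall>\<^sub>F n in sequentially. ?s n < sqrt \<delta>"
      by (rule order_tendstoD(2)[OF LIMSEQ_inverse_real_of_nat]) (use \<delta> in simp)
    then show "\<forall>\<^sub>F n in sequentially. AE z in lborel. z \<in> ?S \<longrightarrow> \<bar>quot n z\<bar> \<le> C * (1 + R) / sqrt \<delta>"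
    proof eventually_elim
      case (elim n)
      have "\<bar>quot n (t, x)\<bar> \<le> C * (1 + R) / sqrt \<delta>" if z: "(t, x) \<in> ?S" for t x
      proof -
        have t: "0 < t" "t \<le> T" "\<delta> \<le> t" and x: "\<bar>x\<bar> \<le> R" using z \<delta> by auto
        have "sqrt \<delta> \<le> sqrt t" using t by simp
        then have "\<bar>quot n (t, x)\<bar> \<le> C * (1 + \<bar>x\<bar>) / sqrt t" using elim by (intro C(2) t) linarith
        also have "\<dots> \<le> C * (1 + R) / sqrt \<delta>"
          using C(1) x \<delta> t by (intro frac_le mult_left_mono) auto
        finally show ?thesis .
      qed
      then show ?case by (intro AE_I2) auto
    qed
    have "\<bar>\<phi> z\<bar> \<le> D \<and> (z \<notin> ?S \<longrightarrow> \<phi> z = 0)" for z using D[of z] z0[of z] by (intro conjI impI)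
    then show "\<forall>\<^sub>F n in sequentially. \<forall>z. \<bar>\<phi> z\<bar> \<le> D \<and> (z \<notin> ?S \<longrightarrow> \<phi> z = 0)" by (intro always_eventually allI)
  qed
  have "compact (q0 ` ?S')" by (intro compact_continuous_image coS' continuous_on_subset[OF q_cont subS'])
  from compact_imp_bounded[OF this] obtain B where B: "\<forall>z\<in>?S'. \<bar>q0 z\<bar> \<le> B" unfolding bounded_iff by auto
  have QB: "\<bar>Q z\<bar> \<le> B" if "z \<in> ?S'" for z
  proof -
    have "z \<in> strip" using that subS' by blast
    then have "Q z = q0 z" by simp
    then show ?thesis using bspec[OF B that] by (simp only:)
  qed
  have out: "\<phi> (z - ?c n) = 0" if "z \<notin> ?S'" for z n
  proof (rule z0, rule notI)
    assume "z - ?c n \<in> ?S"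
    then have 1: "fst z \<in> {\<delta>..T - \<delta>}" and "snd z - ?s n \<in> {-R..R}" by (auto simp: mem_Times_iff)
    then have "snd z \<in> {-R - 1..R + 1}" using s01(1)[of n] s01(2)[of n] unfolding atLeastAtMost_iff by linarith
    with 1 have "z \<in> ?S'" by (simp add: mem_Times_iff)
    with that show False by blast
  qed
  have out0: "\<phi> z = 0" if "z \<notin> ?S'" for z
  proof (rule z0, rule notI)
    assume "z \<in> ?S"
    then have "z \<in> ?S'" by auto
    with that show False by blast
  qed
  have qlim: "(\<lambda>n. (\<phi> (z - ?c n) - \<phi> z) / ?s n) \<longlonglongrightarrow> - ?\<phi>x z" for z
  proof -
    have "filterlim (\<lambda>n. - ?s n) (at 0) sequentially"
      using tendsto_minus[OF LIMSEQ_inverse_real_of_nat] by (intro filterlim_atI) auto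
    from filterlim_compose[OF DERIV_D[OF test_function_partial_DERIV[OF tf plane_Basis(2), of z 0]] this]
    have "(\<lambda>n. (\<phi> (z + (0 + - ?s n) *\<^sub>R (0, 1)) - \<phi> (z + 0 *\<^sub>R (0, 1))) / (- ?s n)) \<longlonglongrightarrow> ?\<phi>x (z + 0 *\<^sub>R (0, 1))" .
    moreover have "z + (0 + - ?s n) *\<^sub>R (0, 1) = z - ?c n" "z + 0 *\<^sub>R (0, 1) = z" for n
      by (simp_all add: prod_eq_iff)
    ultimately have "(\<lambda>n. (\<phi> (z - ?c n) - \<phi> z) / (- ?s n)) \<longlonglongrightarrow> ?\<phi>x z" by (simp only:)
    from tendsto_minus[OF this] show ?thesis by (simp only: minus_divide_right minus_minus)
  qed
  have qbound: "\<bar>(\<phi> (z - ?c n) - \<phi> z) / ?s n\<bar> \<le> D'" for n z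
  proof -
    obtain r where "\<phi> (z + 0 *\<^sub>R (0, 1)) - \<phi> (z + (- ?s n) *\<^sub>R (0, 1)) = (0 - (- ?s n)) * ?\<phi>x (z + r *\<^sub>R (0, 1))"
      using MVT2[of "- ?s n" 0 "\<lambda>s. \<phi> (z + s *\<^sub>R (0, 1))" "\<lambda>r. ?\<phi>x (z + r *\<^sub>R (0, 1))"]
        test_function_partial_DERIV[OF tf plane_Basis(2)] s01(1)[of n] by auto
    moreover have "z + (- ?s n) *\<^sub>R (0, 1) = z - ?c n" "z + 0 *\<^sub>R (0, 1) = z" by (simp_all add: prod_eq_iff)
    ultimately have "\<phi> z - \<phi> (z - ?c n) = ?s n * ?\<phi>x (z + r *\<^sub>R (0, 1))" by (simp only: diff_0 minus_minus)
    then have "\<phi> (z - ?c n) - \<phi> z = - ?\<phi>x (z + r *\<^sub>R (0, 1)) * ?s n" by (simp only: mult.commute mult_minus_right)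
    then have "(\<phi> (z - ?c n) - \<phi> z) / ?s n = - ?\<phi>x (z + r *\<^sub>R (0, 1))"
      using s01(1)[of n] by (simp only: nonzero_mult_div_cancel_right less_imp_neq[symmetric] simp_thms)
    then show ?thesis using D' by simp
  qed
  have lim2: "(\<lambda>n. LINT z|lborel. Q z * ((\<phi> (z - ?c n) - \<phi> z) / ?s n)) \<longlonglongrightarrow> (LINT z|lborel. Q z * (- ?\<phi>x z))"
  proof (rule tendsto_integral_local[OF Q_measurable Q_measurable _ _ coS' _ qlim, where C = B and D = D'])
    show "AE z in lborel. z \<in> ?S' \<longrightarrow> (\<lambda>n. Q z) \<longlonglongrightarrow> Q z" by simp
    show "\<forall>\<^sub>F n in sequentially. AE z in lborel. z \<in> ?S' \<longrightarrow> \<bar>Q z\<bar> \<le> B"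
      by (intro always_eventually allI AE_I2 impI QB)
    have "\<bar>(\<phi> (z - ?c n) - \<phi> z) / ?s n\<bar> \<le> D' \<and> (z \<notin> ?S' \<longrightarrow> (\<phi> (z - ?c n) - \<phi> z) / ?s n = 0)" for z n
    proof (intro conjI impI qbound)
      assume "z \<notin> ?S'"
      from out[OF this] out0[OF this] show "(\<phi> (z - ?c n) - \<phi> z) / ?s n = 0" by simp
    qed
    then show "\<forall>\<^sub>F n in sequentially. \<forall>z. \<bar>(\<phi> (z - ?c n) - \<phi> z) / ?s n\<bar> \<le> D' \<and> (z \<notin> ?S' \<longrightarrow> (\<phi> (z - ?c n) - \<phi> z) / ?s n = 0)"
      by (intro always_eventually allI)
  qed measurable
  have "(LINT z|lborel. quot n z * \<phi> z) = (LINT z|lborel. Q z * ((\<phi> (z - ?c n) - \<phi> z) / ?s n))" for n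
  proof -
    have \<phi>c: "(\<lambda>z. \<phi> (z - ?c n)) \<in> borel_measurable borel" by measurable
    have i1: "integrable lborel (\<lambda>z. Q z * \<phi> (z - ?c n))"
      by (rule integrable_local_mult[OF Q_measurable \<phi>c coS' QB D out])
    have i2: "integrable lborel (\<lambda>z. Q z * \<phi> z)"
      by (rule integrable_local_mult[OF Q_measurable \<phi>m(1) coS' QB D out0])
    have e: "?c n + z = z + ?c n" "z + ?c n - ?c n = z" for z by simp_all
    have i3: "integrable lborel (\<lambda>z. Q (z + ?c n) * \<phi> z)"
      using lborel_integrable_translate[OF i1, of "?c n"] unfolding e .
    have "(LINT z|lborel. Q z * \<phi> (z - ?c n)) = (LINT z|lborel. Q (?c n + z) * \<phi> (?c n + z - ?c n))"
      by (rule lborel_integral_translate[symmetric]) (use \<phi>c in measurable)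
    then have sh: "(LINT z|lborel. Q z * \<phi> (z - ?c n)) = (LINT z|lborel. Q (z + ?c n) * \<phi> z)"
      unfolding e .
    have "(LINT z|lborel. quot n z * \<phi> z) = (LINT z|lborel. (Q (z + ?c n) * \<phi> z - Q z * \<phi> z) / ?s n)"
      unfolding quot_def by (intro Bochner_Integration.integral_cong refl) (simp only: left_diff_distrib times_divide_eq_left)
    also have "\<dots> = ((LINT z|lborel. Q (z + ?c n) * \<phi> z) - (LINT z|lborel. Q z * \<phi> z)) / ?s n"
      unfolding integral_divide_zero Bochner_Integration.integral_diff[OF i3 i2] ..
    also have "\<dots> = (LINT z|lborel. (Q z * \<phi> (z - ?c n) - Q z * \<phi> z) / ?s n)"
      unfolding sh[symmetric] integral_divide_zero Bochner_Integration.integral_diff[OF i1 i2] ..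
    also have "\<dots> = (LINT z|lborel. Q z * ((\<phi> (z - ?c n) - \<phi> z) / ?s n))"
      by (intro Bochner_Integration.integral_cong refl) (simp only: right_diff_distrib times_divide_eq_right)
    finally show ?thesis .
  qed
  then have "(LINT z|lborel. dq z * \<phi> z) = (LINT z|lborel. Q z * (- ?\<phi>x z))"
    using LIMSEQ_unique[OF lim1] lim2 by simp
  then show ?thesis by simp
qed

lemma further_regularity:
  "(\<exists>d. has_weak_deriv (0, 1) ({0<..<T} \<times> UNIV) f0 d \<and> L2 strip d) \<and>
   (\<exists>d. has_weak_deriv (0, 1) ({0<..<T} \<times> UNIV) p0 d \<and> L1_loc strip d)"
proof (rule f0_weak_deriv)
  fix df assume dfm: "df \<in> borel_measurable borel" and df2: "integrable lborel (\<lambda>z. (df z)\<^sup>2)"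
    and df: "\<And>\<phi>. test_function ({0<..<T} \<times> UNIV) \<phi> \<Longrightarrow>
      (LINT z|lborel. (indicator strip z * f0 z) * partial_deriv (0, 1) \<phi> z) = - (LINT z|lborel. df z * \<phi> z)"
  note loc = L2_L1_loc[OF dfm df2]
  have "has_weak_deriv (0, 1) ({0<..<T} \<times> UNIV) f0 df"
    by (rule weak_deriv_plane[OF f_cont dfm loc df])
  moreover have "L2 strip df"
  proof -
    have "integrable lborel (\<lambda>z. indicator strip z *\<^sub>R (df z)\<^sup>2)" by (rule integrable_mult_indicator[OF _ df2]) simp
    moreover have "df \<in> borel_measurable (lebesgue_on strip)"
      by (intro measurable_restrict_space1 borel_measurable_lebesgueI dfm)
    ultimately show ?thesis
      unfolding L2_def by (subst integrable_lebesgue_on_borel) (use dfm in auto)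
  qed
  moreover have loc': "L1_loc S (\<lambda>z. dq z - df z)" if "S \<subseteq> strip" for S
    using dq_L1_loc[OF that] loc[of S] by (simp add: L1_loc_def)
  moreover have "has_weak_deriv (0, 1) ({0<..<T} \<times> UNIV) p0 (\<lambda>z. dq z - df z)"
  proof (rule weak_deriv_plane[OF p_cont])
    show "(\<lambda>z. dq z - df z) \<in> borel_measurable borel" using dfm by measurable
    show "L1_loc ({0<..<T} \<times> UNIV) (\<lambda>z. dq z - df z)" by (rule loc') auto
    fix \<phi> :: "real \<times> real \<Rightarrow> real" assume tf: "test_function ({0<..<T} \<times> UNIV) \<phi>"
    let ?\<phi>x = "partial_deriv (0, 1) \<phi>"
    let ?F = "\<lambda>z. indicator strip z * f0 z"
    note tfx = test_function_partial_deriv[OF tf plane_Basis(2)]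
    obtain \<delta> R where \<delta>: "\<delta> > 0" "R \<ge> 0" and z0: "\<And>z. z \<notin> {\<delta>..T - \<delta>} \<times> {-R..R} \<Longrightarrow> \<phi> z = 0"
      using strip_test_function_support[OF tf] by metis
    let ?S = "{\<delta>..T - \<delta>} \<times> {-R..R}"
    have clS: "closed ?S" and coS: "compact ?S" by (auto intro!: closed_Times compact_Times)
    have subS: "?S \<subseteq> strip" using \<delta> by auto
    have zx: "?\<phi>x z = 0" if "z \<notin> ?S" for z by (rule partial_deriv_zero_outside[OF clS z0 that])
    have \<phi>m: "\<phi> \<in> borel_measurable borel" "?\<phi>x \<in> borel_measurable borel" using tf tfx by (auto intro: test_function_measurable)
    obtain D where D: "\<And>z. \<bar>\<phi> z\<bar> \<le> D" using test_function_bounded[OF tf] by metis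
    obtain D' where D': "\<And>z. \<bar>?\<phi>x z\<bar> \<le> D'" using test_function_bounded[OF tfx] by metis
    have bS: "?S \<in> sets borel" using clS by (rule borel_closed)
    have int1: "integrable lborel (\<lambda>z. indicator strip z * h z * ?\<phi>x z)" if "continuous_on strip h" for h
    proof -
      have "compact (h ` ?S)" by (intro compact_continuous_image coS continuous_on_subset[OF that subS])
      from compact_imp_bounded[OF this] obtain B where B: "\<forall>z\<in>?S. \<bar>h z\<bar> \<le> B" unfolding bounded_iff by auto
      have hB: "\<bar>indicator strip z * h z\<bar> \<le> B" if "z \<in> ?S" for z
      proof -
        have "z \<in> strip" using that subS by blast
        then have "indicator strip z * h z = h z" by simp
        then show ?thesis using bspec[OF B that] by (simp only:)
      qed
      show ?thesis by (rule integrable_local_mult[OF strip_measurable[OF that] \<phi>m(2) coS hB D' zx])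
    qed
    \<comment> \<open>On the support of \<phi>, which lies in a compact subset of the strip, d is
      integrable and \<phi> is bounded.\<close>
    have int2: "integrable lborel (\<lambda>z. d z * \<phi> z)" if dm: "d \<in> borel_measurable borel" and d: "L1_loc strip d" for d
    proof -
      have "integrable (lebesgue_on ?S) d" using d coS subS by (simp add: L1_loc_def)
      then have i: "integrable lborel (\<lambda>z. indicator ?S z * d z)"
        using dm bS by (subst (asm) integrable_lebesgue_on_borel) auto
      show ?thesis
      proof (rule Bochner_Integration.integrable_bound[OF integrable_mult_left[OF i, of D]])
        have "norm (d z * \<phi> z) \<le> norm (indicator ?S z * d z * D)" for z
        proof (cases "z \<in> ?S")
          case True
          have "\<bar>d z\<bar> * \<bar>\<phi> z\<bar> \<le> \<bar>d z\<bar> * \<bar>D\<bar>" by (intro mult_left_mono order_trans[OF D abs_ge_self]) auto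
          then show ?thesis using True by (simp add: abs_mult)
        next
          case False
          show ?thesis unfolding z0[OF False] by simp
        qed
        then show "AE z in lborel. norm (d z * \<phi> z) \<le> norm (indicator ?S z * d z * D)" by simp
      qed (use dm \<phi>m in measurable)
    qed
    have "(LINT z|lborel. (indicator strip z * p0 z) * ?\<phi>x z) = (LINT z|lborel. Q z * ?\<phi>x z - ?F z * ?\<phi>x z)"
      by (intro Bochner_Integration.integral_cong refl) (simp add: p0_eq algebra_simps)
    also have "\<dots> = (LINT z|lborel. Q z * ?\<phi>x z) - (LINT z|lborel. ?F z * ?\<phi>x z)"
      by (rule Bochner_Integration.integral_diff[OF int1[OF q_cont] int1[OF f_cont]])
    also have "\<dots> = - (LINT z|lborel. dq z * \<phi> z) + (LINT z|lborel. df z * \<phi> z)"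
      unfolding q0_weak_deriv[OF tf] df[OF tf] by simp
    also have "\<dots> = - (LINT z|lborel. dq z * \<phi> z - df z * \<phi> z)"
      unfolding Bochner_Integration.integral_diff[OF int2[OF dq_measurable dq_L1_loc[OF order_refl]] int2[OF dfm loc]] by simp
    also have "\<dots> = - (LINT z|lborel. (dq z - df z) * \<phi> z)" by (simp add: left_diff_distrib)
    finally show "(LINT z|lborel. (indicator strip z * p0 z) * ?\<phi>x z) = - (LINT z|lborel. (dq z - df z) * \<phi> z)" .
  qed
  ultimately show ?thesis by blast
qed

end

theorem theorem16:
  fixes T :: real
    and u_ini :: "real \<Rightarrow> real" and \<xi>_ini :: real
    and e :: "nat \<Rightarrow> real"
    and \<xi>0 :: "real \<Rightarrow> real"
    and q0 f0 p0 :: "real \<times> real \<Rightarrow> real"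
  assumes "T > 0"
    and "admissible_initial_data u_ini \<xi>_ini"
    and "\<And>k. 0 < e k" and "\<And>k. (e k)\<^sup>2 \<le> T" and "e \<longlonglongrightarrow> 0"
    and "Linf_tendsto {0..T} (\<lambda>k. xi_eps (e k) u_ini \<xi>_ini) \<xi>0"
    and "W1_inf T \<xi>0" and "continuous_on {0..T} \<xi>0"
    and "Linf_tendsto ({0..T} \<times> UNIV) (\<lambda>k. q_eps (e k) u_ini \<xi>_ini) q0"
    and "continuous_on ({0..T} \<times> UNIV) q0"
    and "heat_solution T (p_of u_ini \<xi>_ini) q0"
    and "AE z in lebesgue_on ({0..T} \<times> UNIV). (\<lambda>k. f_eps (e k) u_ini \<xi>_ini z) \<longlonglongrightarrow> f0 z"
    and "\<And>K. compact K \<Longrightarrow> K \<subseteq> {0..T} \<times> UNIV \<Longrightarrow>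
           Linf_tendsto K (\<lambda>k. f_eps (e k) u_ini \<xi>_ini) f0"
    and "continuous_on ({0..T} \<times> UNIV) f0"
    and "\<And>z. p0 z = q0 z - f0 z"
    and "AE z in lebesgue_on ({0..T} \<times> UNIV). (\<lambda>k. p_eps (e k) u_ini \<xi>_ini z) \<longlonglongrightarrow> p0 z"
    and "\<And>K. compact K \<Longrightarrow> K \<subseteq> {0..T} \<times> UNIV \<Longrightarrow>
           Linf_tendsto K (\<lambda>k. p_eps (e k) u_ini \<xi>_ini) p0"
  shows
    "(\<forall>\<phi>. test_function ({0<..<T} \<times> UNIV) \<phi> \<longrightarrow>
        (LINT t:{0..T}|lborel. (LINT x|lborel.
           p0 (t, x) * partial_deriv (0, 1) (partial_deriv (0, 1) \<phi>) (t, x)))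
        = - (LINT t:{0..T}|lborel. (LINT x|lborel.
           (p0 (t, x) + sgn (x - \<xi>0 t)) * partial_deriv (1, 0) \<phi> (t, x))))
     \<and> (continuous_on ({0..T} \<times> UNIV) p0 \<and>
        (\<forall>t\<in>{0..T}. (\<forall>x\<le>\<xi>0 t. - 1 \<le> p0 (t, x) \<and> p0 (t, x) \<le> 1) \<and>
                     (\<forall>x\<ge>\<xi>0 t. - 1 \<le> p0 (t, x))))
     \<and> (\<forall>\<xi>0'. has_weak_deriv 1 {0<..<T} \<xi>0 \<xi>0' \<longrightarrow>
          (AE t in lebesgue_on {0..T}. \<xi>0' t \<le> 0) \<and>
          (AE t in lebesgue_on {0..T}. p0 (t, \<xi>0 t) < 1 \<longrightarrow> \<xi>0' t = 0))
     \<and> ((\<exists>d. has_weak_deriv (0, 1) ({0<..<T} \<times> UNIV) f0 d \<and> L2 ({0..T} \<times> UNIV) d) \<and>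
        (\<exists>d. has_weak_deriv (0, 1) ({0<..<T} \<times> UNIV) p0 d \<and> L1_loc ({0..T} \<times> UNIV) d))"
proof -
  interpret sharp_limit T u_ini \<xi>_ini e \<xi>0 q0 f0 p0
    using assms by unfold_locales (auto simp: admissible_initial_data_def)
  show ?thesis
    using weak_form p_cont p_ge p_le flow_rule further_regularity by blast
qed

end
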